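(* Let $M$ be an $m$-dimensional invariant $\xi^{\bot}$-submanifold of a generalized Quasi-Sasakian (G.Q.S.) manifold $\widetilde M$. Then $M$ is totally umbilical if and only if $$h(X,Y)=\frac{1}{m}\,g(X,Y)\,\mathrm{trace}(A_{\xi})\,\xi\quad\text{for all } X,Y\in\Gamma(TM).$$
   Context: All manifolds and maps are smooth; $\Gamma(E)$ denotes the sections of a vector bundle $E$. An almost contact metric structure on a real $(2n+1)$-dimensional manifold $\widetilde{M}$ is $(\phi,\xi,\eta,\tilde g)$, where $\phi$ is a $(1,1)$-tensor field, $\xi$ a vector field, $\eta$ a 1-form and $\tilde g$ a Riemannian metric with $\phi^2=-I+\eta\otimes\xi$, $\eta(\xi)=1$, $\eta\circ\phi=0$, $\phi\xi=0$, $\eta(X)=\tilde g(X,\xi)$, $\tilde g(\phi X,Y)+\tilde g(X,\phi Y)=0$ for all vector fields $X,Y$. Let $\widetilde\nabla$ be the Levi-Civita connection of $\tilde g$. $\widetilde M$ is a generalized Quasi-Sasakian (G.Q.S.) manifold if $(\widetilde\nabla_X\phi)Y=\tilde g(\widetilde\nabla_{\phi X}\xi,Y)\xi-\eta(Y)\widetilde\nabla_{\phi X}\xi$ for all vector fields $X,Y$ on $\widetilde M$. A semi-invariant $\xi^{\bot}$-submanifold of $\widetilde M$ is an isometrically immersed submanifold $M$ such that $\xi$ is orthogonal to $M$ and there exist two orthogonal distributions $\mathcal{D},\mathcal{D}^{\bot}$ in $TM$ with $TM=\mathcal{D}\oplus\mathcal{D}^{\bot}$ (orthogonal sum), $\phi\mathcal{D}=\mathcal{D}$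 and $\phi\mathcal{D}^{\bot}\subseteq TM^{\bot}$, where $TM^{\bot}$ is the normal bundle. It is an invariant $\xi^{\bot}$-submanifold if $\mathcal{D}^{\bot}=\{0\}$. $g$ is the induced metric on $M$, $\nabla$ its Levi-Civita connection, $h$ the second fundamental form ($\widetilde\nabla_XY=\nabla_XY+h(X,Y)$), and $A_N$ the shape operator of a normal section $N$: $\tilde g(h(X,Y),N)=g(A_NX,Y)$. $H=\frac1m\mathrm{trace}(h)$ is the mean curvature vector. $M$ is totally umbilical if $h(X,Y)=g(X,Y)H$ for all $X,Y\in\Gamma(TM)$. *)

theory Defs
  imports "HOL-Analysis.Analysis" "HOL-Library.Function_Algebras"
begin

section \<open>Functions as a real vector space\<close>

instantiation "fun" :: (type, real_vector) real_vector
begin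

definition scaleR_fun :: "real \<Rightarrow> ('a \<Rightarrow> 'b) \<Rightarrow> 'a \<Rightarrow> 'b"
  where "scaleR_fun c f = (\<lambda>x. c *\<^sub>R f x)"

instance
  by standard
    (simp_all add: scaleR_fun_def plus_fun_def fun_eq_iff scaleR_add_right scaleR_add_left)

end

lemma scaleR_fun_apply [simp]: "(c *\<^sub>R f) x = c *\<^sub>R f x"
  by (simp add: scaleR_fun_def)

definition linear_on_subspace :: "'a::real_vector set \<Rightarrow> ('a \<Rightarrow> 'b::real_vector) \<Rightarrow> bool"
  where "linear_on_subspace V T \<longleftrightarrow>
    (\<forall>u\<in>V. \<forall>v\<in>V. T (u + v) = T u + T v) \<and> (\<forall>c. \<forall>u\<in>V. T (c *\<^sub>R u) = c *\<^sub>R T u)"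

text \<open>Trace of an endomorphism of a finite-dimensional subspace; the value does not depend on the
  chosen basis.\<close>

definition trace_on :: "'a::real_vector set \<Rightarrow> ('a \<Rightarrow> 'a) \<Rightarrow> real"
  where "trace_on V T =
    (let b = (SOME b. independent b \<and> span b = V) in \<Sum>v\<in>b. representation b (T v) v)"

text \<open>Trace, with respect to the inner product \<open>q\<close> on \<open>V\<close>, of a (vector-valued) bilinear map; the
  value does not depend on the chosen orthonormal basis.\<close>

definition metric_trace ::
  "'a::real_vector set \<Rightarrow> ('a \<Rightarrow> 'a \<Rightarrow> real) \<Rightarrow> ('a \<Rightarrow> 'a \<Rightarrow> 'b::real_vector) \<Rightarrow> 'b"
  where "metric_trace V q b =
    (let E = (SOME E. finite E \<and> span E = V \<and> (\<forall>u\<in>E. \<forall>v\<in>E. q u v = (if u = v then 1 else 0)))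
     in \<Sum>e\<in>E. b e e)"


section \<open>Smooth manifolds and smooth maps\<close>

text \<open>\<open>smooth_on S f\<close> is meant for open sets \<open>S\<close> of a Euclidean space.\<close>

fun Ck_on :: "nat \<Rightarrow> 'a::real_normed_vector set \<Rightarrow> ('a \<Rightarrow> 'b::real_normed_vector) \<Rightarrow> bool" where
  "Ck_on 0 S f = continuous_on S f"
| "Ck_on (Suc k) S f =
    (f differentiable_on S \<and> (\<forall>v. Ck_on k S (\<lambda>x. frechet_derivative f (at x) v)))"

definition smooth_on :: "'a::real_normed_vector set \<Rightarrow> ('a \<Rightarrow> 'b::real_normed_vector) \<Rightarrow> bool"
  where "smooth_on S f \<longleftrightarrow> (\<forall>k. Ck_on k S f)"

text \<open>A chart is a pair of a domain and a coordinate map; outside its domain the coordinate map is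
  irrelevant. The points of a manifold are the elements of a type; its dimension is the dimension of
  the Euclidean space in which the charts take their values.\<close>

type_synonym ('p, 'e) atlas = "('p set \<times> ('p \<Rightarrow> 'e)) set"

definition smooth_atlas :: "('p::topological_space, 'e::euclidean_space) atlas \<Rightarrow> bool"
  where "smooth_atlas A \<longleftrightarrow>
    (\<forall>(U, x)\<in>A. open U \<and> open (x ` U) \<and> (\<exists>y. homeomorphism U (x ` U) x y)) \<and>
    (\<Union>(U, x)\<in>A. U) = UNIV \<and>
    (\<forall>(U, x)\<in>A. \<forall>(V, y)\<in>A. smooth_on (x ` (U \<inter> V)) (\<lambda>z. y (inv_into U x z)))"

definition euclidean_atlas :: "('e::euclidean_space, 'e) atlas"
  where "euclidean_atlas = {(UNIV, \<lambda>x. x)}"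

definition smooth_map_on ::
  "('p::topological_space, 'e::euclidean_space) atlas \<Rightarrow> ('q::topological_space, 'f::euclidean_space) atlas
    \<Rightarrow> 'p set \<Rightarrow> ('p \<Rightarrow> 'q) \<Rightarrow> bool"
  where "smooth_map_on A B S F \<longleftrightarrow> open S \<and> continuous_on S F \<and>
    (\<forall>(U, x)\<in>A. \<forall>(V, y)\<in>B. smooth_on (x ` (S \<inter> U \<inter> F -` V)) (\<lambda>z. y (F (inv_into U x z))))"

abbreviation smooth_fun_on ::
  "('p::topological_space, 'e::euclidean_space) atlas \<Rightarrow> 'p set \<Rightarrow> ('p \<Rightarrow> real) \<Rightarrow> bool"
  where "smooth_fun_on A S f \<equiv> smooth_map_on A euclidean_atlas S f"

definition smooth_near ::
  "('p::topological_space, 'e::euclidean_space) atlas \<Rightarrow> 'p \<Rightarrow> ('p \<Rightarrow> real) \<Rightarrow> bool"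
  where "smooth_near A p f \<longleftrightarrow> (\<exists>U. p \<in> U \<and> smooth_fun_on A U f)"


section \<open>Tangent vectors and vector fields\<close>

text \<open>A tangent vector at \<open>p\<close> is the velocity of a smooth curve through \<open>p\<close>, regarded as a directional
  derivative of real functions that are smooth near \<open>p\<close>. On all other functions it is set to \<open>0\<close>, so
  that two tangent vectors are equal iff they agree on the functions smooth near \<open>p\<close>.\<close>

type_synonym 'p tvec = "('p \<Rightarrow> real) \<Rightarrow> real"

definition velocity ::
  "('p::topological_space, 'e::euclidean_space) atlas \<Rightarrow> (real \<Rightarrow> 'p) \<Rightarrow> 'p tvec"
  where "velocity A c = (\<lambda>f. if smooth_near A (c 0) f then deriv (\<lambda>t. f (c t)) 0 else 0)"

definition tangent_space ::
  "('p::topological_space, 'e::euclidean_space) atlas \<Rightarrow> 'p \<Rightarrow> 'p tvec set"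
  where "tangent_space A p =
    {velocity A c | c. c 0 = p \<and> (\<exists>e>0. smooth_map_on euclidean_atlas A {-e<..<e} c)}"

text \<open>The differential at \<open>p\<close> of a map \<open>F\<close> into the manifold with atlas \<open>B\<close>.\<close>

definition differential ::
  "('q::topological_space, 'f::euclidean_space) atlas \<Rightarrow> ('p \<Rightarrow> 'q) \<Rightarrow> 'p \<Rightarrow> 'p tvec \<Rightarrow> 'q tvec"
  where "differential B F p v = (\<lambda>f. if smooth_near B (F p) f then v (\<lambda>q. f (F q)) else 0)"

text \<open>Smooth sections of the pull-back of the tangent bundle of the target under \<open>F\<close>.\<close>

definition sections_along ::
  "('p::topological_space, 'e::euclidean_space) atlas \<Rightarrow> ('q::topological_space, 'f::euclidean_space) atlas
    \<Rightarrow> ('p \<Rightarrow> 'q) \<Rightarrow> ('p \<Rightarrow> 'q tvec) set"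
  where "sections_along A B F =
    {W. (\<forall>p. W p \<in> tangent_space B (F p)) \<and>
        (\<forall>V f. smooth_fun_on B V f \<longrightarrow> smooth_fun_on A (F -` V) (\<lambda>p. W p f))}"

definition vector_fields ::
  "('p::topological_space, 'e::euclidean_space) atlas \<Rightarrow> ('p \<Rightarrow> 'p tvec) set"
  where "vector_fields A = sections_along A A (\<lambda>p. p)"

definition lie_bracket ::
  "('p::topological_space, 'e::euclidean_space) atlas
    \<Rightarrow> ('p \<Rightarrow> 'p tvec) \<Rightarrow> ('p \<Rightarrow> 'p tvec) \<Rightarrow> 'p \<Rightarrow> 'p tvec"
  where "lie_bracket A X Y = (\<lambda>p f.
    if smooth_near A p f then X p (\<lambda>q. Y q f) - Y p (\<lambda>q. X q f) else 0)"


section \<open>Tensor fields, metrics and connections\<close>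

text \<open>Tensor fields are functions on the tangent spaces; their values on arguments that are not
  tangent vectors at the given point are irrelevant. They are smooth iff they yield smooth results
  on smooth vector fields.\<close>

definition riemannian_metric ::
  "('p::topological_space, 'e::euclidean_space) atlas \<Rightarrow> ('p \<Rightarrow> 'p tvec \<Rightarrow> 'p tvec \<Rightarrow> real) \<Rightarrow> bool"
  where "riemannian_metric A g \<longleftrightarrow>
    (\<forall>p. \<forall>u\<in>tangent_space A p. linear_on_subspace (tangent_space A p) (g p u)) \<and>
    (\<forall>p. \<forall>u\<in>tangent_space A p. \<forall>v\<in>tangent_space A p. g p u v = g p v u) \<and>
    (\<forall>p. \<forall>u\<in>tangent_space A p. u \<noteq> 0 \<longrightarrow> g p u u > 0) \<and>
    (\<forall>X\<in>vector_fields A. \<forall>Y\<in>vector_fields A. smooth_fun_on A UNIV (\<lambda>p. g p (X p) (Y p)))"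

definition endomorphism_field ::
  "('p::topological_space, 'e::euclidean_space) atlas \<Rightarrow> ('p \<Rightarrow> 'p tvec \<Rightarrow> 'p tvec) \<Rightarrow> bool"
  where "endomorphism_field A T \<longleftrightarrow>
    (\<forall>p. T p ` tangent_space A p \<subseteq> tangent_space A p \<and> linear_on_subspace (tangent_space A p) (T p)) \<and>
    (\<forall>X\<in>vector_fields A. (\<lambda>p. T p (X p)) \<in> vector_fields A)"

definition one_form ::
  "('p::topological_space, 'e::euclidean_space) atlas \<Rightarrow> ('p \<Rightarrow> 'p tvec \<Rightarrow> real) \<Rightarrow> bool"
  where "one_form A \<omega> \<longleftrightarrow>
    (\<forall>p. linear_on_subspace (tangent_space A p) (\<omega> p)) \<and>
    (\<forall>X\<in>vector_fields A. smooth_fun_on A UNIV (\<lambda>p. \<omega> p (X p)))"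

text \<open>A covariant derivative on the vector bundle with space of sections \<open>\<Gamma>\<close>.\<close>

definition covariant_derivative ::
  "('p::topological_space, 'e::euclidean_space) atlas \<Rightarrow> ('p \<Rightarrow> 'v::real_vector) set
    \<Rightarrow> (('p \<Rightarrow> 'p tvec) \<Rightarrow> ('p \<Rightarrow> 'v) \<Rightarrow> 'p \<Rightarrow> 'v) \<Rightarrow> bool"
  where "covariant_derivative A \<Gamma> D \<longleftrightarrow>
    (\<forall>X\<in>vector_fields A. \<forall>W\<in>\<Gamma>. D X W \<in> \<Gamma>) \<and>
    (\<forall>X\<in>vector_fields A. \<forall>Y\<in>vector_fields A. \<forall>W\<in>\<Gamma>. D (X + Y) W = D X W + D Y W) \<and>
    (\<forall>f. \<forall>X\<in>vector_fields A. \<forall>W\<in>\<Gamma>. smooth_fun_on A UNIV f \<longrightarrow>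
      D (\<lambda>p. f p *\<^sub>R X p) W = (\<lambda>p. f p *\<^sub>R D X W p)) \<and>
    (\<forall>X\<in>vector_fields A. \<forall>W\<in>\<Gamma>. \<forall>Z\<in>\<Gamma>. D X (W + Z) = D X W + D X Z) \<and>
    (\<forall>f. \<forall>X\<in>vector_fields A. \<forall>W\<in>\<Gamma>. smooth_fun_on A UNIV f \<longrightarrow>
      D X (\<lambda>p. f p *\<^sub>R W p) = (\<lambda>p. X p f *\<^sub>R W p + f p *\<^sub>R D X W p))"

definition levi_civita ::
  "('p::topological_space, 'e::euclidean_space) atlas \<Rightarrow> ('p \<Rightarrow> 'p tvec \<Rightarrow> 'p tvec \<Rightarrow> real)
    \<Rightarrow> (('p \<Rightarrow> 'p tvec) \<Rightarrow> ('p \<Rightarrow> 'p tvec) \<Rightarrow> 'p \<Rightarrow> 'p tvec) \<Rightarrow> bool"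
  where "levi_civita A g D \<longleftrightarrow>
    covariant_derivative A (vector_fields A) D \<and>
    (\<forall>X\<in>vector_fields A. \<forall>Y\<in>vector_fields A. D X Y - D Y X = lie_bracket A X Y) \<and>
    (\<forall>X\<in>vector_fields A. \<forall>Y\<in>vector_fields A. \<forall>Z\<in>vector_fields A. \<forall>p.
      X p (\<lambda>q. g q (Y q) (Z q)) = g p (D X Y p) (Z p) + g p (Y p) (D X Z p))"

text \<open>The connection induced by \<open>D\<close> on the pull-back bundle under \<open>F\<close>. It gives the meaning of
  \<open>D X W\<close> when \<open>X\<close> is a vector field on the source and \<open>W\<close> is a vector field along \<open>F\<close>.\<close>

definition pullback_connection ::
  "('p::topological_space, 'e::euclidean_space) atlas \<Rightarrow> ('q::topological_space, 'f::euclidean_space) atlas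
    \<Rightarrow> ('p \<Rightarrow> 'q) \<Rightarrow> (('q \<Rightarrow> 'q tvec) \<Rightarrow> ('q \<Rightarrow> 'q tvec) \<Rightarrow> 'q \<Rightarrow> 'q tvec)
    \<Rightarrow> (('p \<Rightarrow> 'p tvec) \<Rightarrow> ('p \<Rightarrow> 'q tvec) \<Rightarrow> 'p \<Rightarrow> 'q tvec) \<Rightarrow> bool"
  where "pullback_connection A B F D D' \<longleftrightarrow>
    covariant_derivative A (sections_along A B F) D' \<and>
    (\<forall>X\<in>vector_fields A. \<forall>Y\<in>vector_fields B. \<forall>Z\<in>vector_fields B. \<forall>p.
      Y (F p) = differential B F p (X p) \<longrightarrow> D' X (\<lambda>q. Z (F q)) p = D Y Z (F p))"


section \<open>Generalized quasi-Sasakian manifolds\<close>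

definition almost_contact_metric ::
  "('q::topological_space, 'f::euclidean_space) atlas \<Rightarrow> ('q \<Rightarrow> 'q tvec \<Rightarrow> 'q tvec)
    \<Rightarrow> ('q \<Rightarrow> 'q tvec) \<Rightarrow> ('q \<Rightarrow> 'q tvec \<Rightarrow> real) \<Rightarrow> ('q \<Rightarrow> 'q tvec \<Rightarrow> 'q tvec \<Rightarrow> real) \<Rightarrow> bool"
  where "almost_contact_metric B \<phi> \<xi> \<eta> g \<longleftrightarrow>
    endomorphism_field B \<phi> \<and> \<xi> \<in> vector_fields B \<and> one_form B \<eta> \<and> riemannian_metric B g \<and>
    (\<forall>p. \<forall>v\<in>tangent_space B p. \<phi> p (\<phi> p v) = - v + \<eta> p v *\<^sub>R \<xi> p) \<and>
    (\<forall>p. \<eta> p (\<xi> p) = 1) \<and>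
    (\<forall>p. \<forall>v\<in>tangent_space B p. \<eta> p (\<phi> p v) = 0) \<and>
    (\<forall>p. \<phi> p (\<xi> p) = 0) \<and>
    (\<forall>p. \<forall>v\<in>tangent_space B p. \<eta> p v = g p v (\<xi> p)) \<and>
    (\<forall>p. \<forall>u\<in>tangent_space B p. \<forall>v\<in>tangent_space B p. g p (\<phi> p u) v + g p u (\<phi> p v) = 0)"

text \<open>The left-hand side of the last equation is \<open>(D\<^sub>X \<phi>) Y\<close>.\<close>

definition generalized_quasi_sasakian ::
  "('q::topological_space, 'f::euclidean_space) atlas \<Rightarrow> ('q \<Rightarrow> 'q tvec \<Rightarrow> 'q tvec)
    \<Rightarrow> ('q \<Rightarrow> 'q tvec) \<Rightarrow> ('q \<Rightarrow> 'q tvec \<Rightarrow> real) \<Rightarrow> ('q \<Rightarrow> 'q tvec \<Rightarrow> 'q tvec \<Rightarrow> real)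
    \<Rightarrow> (('q \<Rightarrow> 'q tvec) \<Rightarrow> ('q \<Rightarrow> 'q tvec) \<Rightarrow> 'q \<Rightarrow> 'q tvec) \<Rightarrow> bool"
  where "generalized_quasi_sasakian B \<phi> \<xi> \<eta> g D \<longleftrightarrow>
    almost_contact_metric B \<phi> \<xi> \<eta> g \<and> levi_civita B g D \<and>
    (\<forall>X\<in>vector_fields B. \<forall>Y\<in>vector_fields B. \<forall>p.
      D X (\<lambda>q. \<phi> q (Y q)) p - \<phi> p (D X Y p) =
      g p (D (\<lambda>q. \<phi> q (X q)) \<xi> p) (Y p) *\<^sub>R \<xi> p - \<eta> p (Y p) *\<^sub>R D (\<lambda>q. \<phi> q (X q)) \<xi> p)"


section \<open>Submanifolds\<close>

definition immersion ::
  "('p::topological_space, 'e::euclidean_space) atlas \<Rightarrow> ('q::topological_space, 'f::euclidean_space) atlas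
    \<Rightarrow> ('p \<Rightarrow> 'q) \<Rightarrow> bool"
  where "immersion A B i \<longleftrightarrow>
    smooth_map_on A B UNIV i \<and> (\<forall>p. inj_on (differential B i p) (tangent_space A p))"

definition induced_metric ::
  "('q::topological_space, 'f::euclidean_space) atlas \<Rightarrow> ('p \<Rightarrow> 'q)
    \<Rightarrow> ('q \<Rightarrow> 'q tvec \<Rightarrow> 'q tvec \<Rightarrow> real) \<Rightarrow> 'p \<Rightarrow> 'p tvec \<Rightarrow> 'p tvec \<Rightarrow> real"
  where "induced_metric B i g = (\<lambda>p u v. g (i p) (differential B i p u) (differential B i p v))"

definition normal_space ::
  "('p::topological_space, 'e::euclidean_space) atlas \<Rightarrow> ('q::topological_space, 'f::euclidean_space) atlas
    \<Rightarrow> ('p \<Rightarrow> 'q) \<Rightarrow> ('q \<Rightarrow> 'q tvec \<Rightarrow> 'q tvec \<Rightarrow> real) \<Rightarrow> 'p \<Rightarrow> 'q tvec set"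
  where "normal_space A B i g p =
    {w \<in> tangent_space B (i p). \<forall>v\<in>tangent_space A p. g (i p) (differential B i p v) w = 0}"

definition smooth_distribution ::
  "('p::topological_space, 'e::euclidean_space) atlas \<Rightarrow> ('p \<Rightarrow> 'p tvec set) \<Rightarrow> bool"
  where "smooth_distribution A \<D> \<longleftrightarrow>
    (\<exists>k::nat. \<forall>p. \<exists>U E. open U \<and> p \<in> U \<and> (\<forall>j<k. E j \<in> vector_fields A) \<and>
      (\<forall>q\<in>U. inj_on (\<lambda>j. E j q) {..<k} \<and> independent ((\<lambda>j. E j q) ` {..<k}) \<and>
             \<D> q = span ((\<lambda>j. E j q) ` {..<k})))"

definition semi_invariant_xi_perp_submanifold ::
  "('p::topological_space, 'e::euclidean_space) atlas \<Rightarrow> ('q::topological_space, 'f::euclidean_space) atlas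
    \<Rightarrow> ('p \<Rightarrow> 'q) \<Rightarrow> ('q \<Rightarrow> 'q tvec \<Rightarrow> 'q tvec) \<Rightarrow> ('q \<Rightarrow> 'q tvec)
    \<Rightarrow> ('q \<Rightarrow> 'q tvec \<Rightarrow> 'q tvec \<Rightarrow> real) \<Rightarrow> ('p \<Rightarrow> 'p tvec set) \<Rightarrow> ('p \<Rightarrow> 'p tvec set) \<Rightarrow> bool"
  where "semi_invariant_xi_perp_submanifold A B i \<phi> \<xi> g \<D> \<D>p \<longleftrightarrow>
    immersion A B i \<and> (\<forall>p. \<xi> (i p) \<in> normal_space A B i g p) \<and>
    smooth_distribution A \<D> \<and> smooth_distribution A \<D>p \<and>
    (\<forall>p. {u + v | u v. u \<in> \<D> p \<and> v \<in> \<D>p p} = tangent_space A p) \<and>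
    (\<forall>p. \<forall>u\<in>\<D> p. \<forall>v\<in>\<D>p p. induced_metric B i g p u v = 0) \<and>
    (\<forall>p. \<phi> (i p) ` (differential B i p ` \<D> p) = differential B i p ` \<D> p) \<and>
    (\<forall>p. \<phi> (i p) ` (differential B i p ` \<D>p p) \<subseteq> normal_space A B i g p)"

definition invariant_xi_perp_submanifold ::
  "('p::topological_space, 'e::euclidean_space) atlas \<Rightarrow> ('q::topological_space, 'f::euclidean_space) atlas
    \<Rightarrow> ('p \<Rightarrow> 'q) \<Rightarrow> ('q \<Rightarrow> 'q tvec \<Rightarrow> 'q tvec) \<Rightarrow> ('q \<Rightarrow> 'q tvec)
    \<Rightarrow> ('q \<Rightarrow> 'q tvec \<Rightarrow> 'q tvec \<Rightarrow> real) \<Rightarrow> bool"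
  where "invariant_xi_perp_submanifold A B i \<phi> \<xi> g \<longleftrightarrow>
    (\<exists>\<D>. semi_invariant_xi_perp_submanifold A B i \<phi> \<xi> g \<D> (\<lambda>p. {0}))"

text \<open>The Gauss formula. Here \<open>D\<close> is the connection of the submanifold and \<open>D'\<close> is the ambient
  connection on vector fields along \<open>i\<close>. The formula determines \<open>h\<close> on tangent vectors, since every
  tangent vector is a value of some vector field.\<close>

definition second_fundamental_form ::
  "('p::topological_space, 'e::euclidean_space) atlas \<Rightarrow> ('q::topological_space, 'f::euclidean_space) atlas
    \<Rightarrow> ('p \<Rightarrow> 'q) \<Rightarrow> ('q \<Rightarrow> 'q tvec \<Rightarrow> 'q tvec \<Rightarrow> real)
    \<Rightarrow> (('p \<Rightarrow> 'p tvec) \<Rightarrow> ('p \<Rightarrow> 'p tvec) \<Rightarrow> 'p \<Rightarrow> 'p tvec)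
    \<Rightarrow> (('p \<Rightarrow> 'p tvec) \<Rightarrow> ('p \<Rightarrow> 'q tvec) \<Rightarrow> 'p \<Rightarrow> 'q tvec)
    \<Rightarrow> ('p \<Rightarrow> 'p tvec \<Rightarrow> 'p tvec \<Rightarrow> 'q tvec) \<Rightarrow> bool"
  where "second_fundamental_form A B i g D D' h \<longleftrightarrow>
    (\<forall>p. \<forall>u\<in>tangent_space A p. \<forall>v\<in>tangent_space A p. h p u v \<in> normal_space A B i g p) \<and>
    (\<forall>X\<in>vector_fields A. \<forall>Y\<in>vector_fields A. \<forall>p.
      D' X (\<lambda>q. differential B i q (Y q)) p = differential B i p (D X Y p) + h p (X p) (Y p))"

text \<open>The shape operator at \<open>p\<close> of a normal vector \<open>N\<close> at \<open>p\<close>.\<close>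

definition shape_operator ::
  "('p::topological_space, 'e::euclidean_space) atlas \<Rightarrow> ('q::topological_space, 'f::euclidean_space) atlas
    \<Rightarrow> ('p \<Rightarrow> 'q) \<Rightarrow> ('q \<Rightarrow> 'q tvec \<Rightarrow> 'q tvec \<Rightarrow> real)
    \<Rightarrow> ('p \<Rightarrow> 'p tvec \<Rightarrow> 'p tvec \<Rightarrow> 'q tvec) \<Rightarrow> 'p \<Rightarrow> 'q tvec \<Rightarrow> 'p tvec \<Rightarrow> 'p tvec"
  where "shape_operator A B i g h p N u =
    (THE w. w \<in> tangent_space A p \<and>
      (\<forall>v\<in>tangent_space A p. g (i p) (h p u v) N = induced_metric B i g p w v))"

definition mean_curvature ::
  "('p::topological_space, 'e::euclidean_space) atlas \<Rightarrow> ('q::topological_space, 'f::euclidean_space) atlas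
    \<Rightarrow> ('p \<Rightarrow> 'q) \<Rightarrow> ('q \<Rightarrow> 'q tvec \<Rightarrow> 'q tvec \<Rightarrow> real)
    \<Rightarrow> ('p \<Rightarrow> 'p tvec \<Rightarrow> 'p tvec \<Rightarrow> 'q tvec) \<Rightarrow> 'p \<Rightarrow> 'q tvec"
  where "mean_curvature A B i g h p =
    (1 / real DIM('e)) *\<^sub>R metric_trace (tangent_space A p) (induced_metric B i g p) (h p)"

definition totally_umbilical ::
  "('p::topological_space, 'e::euclidean_space) atlas \<Rightarrow> ('q::topological_space, 'f::euclidean_space) atlas
    \<Rightarrow> ('p \<Rightarrow> 'q) \<Rightarrow> ('q \<Rightarrow> 'q tvec \<Rightarrow> 'q tvec \<Rightarrow> real)
    \<Rightarrow> ('p \<Rightarrow> 'p tvec \<Rightarrow> 'p tvec \<Rightarrow> 'q tvec) \<Rightarrow> bool"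
  where "totally_umbilical A B i g h \<longleftrightarrow>
    (\<forall>X\<in>vector_fields A. \<forall>Y\<in>vector_fields A. \<forall>p.
      h p (X p) (Y p) = induced_metric B i g p (X p) (Y p) *\<^sub>R mean_curvature A B i g h p)"

end

theory Submission
  imports Defs
begin

text \<open>Let \<open>X\<close> be a vector field on the submanifold and \<open>M = \<phi> h(X, X)\<close>. Since the tangent spaces are
  \<open>\<phi>\<close>-invariant, \<open>M\<close> is a normal section. The G.Q.S. condition gives
  \<open>g'(nabla_i X (\<phi> X), M) = g'(M, M)\<close>, because \<open>\<xi>\<close> is orthogonal to the image of \<open>\<phi>\<close> and to the
  submanifold. The left-hand side equals \<open>g'(h(X, \<phi> X), M)\<close>, which vanishes for an umbilical
  submanifold as \<open>g(X, \<phi> X) = 0\<close>. Hence \<open>\<phi> h(X, X) = 0\<close>, so the mean curvature vector is a multiple of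
  \<open>\<xi>\<close>, and taking the trace of the shape operator identifies the factor. The pointwise identities for
  vector fields along the immersion follow from those for ambient vector fields by expanding in a
  coordinate frame cut off by a bump function.\<close>

section \<open>Calculus of smooth functions\<close>

text \<open>A connection along the immersion is tied to the ambient connection only on restrictions
  \<open>Z (i q)\<close> of ambient vector fields. These do not exhaust the sections along
  \<open>i\<close>, as an immersion need not be injective. Connections moreover act on global
  sections, so a coordinate frame on a chart is not an admissible argument. This is why the frame is
  cut off: a function \<open>\<kappa>\<close>, equal to 1 near the point of interest, satisfies
  \<open>\<kappa> v = \<Sum>b. v (F b) Z b\<close> at every point of the manifold with everything
  globally defined, and the Leibniz rule at that point then removes \<open>\<kappa>\<close>. The
  Hausdorff property enters here, to make extension by zero smooth. The geometric argument is
  pointwise: umbilicity is evaluated at one point \<open>p\<close>, on the pairs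
  \<open>(u, v)\<close> and \<open>(u, u)\<close> with \<open>u\<close> nonzero and \<open>v\<close>
  representing \<open>\<phi> u\<close>. Such a \<open>u\<close> exists because Euclidean spaces have
  positive dimension. The theorem is therefore proved as an equivalence at each \<open>p\<close>.
  Its converse is a trace computation: a form \<open>h = g H\<close> has metric trace
  \<open>m H\<close>, so \<open>H\<close> is the mean curvature vector.\<close>

lemma Ck_on_subset: "Ck_on k S f \<Longrightarrow> T \<subseteq> S \<Longrightarrow> Ck_on k T f"
  by (induction k arbitrary: f) (auto intro: continuous_on_subset differentiable_on_subset)

lemma Ck_on_SucD:
  assumes "Ck_on (Suc k) S f" "open S" "x \<in> S"
  shows "(f has_derivative frechet_derivative f (at x)) (at x)"
  using assms by (simp add: differentiable_on_eq_differentiable_at frechet_derivative_works)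

text \<open>\<open>frechet_derivative\<close> is taken at \<open>x\<close> in the whole space, so
  openness of \<open>S\<close> is what carries equality on \<open>S\<close> over to the
  derivatives.\<close>

lemma Ck_on_cong:
  assumes "open S" "\<And>x. x \<in> S \<Longrightarrow> f x = g x" "Ck_on k S f"
  shows "Ck_on k S g"
  using assms(2,3)
proof (induction k arbitrary: f g)
  case 0
  then show ?case by (simp cong: continuous_on_cong)
next
  case (Suc k)
  have D: "(g has_derivative frechet_derivative f (at x)) (at x)" if x: "x \<in> S" for x
    by (rule has_derivative_transform_within_open[OF Ck_on_SucD[OF Suc.prems(2) \<open>open S\<close> x] \<open>open S\<close> x])
      (use Suc.prems(1) in auto)
  have "Ck_on k S (\<lambda>x. frechet_derivative g (at x) v)" for v
  proof (rule Suc.IH)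
    show "Ck_on k S (\<lambda>x. frechet_derivative f (at x) v)" using Suc.prems(2) by simp
    show "frechet_derivative f (at x) v = frechet_derivative g (at x) v" if "x \<in> S" for x
      using frechet_derivative_at[OF D[OF that]] by simp
  qed
  moreover have "g differentiable_on S"
    using D assms(1) by (meson differentiableI differentiable_on_eq_differentiable_at)
  ultimately show ?case by simp
qed

text \<open>A derivative known in closed form may replace the term \<open>frechet_derivative\<close>
  of the definition. Most closure properties below enter through this rule.\<close>

lemma Ck_on_intro:
  assumes "open S" "\<And>x. x \<in> S \<Longrightarrow> (f has_derivative f' x) (at x)" "\<And>v. Ck_on k S (\<lambda>x. f' x v)"
  shows "Ck_on (Suc k) S f"
proof -
  have "frechet_derivative f (at x) = f' x" if "x \<in> S" for x
    using assms(2)[OF that] frechet_derivative_at by metis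
  then have "Ck_on k S (\<lambda>x. frechet_derivative f (at x) v)" for v
    by (intro Ck_on_cong[OF assms(1) _ assms(3)[of v]]) simp
  moreover have "f differentiable_on S"
    using assms(1,2) by (meson differentiableI differentiable_on_eq_differentiable_at)
  ultimately show ?thesis by simp
qed

text \<open>Derivatives at a point do not refer to the ambient set, so a neighbourhood
  \<open>T\<close> settles the matter even if it leaves \<open>S\<close>.\<close>

lemma Ck_on_local:
  assumes "\<And>x. x \<in> S \<Longrightarrow> \<exists>T. open T \<and> x \<in> T \<and> Ck_on k T f"
  shows "Ck_on k S f"
  using assms
proof (induction k arbitrary: f)
  case 0
  have "continuous (at x within S) f" if "x \<in> S" for x
    using 0[OF that] by (auto simp: continuous_on_eq_continuous_at intro: continuous_at_imp_continuous_at_within)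
  then show ?case by (simp add: continuous_on_eq_continuous_within)
next
  case (Suc k)
  have "f differentiable (at x within S)" if "x \<in> S" for x
    using Suc.prems[OF that]
    by (auto simp: differentiable_on_eq_differentiable_at intro: differentiable_at_withinI)
  moreover have "Ck_on k S (\<lambda>x. frechet_derivative f (at x) v)" for v
  proof (rule Suc.IH)
    fix x assume "x \<in> S"
    from Suc.prems[OF this] show "\<exists>T. open T \<and> x \<in> T \<and> Ck_on k T (\<lambda>x. frechet_derivative f (at x) v)"
      by auto
  qed
  ultimately show ?case by (simp add: differentiable_on_def)
qed

lemma Ck_on_continuous_on: "Ck_on k S f \<Longrightarrow> continuous_on S f"
  by (cases k) (auto intro: differentiable_imp_continuous_on)

lemma Ck_on_less_Suc: "open S \<Longrightarrow> Ck_on (Suc k) S f \<Longrightarrow> Ck_on k S f"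
proof (induction k arbitrary: f)
  case 0
  then show ?case by (auto intro: differentiable_imp_continuous_on)
next
  case (Suc k)
  then show ?case by simp
qed

lemma Ck_on_const: "open S \<Longrightarrow> Ck_on k S (\<lambda>x. c)"
proof (induction k arbitrary: c)
  case (Suc k)
  show ?case
    by (rule Ck_on_intro[where f'="\<lambda>x v. 0"]) (use Suc in auto)
qed simp

lemma Ck_on_id: "open S \<Longrightarrow> Ck_on k S (\<lambda>x. x)"
proof (induction k)
  case (Suc k)
  show ?case
    by (rule Ck_on_intro[where f'="\<lambda>x v. v"]) (use Suc Ck_on_const in auto)
qed simp

lemma Ck_on_bounded_linear:
  assumes "open S" "bounded_linear L" "Ck_on k S f"
  shows "Ck_on k S (\<lambda>x. L (f x))"
  using assms(3)
proof (induction k arbitrary: f)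
  case 0
  then show ?case using assms by (simp add: bounded_linear.continuous_on)
next
  case (Suc k)
  show ?case
  proof (rule Ck_on_intro[where f'="\<lambda>x v. L (frechet_derivative f (at x) v)"])
    fix x assume x: "x \<in> S"
    show "((\<lambda>x. L (f x)) has_derivative (\<lambda>v. L (frechet_derivative f (at x) v))) (at x)"
      by (rule bounded_linear.has_derivative[OF assms(2) Ck_on_SucD[OF Suc.prems assms(1) x]])
  next
    fix v show "Ck_on k S (\<lambda>x. L (frechet_derivative f (at x) v))"
      using Suc by simp
  qed (use assms in auto)
qed

lemma Ck_on_add:
  assumes "open S" "Ck_on k S f" "Ck_on k S g"
  shows "Ck_on k S (\<lambda>x. f x + g x)"
  using assms(2,3)
proof (induction k arbitrary: f g)
  case 0
  then show ?case by (simp add: continuous_on_add)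
next
  case (Suc k)
  show ?case
  proof (rule Ck_on_intro[where f'="\<lambda>x v. frechet_derivative f (at x) v + frechet_derivative g (at x) v"])
    fix x assume x: "x \<in> S"
    show "((\<lambda>x. f x + g x) has_derivative (\<lambda>v. frechet_derivative f (at x) v + frechet_derivative g (at x) v)) (at x)"
      by (intro has_derivative_add Ck_on_SucD[OF Suc.prems(1) assms(1) x] Ck_on_SucD[OF Suc.prems(2) assms(1) x])
  next
    fix v
    show "Ck_on k S (\<lambda>x. frechet_derivative f (at x) v + frechet_derivative g (at x) v)"
      using Suc.prems by (intro Suc.IH) auto
  qed (use assms in auto)
qed

lemma Ck_on_sum:
  assumes "open S" "finite I" "\<And>i. i \<in> I \<Longrightarrow> Ck_on k S (f i)"
  shows "Ck_on k S (\<lambda>x. \<Sum>i\<in>I. f i x)"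
  using assms(2,3)
  by (induction I rule: finite_induct) (auto intro: Ck_on_const Ck_on_add assms(1))

lemma Ck_on_bilinear:
  assumes "open S" "bounded_bilinear P" "Ck_on k S f" "Ck_on k S g"
  shows "Ck_on k S (\<lambda>x. P (f x) (g x))"
  using assms(3,4)
proof (induction k arbitrary: f g)
  case 0
  then show ?case by (simp add: bounded_bilinear.continuous_on[OF assms(2)])
next
  case (Suc k)
  show ?case
  proof (rule Ck_on_intro[where
        f'="\<lambda>x v. P (f x) (frechet_derivative g (at x) v) + P (frechet_derivative f (at x) v) (g x)"])
    fix x assume x: "x \<in> S"
    show "((\<lambda>x. P (f x) (g x)) has_derivative
        (\<lambda>v. P (f x) (frechet_derivative g (at x) v) + P (frechet_derivative f (at x) v) (g x))) (at x)"
      by (rule bounded_bilinear.FDERIV[OF assms(2) Ck_on_SucD[OF Suc.prems(1) assms(1) x]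
            Ck_on_SucD[OF Suc.prems(2) assms(1) x]])
  next
    fix v
    \<comment> \<open>Each summand of the product rule contains one undifferentiated factor, which
      the induction hypothesis needs at order \<open>k\<close>.\<close>
    note Ck_on_less_Suc[OF assms(1) Suc.prems(1)] Ck_on_less_Suc[OF assms(1) Suc.prems(2)]
    then show "Ck_on k S (\<lambda>x. P (f x) (frechet_derivative g (at x) v) + P (frechet_derivative f (at x) v) (g x))"
      using Suc.prems by (intro Ck_on_add assms(1) Suc.IH) auto
  qed (use assms in auto)
qed

text \<open>In the chain rule the direction in which \<open>f\<close> is differentiated moves with
  \<open>x\<close>, while \<open>Ck_on\<close> controls derivatives in fixed directions. Expanding
  that direction in \<open>Basis\<close> leaves partial derivatives of \<open>f\<close> composed
  with \<open>g\<close>, covered by the induction, times coordinates of the derivative of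
  \<open>g\<close>.\<close>

lemma Ck_on_compose:
  fixes f :: "'b::euclidean_space \<Rightarrow> 'c::real_normed_vector" and g :: "'a::real_normed_vector \<Rightarrow> 'b"
  assumes "open S" "open T" "Ck_on k T f" "Ck_on k S g" "g ` S \<subseteq> T"
  shows "Ck_on k S (\<lambda>x. f (g x))"
  using assms(3,4)
proof (induction k arbitrary: f)
  case 0
  then show ?case using continuous_on_compose2[of T f S g] assms(5) by simp
next
  case (Suc k)
  let ?Df = "\<lambda>x. frechet_derivative f (at x)" and ?Dg = "\<lambda>x. frechet_derivative g (at x)"
  show ?case
  proof (rule Ck_on_intro[where f'="\<lambda>x v. \<Sum>b\<in>Basis. (?Dg x v \<bullet> b) *\<^sub>R ?Df (g x) b"])
    fix x assume x: "x \<in> S"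
    have Df: "(f has_derivative ?Df (g x)) (at (g x))"
      by (rule Ck_on_SucD[OF Suc.prems(1) assms(2)]) (use assms(5) x in auto)
    then have lin: "linear (?Df (g x))" by (rule has_derivative_linear)
    have eq: "(\<Sum>b\<in>Basis. (w \<bullet> b) *\<^sub>R ?Df (g x) b) = ?Df (g x) w" for w
    proof -
      have "?Df (g x) w = ?Df (g x) (\<Sum>b\<in>Basis. (w \<bullet> b) *\<^sub>R b)" by (simp add: euclidean_representation)
      also have "\<dots> = (\<Sum>b\<in>Basis. (w \<bullet> b) *\<^sub>R ?Df (g x) b)"
        by (simp only: linear_sum[OF lin] linear_scale[OF lin])
      finally show ?thesis by (rule sym)
    qed
    show "((\<lambda>x. f (g x)) has_derivative (\<lambda>v. \<Sum>b\<in>Basis. (?Dg x v \<bullet> b) *\<^sub>R ?Df (g x) b)) (at x)"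
      unfolding eq by (rule has_derivative_compose[OF Ck_on_SucD[OF Suc.prems(2) assms(1) x] Df])
  next
    fix v
    have "Ck_on k S (\<lambda>x. ?Df (g x) b)" for b
      using Suc.prems(1) by (intro Suc.IH Ck_on_less_Suc[OF assms(1) Suc.prems(2)]) simp
    moreover have "Ck_on k S (\<lambda>x. ?Dg x v \<bullet> b)" for b
      using Suc.prems by (intro Ck_on_bounded_linear[OF assms(1) bounded_linear_inner_left]) simp
    ultimately show "Ck_on k S (\<lambda>x. \<Sum>b\<in>Basis. (?Dg x v \<bullet> b) *\<^sub>R ?Df (g x) b)"
      by (intro Ck_on_sum Ck_on_bilinear[OF _ bounded_bilinear_scaleR] assms(1)) auto
  qed (use assms in auto)
qed

text \<open>The derivative is, up to a constant, a product of two copies of \<open>inverse\<close>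
  itself, so the induction closes.\<close>

lemma Ck_on_inverse: "Ck_on k (- {0}) (inverse :: real \<Rightarrow> real)"
proof (induction k)
  case 0
  show ?case by (auto intro!: continuous_intros)
next
  case (Suc k)
  show ?case
  proof (rule Ck_on_intro[where f'="\<lambda>x v. (- v) * (inverse x * inverse x)"])
    fix x :: real assume "x \<in> - {0}"
    then show "(inverse has_derivative (\<lambda>v. (- v) * (inverse x * inverse x))) (at x)"
      by (auto intro!: derivative_eq_intros simp: field_simps power2_eq_square)
  next
    fix v :: real
    show "Ck_on k (- {0}) (\<lambda>x. (- v) * (inverse x * inverse x))"
      by (intro Ck_on_bilinear[OF _ bounded_bilinear_mult] Ck_on_const Suc) auto
  qed auto
qed

section \<open>Smoothness as class \<open>Ck_on k\<close> for every \<open>k\<close>\<close>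

lemma smooth_on_subset: "smooth_on S f \<Longrightarrow> T \<subseteq> S \<Longrightarrow> smooth_on T f"
  unfolding smooth_on_def using Ck_on_subset by blast

lemma smooth_on_cong: "open S \<Longrightarrow> (\<And>x. x \<in> S \<Longrightarrow> f x = g x) \<Longrightarrow> smooth_on S f \<Longrightarrow> smooth_on S g"
  unfolding smooth_on_def by (blast intro: Ck_on_cong[where f=f])

lemma smooth_on_local:
  assumes "\<And>x. x \<in> S \<Longrightarrow> \<exists>T. open T \<and> x \<in> T \<and> smooth_on T f"
  shows "smooth_on S f"
  unfolding smooth_on_def
proof (intro allI Ck_on_local)
  fix k x assume "x \<in> S"
  then show "\<exists>T. open T \<and> x \<in> T \<and> Ck_on k T f"
    using assms[of x] unfolding smooth_on_def by blast
qed

lemma smooth_on_continuous_on: "smooth_on S f \<Longrightarrow> continuous_on S f"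
  unfolding smooth_on_def using Ck_on_continuous_on by blast

lemma smooth_on_const: "open S \<Longrightarrow> smooth_on S (\<lambda>x. c)"
  and smooth_on_id: "open S \<Longrightarrow> smooth_on S (\<lambda>x. x)"
  and smooth_on_bounded_linear: "open S \<Longrightarrow> bounded_linear L \<Longrightarrow> smooth_on S f \<Longrightarrow> smooth_on S (\<lambda>x. L (f x))"
  and smooth_on_add: "open S \<Longrightarrow> smooth_on S f \<Longrightarrow> smooth_on S g \<Longrightarrow> smooth_on S (\<lambda>x. f x + g x)"
  and smooth_on_bilinear: "open S \<Longrightarrow> bounded_bilinear P \<Longrightarrow> smooth_on S f \<Longrightarrow> smooth_on S g \<Longrightarrow>
    smooth_on S (\<lambda>x. P (f x) (g x))"
  unfolding smooth_on_def
  by (blast intro: Ck_on_const Ck_on_id Ck_on_bounded_linear Ck_on_add Ck_on_bilinear)+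

lemma smooth_on_diff:
  assumes "open S" "smooth_on S f" "smooth_on S g"
  shows "smooth_on S (\<lambda>x. f x - g x)"
  using smooth_on_add[OF assms(1,2) smooth_on_bounded_linear[OF assms(1)
      bounded_linear_minus[OF bounded_linear_ident] assms(3)]]
  by simp

lemma smooth_on_compose:
  fixes f :: "'b::euclidean_space \<Rightarrow> 'c::real_normed_vector"
  assumes "open S" "open T" "smooth_on T f" "smooth_on S g" "g ` S \<subseteq> T"
  shows "smooth_on S (\<lambda>x. f (g x))"
  using Ck_on_compose[OF assms(1,2)] assms(3-5) unfolding smooth_on_def by blast

lemma smooth_on_has_derivative:
  "smooth_on S f \<Longrightarrow> open S \<Longrightarrow> x \<in> S \<Longrightarrow> (f has_derivative frechet_derivative f (at x)) (at x)"
  unfolding smooth_on_def by (rule Ck_on_SucD[of 0]) blast+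

lemma smooth_on_frechet_derivative:
  "smooth_on S f \<Longrightarrow> smooth_on S (\<lambda>x. frechet_derivative f (at x) v)"
  unfolding smooth_on_def
proof
  fix k assume "\<forall>k. Ck_on k S f"
  then have "Ck_on (Suc k) S f" by blast
  then show "Ck_on k S (\<lambda>x. frechet_derivative f (at x) v)" by simp
qed

section \<open>Flat functions and bump functions\<close>

definition flat :: "nat \<Rightarrow> real \<Rightarrow> real"
  where "flat k t = (if t > 0 then exp (- inverse t) * inverse t ^ k else 0)"

text \<open>With \<open>s = 1/t\<close> this is the decay of \<open>s ^ k / exp s\<close> at
  infinity; to the left of 0 the function vanishes.\<close>

lemma flat_tendsto_0: "(flat k \<longlongrightarrow> 0) (at 0)"
proof (rule filterlim_split_at)
  have "((\<lambda>t. inverse t ^ k / exp (inverse t)) \<longlongrightarrow> 0) (at_right (0::real))"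
    by (rule filterlim_compose[OF tendsto_power_div_exp_0 filterlim_inverse_at_top_right])
  then show "(flat k \<longlongrightarrow> 0) (at_right 0)"
    by (rule Lim_transform_eventually)
      (auto simp: flat_def eventually_at_filter exp_minus field_simps)
  show "(flat k \<longlongrightarrow> 0) (at_left 0)"
    by (rule tendsto_eventually) (auto simp: flat_def eventually_at_filter)
qed

text \<open>The powers of \<open>inverse t\<close> are there for this formula: the family, which
  starts with \<open>exp (- 1/t)\<close>, becomes closed under differentiation up to linear
  combinations, so a single induction makes all its members smooth.\<close>

lemma flat_has_real_derivative:
  "(flat k has_real_derivative (flat (k + 2) t - real k * flat (k + 1) t)) (at t)"
proof -
  consider "t > 0" | "t < 0" | "t = 0" by linarith
  then show ?thesis
  proof cases
    case 1
    have "((\<lambda>t. exp (- inverse t) * inverse t ^ k) has_real_derivative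
        (exp (- inverse t) * (inverse t)\<^sup>2 * inverse t ^ k
          - exp (- inverse t) * (real k * (inverse t ^ (k - 1) * (inverse t)\<^sup>2)))) (at t)"
      using 1 by (auto intro!: derivative_eq_intros simp: power2_eq_square)
    \<comment> \<open>For \<open>k = 0\<close> the truncated exponent \<open>k - 1\<close> does no
      harm, as both sides carry the factor \<open>real k\<close>.\<close>
    moreover have eq: "real k * (inverse t ^ (k - 1) * (inverse t)\<^sup>2) = real k * inverse t ^ (k + 1)"
      by (cases k) (auto simp: power2_eq_square)
    ultimately have "((\<lambda>t. exp (- inverse t) * inverse t ^ k) has_real_derivative
        exp (- inverse t) * (inverse t)\<^sup>2 * inverse t ^ k
          - exp (- inverse t) * (real k * inverse t ^ (k + 1))) (at t)"
      by (simp only: eq)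
    then have "((\<lambda>t. exp (- inverse t) * inverse t ^ k) has_real_derivative
        (flat (k + 2) t - real k * flat (k + 1) t)) (at t)"
      using 1 by (simp add: flat_def power_add power2_eq_square algebra_simps)
    then show ?thesis
      by (rule has_field_derivative_transform_within_open[where S="{0<..}"]) (use 1 in \<open>auto simp: flat_def\<close>)
  next
    case 2
    have "((\<lambda>t. 0) has_real_derivative (flat (k + 2) t - real k * flat (k + 1) t)) (at t)"
      using 2 by (simp add: flat_def)
    then show ?thesis
      by (rule has_field_derivative_transform_within_open[where S="{..<0}"]) (use 2 in \<open>auto simp: flat_def\<close>)
  next
    case 3
    \<comment> \<open>Away from 0 this difference quotient is \<open>flat (Suc k)\<close>.\<close>
    have "((\<lambda>s. (flat k s - flat k 0) / (s - 0)) \<longlongrightarrow> 0) (at 0)"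
      by (rule Lim_transform_eventually[OF flat_tendsto_0[of "Suc k"]])
        (auto simp: flat_def eventually_at_filter field_simps)
    then have "(flat k has_real_derivative 0) (at 0)"
      by (simp only: has_field_derivative_iff)
    then show ?thesis using 3 by (simp add: flat_def)
  qed
qed

lemma Ck_on_flat: "Ck_on n UNIV (flat k)"
proof (induction n arbitrary: k)
  case 0
  show ?case
    by (auto simp: continuous_on_eq_continuous_at intro: DERIV_isCont[OF flat_has_real_derivative])
next
  case (Suc n)
  show ?case
  proof (rule Ck_on_intro[where f'="\<lambda>t v. (flat (k + 2) t + (- real k) * flat (k + 1) t) * v"])
    fix t show "(flat k has_derivative (\<lambda>v. (flat (k + 2) t + (- real k) * flat (k + 1) t) * v)) (at t)"
      using flat_has_real_derivative[of k t] by (simp add: has_field_derivative_def)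
  next
    fix v :: real
    show "Ck_on n UNIV (\<lambda>t. (flat (k + 2) t + (- real k) * flat (k + 1) t) * v)"
      by (intro Ck_on_bilinear[OF _ bounded_bilinear_mult] Ck_on_add Ck_on_const Suc) auto
  qed auto
qed

text \<open>The function is \<open>u / (u + w)\<close>, where \<open>u\<close> vanishes outside
  radius \<open>s\<close> and \<open>w\<close> inside radius \<open>r\<close>. Since
  \<open>r < s\<close> they never vanish together. Squared distances are used because the norm is
  not smooth at the centre.\<close>

lemma smooth_bump:
  fixes a :: "'e::euclidean_space"
  assumes "0 < r" "r < s"
  obtains \<rho> :: "'e \<Rightarrow> real" where "smooth_on UNIV \<rho>" "\<And>z. dist a z \<le> r \<Longrightarrow> \<rho> z = 1"
    "\<And>z. dist a z \<ge> s \<Longrightarrow> \<rho> z = 0"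
proof -
  define d where "d = (\<lambda>z. (z - a) \<bullet> (z - a))"
  have d: "d z = (dist a z)\<^sup>2" for z by (simp add: d_def dist_norm dot_square_norm norm_minus_commute)
  define u where "u = (\<lambda>z. flat 0 (s\<^sup>2 - d z))"
  define w where "w = (\<lambda>z. flat 0 (d z - r\<^sup>2))"
  have sd: "smooth_on UNIV d"
    unfolding d_def
    by (intro smooth_on_bilinear[OF _ bounded_bilinear_inner] smooth_on_diff smooth_on_const smooth_on_id) auto
  have flat: "smooth_on UNIV (flat 0)" by (simp add: smooth_on_def Ck_on_flat)
  have su: "smooth_on UNIV u" unfolding u_def
    by (rule smooth_on_compose[OF open_UNIV open_UNIV flat]) (intro smooth_on_diff sd smooth_on_const open_UNIV, simp)
  have sw: "smooth_on UNIV w" unfolding w_def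
    by (rule smooth_on_compose[OF open_UNIV open_UNIV flat]) (intro smooth_on_diff sd smooth_on_const open_UNIV, simp)
  have nn: "u z \<ge> 0" "w z \<ge> 0" for z by (auto simp: u_def w_def flat_def)
  have pos: "u z + w z > 0" for z
  proof (cases "d z < s\<^sup>2")
    case True
    then have "u z > 0" by (simp add: u_def flat_def)
    then show ?thesis using nn(2)[of z] by linarith
  next
    case False
    moreover have "r\<^sup>2 < s\<^sup>2" using assms by (simp add: power_strict_mono)
    ultimately have "w z > 0" by (simp add: w_def flat_def)
    then show ?thesis using nn(1)[of z] by linarith
  qed
  have sinv: "smooth_on (- {0::real}) inverse" by (simp add: smooth_on_def Ck_on_inverse)
  have "smooth_on UNIV (\<lambda>z. inverse (u z + w z))"
  proof (rule smooth_on_compose[OF open_UNIV _ sinv])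
    show "range (\<lambda>z. u z + w z) \<subseteq> - {0}" using pos by (auto simp: image_iff) (metis less_irrefl)
  qed (auto intro: smooth_on_add su sw)
  then have "smooth_on UNIV (\<lambda>z. u z * inverse (u z + w z))"
    by (intro smooth_on_bilinear[OF _ bounded_bilinear_mult] su) auto
  moreover have "u z * inverse (u z + w z) = 1" if "dist a z \<le> r" for z
  proof -
    have "d z \<le> r\<^sup>2" using that by (simp add: d power_mono)
    then have "w z = 0" by (simp add: w_def flat_def)
    then show ?thesis using pos[of z] by simp
  qed
  moreover have "u z * inverse (u z + w z) = 0" if "dist a z \<ge> s" for z
  proof -
    have "d z \<ge> s\<^sup>2" using that assms by (simp add: d power_mono)
    then show ?thesis by (simp add: u_def flat_def)
  qed
  ultimately show ?thesis using that by blast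
qed

section \<open>Smooth maps between manifolds\<close>

lemma chart_exists:
  assumes "smooth_atlas A"
  obtains U x where "(U, x) \<in> A" "p \<in> U"
proof -
  have "p \<in> (\<Union>(U, x)\<in>A. U)" using assms unfolding smooth_atlas_def by simp
  then show ?thesis using that by auto
qed

lemma chart_transition:
  assumes "smooth_atlas A" "(U, x) \<in> A" "(V, y) \<in> A"
  shows "smooth_on (x ` (U \<inter> V)) (\<lambda>z. y (inv_into U x z))"
proof -
  have "\<forall>(U, x)\<in>A. \<forall>(V, y)\<in>A. smooth_on (x ` (U \<inter> V)) (\<lambda>z. y (inv_into U x z))"
    using assms(1) unfolding smooth_atlas_def by blast
  from bspec[OF bspec[OF this assms(2), simplified] assms(3)] show ?thesis by simp
qed

lemma chart:
  assumes "smooth_atlas A" "(U, x) \<in> A"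
  shows chart_open: "open U"
    and chart_inj: "inj_on x U"
    and chart_continuous: "continuous_on U x"
    and chart_inv_continuous: "continuous_on (x ` U) (inv_into U x)"
    and chart_open_image: "open T \<Longrightarrow> T \<subseteq> U \<Longrightarrow> open (x ` T)"
proof -
  from assms obtain y where U: "open U" "open (x ` U)" and y: "homeomorphism U (x ` U) x y"
    unfolding smooth_atlas_def by fast
  have yx: "y (x q) = q" if "q \<in> U" for q using y that by (simp add: homeomorphism_def)
  show "open U" by fact
  show inj: "inj_on x U" using yx by (metis inj_onI)
  show "continuous_on U x" using y by (simp add: homeomorphism_def)
  have cy: "continuous_on (x ` U) y" using y by (simp add: homeomorphism_def)
  show "continuous_on (x ` U) (inv_into U x)"
    by (rule continuous_on_eq[OF cy]) (auto simp: yx inv_into_f_f[OF inj])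
  show "open (x ` T)" if "open T" "T \<subseteq> U"
  proof -
    have "x ` T = x ` U \<inter> y -` T" using yx that(2) by auto
    then show ?thesis using continuous_open_preimage[OF cy U(2) that(1)] by simp
  qed
qed

text \<open>Smoothness is defined by all pairs of charts; since transition maps are smooth, one pair
  around each point is enough.\<close>

lemma smooth_map_onI:
  fixes A :: "('p::topological_space, 'e::euclidean_space) atlas"
    and B :: "('q::topological_space, 'f::euclidean_space) atlas"
  assumes A: "smooth_atlas A" and B: "smooth_atlas B" and S: "open S" and F: "continuous_on S F"
    and loc: "\<And>p. p \<in> S \<Longrightarrow> \<exists>U x V y T. (U, x) \<in> A \<and> (V, y) \<in> B \<and> open T \<and> p \<in> T \<and> T \<subseteq> U \<and>
      F ` T \<subseteq> V \<and> smooth_on (x ` T) (\<lambda>z. y (F (inv_into U x z)))"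
  shows "smooth_map_on A B S F"
proof -
  have "smooth_on (x' ` (S \<inter> U' \<inter> F -` V')) (\<lambda>z. y' (F (inv_into U' x' z)))"
    if U': "(U', x') \<in> A" and V': "(V', y') \<in> B" for U' x' V' y'
  proof (rule smooth_on_local)
    fix w assume "w \<in> x' ` (S \<inter> U' \<inter> F -` V')"
    then obtain p where p: "p \<in> S" "p \<in> U'" "F p \<in> V'" and w: "w = x' p" by auto
    from loc[OF p(1)] obtain U x V y T where U: "(U, x) \<in> A" and V: "(V, y) \<in> B"
      and T: "open T" "p \<in> T" "T \<subseteq> U" "F ` T \<subseteq> V"
      and sm: "smooth_on (x ` T) (\<lambda>z. y (F (inv_into U x z)))"
      by auto
    \<comment> \<open>On \<open>T'\<close> both source charts, and on its image both target charts,
      are available. The new coordinate expression is there the old one between two transition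
      maps.\<close>
    define T' where "T' = T \<inter> U' \<inter> (S \<inter> F -` V')"
    have oT': "open T'"
      unfolding T'_def using T(1) chart_open[OF A U'] continuous_open_preimage[OF F S chart_open[OF B V']]
      by (metis open_Int)
    have sub: "T' \<subseteq> U'" "T' \<subseteq> U" "T' \<subseteq> T" using T unfolding T'_def by auto
    have FT': "F q \<in> V" "F q \<in> V'" if "q \<in> T'" for q using that T unfolding T'_def by auto
    note injs = chart_inj[OF A U] chart_inj[OF A U'] chart_inj[OF B V]
    have o1: "open (x' ` T')" and o2: "open (x ` T')"
      using chart_open_image[OF A U' oT'] chart_open_image[OF A U oT'] sub by auto
    have o3: "open (y ` (V \<inter> V'))"
      by (rule chart_open_image[OF B V]) (use chart_open[OF B V] chart_open[OF B V'] in auto)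
    have inv': "inv_into U' x' (x' q) = q" if "q \<in> T'" for q using that sub injs by (simp add: inv_into_f_f subset_iff)
    have inv: "inv_into U x (x q) = q" if "q \<in> T'" for q using that sub injs by (simp add: inv_into_f_f subset_iff)
    have invV: "inv_into V y (y q) = q" if "q \<in> V" for q using that injs by (simp add: inv_into_f_f)
    have "smooth_on (x' ` T') (\<lambda>z. x (inv_into U' x' z))"
      by (rule smooth_on_subset[OF chart_transition[OF A U' U]]) (use sub in auto)
    moreover have "(\<lambda>z. x (inv_into U' x' z)) ` (x' ` T') \<subseteq> x ` T'" using inv' by auto
    moreover have "smooth_on (x ` T') (\<lambda>z. y (F (inv_into U x z)))"
      by (rule smooth_on_subset[OF sm]) (use sub in auto)
    ultimately have "smooth_on (x' ` T') (\<lambda>z. y (F (inv_into U x (x (inv_into U' x' z)))))"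
      using smooth_on_compose[OF o1 o2] by blast
    moreover have "(\<lambda>z. y (F (inv_into U x (x (inv_into U' x' z))))) ` (x' ` T') \<subseteq> y ` (V \<inter> V')"
      using inv inv' FT' by auto
    ultimately have "smooth_on (x' ` T') (\<lambda>z. y' (inv_into V y (y (F (inv_into U x (x (inv_into U' x' z)))))))"
      using smooth_on_compose[OF o1 o3 chart_transition[OF B V V']] by blast
    then have "smooth_on (x' ` T') (\<lambda>z. y' (F (inv_into U' x' z)))"
      by (rule smooth_on_cong[OF o1, rotated]) (use inv inv' invV FT' in auto)
    moreover have "w \<in> x' ` T'" using w p T unfolding T'_def by auto
    ultimately show "\<exists>T. open T \<and> w \<in> T \<and> smooth_on T (\<lambda>z. y' (F (inv_into U' x' z)))"
      using o1 by blast
  qed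
  then show ?thesis unfolding smooth_map_on_def using S F by auto
qed

lemma smooth_map_onD:
  assumes "smooth_map_on A B S F"
  shows "open S" "continuous_on S F"
    "(U, x) \<in> A \<Longrightarrow> (V, y) \<in> B \<Longrightarrow> smooth_on (x ` (S \<inter> U \<inter> F -` V)) (\<lambda>z. y (F (inv_into U x z)))"
  using assms unfolding smooth_map_on_def by auto

lemma smooth_map_on_subset:
  assumes F: "smooth_map_on A B S F" and T: "open T" "T \<subseteq> S"
  shows "smooth_map_on A B T F"
proof -
  have "smooth_on (x ` (T \<inter> U \<inter> F -` V)) (\<lambda>z. y (F (inv_into U x z)))"
    if "(U, x) \<in> A" "(V, y) \<in> B" for U x V y
    by (rule smooth_on_subset[OF smooth_map_onD(3)[OF F that]]) (use T in auto)
  then show ?thesis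
    unfolding smooth_map_on_def using T continuous_on_subset[OF smooth_map_onD(2)[OF F]] by auto
qed

lemma smooth_map_on_local:
  fixes A :: "('p::topological_space, 'e::euclidean_space) atlas"
    and B :: "('q::topological_space, 'f::euclidean_space) atlas"
  assumes A: "smooth_atlas A" and B: "smooth_atlas B"
    and loc: "\<And>p. p \<in> S \<Longrightarrow> \<exists>T. p \<in> T \<and> T \<subseteq> S \<and> smooth_map_on A B T F"
  shows "smooth_map_on A B S F"
proof (rule smooth_map_onI[OF A B])
  have loc': "\<exists>T. open T \<and> p \<in> T \<and> T \<subseteq> S \<and> continuous_on T F" if p: "p \<in> S" for p
    using loc[OF p] by (auto dest: smooth_map_onD(1,2))
  then show "open S" by (subst open_subopen) blast
  have "continuous_on (\<Union>{T. open T \<and> T \<subseteq> S \<and> continuous_on T F}) F"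
    by (rule continuous_on_open_Union) auto
  moreover have "\<Union>{T. open T \<and> T \<subseteq> S \<and> continuous_on T F} = S" using loc' by blast
  ultimately show "continuous_on S F" by (simp only:)
  fix p assume "p \<in> S"
  from loc[OF this] obtain T where T: "p \<in> T" "smooth_map_on A B T F" by blast
  obtain U x V y where U: "(U, x) \<in> A" "p \<in> U" and V: "(V, y) \<in> B" "F p \<in> V"
    using chart_exists[OF A] chart_exists[OF B] by metis
  note T' = smooth_map_onD[OF T(2)]
  have "open (T \<inter> U \<inter> F -` V)"
    using open_Int[OF continuous_open_preimage[OF T'(2,1) chart_open[OF B V(1)]] chart_open[OF A U(1)]]
    by (simp add: Int_ac)
  then show "\<exists>U x V y T. (U, x) \<in> A \<and> (V, y) \<in> B \<and> open T \<and> p \<in> T \<and> T \<subseteq> U \<and>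
      F ` T \<subseteq> V \<and> smooth_on (x ` T) (\<lambda>z. y (F (inv_into U x z)))"
    using T'(3)[OF U(1) V(1)] U V T(1) by (intro exI[of _ U] exI[of _ x] exI[of _ V] exI[of _ y] exI[of _ "T \<inter> U \<inter> F -` V"]) auto
qed

lemma smooth_map_on_cong:
  fixes A :: "('p::topological_space, 'e::euclidean_space) atlas"
    and B :: "('q::topological_space, 'f::euclidean_space) atlas"
  assumes A: "smooth_atlas A" and B: "smooth_atlas B"
    and F: "smooth_map_on A B S F" and eq: "\<And>p. p \<in> S \<Longrightarrow> F p = G p"
  shows "smooth_map_on A B S G"
proof -
  note F' = smooth_map_onD[OF F]
  have "smooth_on (x ` (S \<inter> U \<inter> G -` V)) (\<lambda>z. y (G (inv_into U x z)))"
    if U: "(U, x) \<in> A" and V: "(V, y) \<in> B" for U x V y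
  proof (rule smooth_on_cong)
    have *: "S \<inter> U \<inter> G -` V = S \<inter> U \<inter> F -` V" using eq by auto
    have "open (S \<inter> U \<inter> F -` V)"
      using open_Int[OF continuous_open_preimage[OF F'(2,1) chart_open[OF B V(1)]] chart_open[OF A U(1)]]
      by (simp add: Int_ac)
    then show "open (x ` (S \<inter> U \<inter> G -` V))" unfolding * by (rule chart_open_image[OF A U]) auto
    show "smooth_on (x ` (S \<inter> U \<inter> G -` V)) (\<lambda>z. y (F (inv_into U x z)))"
      unfolding * by (rule F'(3)[OF U V])
    show "y (F (inv_into U x z)) = y (G (inv_into U x z))" if "z \<in> x ` (S \<inter> U \<inter> G -` V)" for z
      using that eq chart_inj[OF A U] by (auto simp: inv_into_f_f)
  qed
  then show ?thesis unfolding smooth_map_on_def using F'(1) continuous_on_eq[OF F'(2) eq] by auto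
qed

lemma smooth_map_on_compose:
  fixes A :: "('p::topological_space, 'e::euclidean_space) atlas"
    and B :: "('q::topological_space, 'f::euclidean_space) atlas"
    and C :: "('r::topological_space, 'g::euclidean_space) atlas"
  assumes A: "smooth_atlas A" and B: "smooth_atlas B" and C: "smooth_atlas C"
    and F: "smooth_map_on A B S F" and G: "smooth_map_on B C T G"
  shows "smooth_map_on A C (S \<inter> F -` T) (\<lambda>p. G (F p))"
proof (rule smooth_map_onI[OF A C])
  note F' = smooth_map_onD[OF F] and G' = smooth_map_onD[OF G]
  show "open (S \<inter> F -` T)" by (rule continuous_open_preimage[OF F'(2,1) G'(1)])
  show "continuous_on (S \<inter> F -` T) (\<lambda>p. G (F p))"
    by (rule continuous_on_compose2[OF G'(2) continuous_on_subset[OF F'(2)]]) auto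
  fix p assume p: "p \<in> S \<inter> F -` T"
  obtain U x V y W z where U: "(U, x) \<in> A" "p \<in> U" and V: "(V, y) \<in> B" "F p \<in> V"
    and W: "(W, z) \<in> C" "G (F p) \<in> W"
    using chart_exists[OF A] chart_exists[OF B] chart_exists[OF C] by metis
  define T2 where "T2 = T \<inter> V \<inter> G -` W"
  have o2: "open T2"
    using open_Int[OF continuous_open_preimage[OF G'(2,1) chart_open[OF C W(1)]] chart_open[OF B V(1)]]
    unfolding T2_def by (simp add: Int_ac)
  define T1 where "T1 = S \<inter> U \<inter> F -` T2"
  have o1: "open T1"
    using open_Int[OF continuous_open_preimage[OF F'(2,1) o2] chart_open[OF A U(1)]]
    unfolding T1_def by (simp add: Int_ac)
  have i1: "open (x ` T1)" by (rule chart_open_image[OF A U(1) o1]) (auto simp: T1_def)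
  have i2: "open (y ` T2)" by (rule chart_open_image[OF B V(1) o2]) (auto simp: T2_def)
  have s1: "smooth_on (x ` T1) (\<lambda>w. y (F (inv_into U x w)))"
    by (rule smooth_on_subset[OF F'(3)[OF U(1) V(1)]]) (auto simp: T1_def T2_def)
  have s2: "smooth_on (y ` T2) (\<lambda>w. z (G (inv_into V y w)))"
    using G'(3)[OF V(1) W(1)] by (simp add: T2_def)
  have inv: "inv_into U x (x q) = q" if "q \<in> T1" for q
    using that chart_inj[OF A U(1)] by (auto simp: T1_def inv_into_f_f)
  have invV: "inv_into V y (y q) = q" if "q \<in> V" for q
    using that chart_inj[OF B V(1)] by (auto simp: inv_into_f_f)
  have "smooth_on (x ` T1) (\<lambda>w. z (G (inv_into V y (y (F (inv_into U x w))))))"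
    by (rule smooth_on_compose[OF i1 i2 s2 s1]) (use inv in \<open>auto simp: T1_def\<close>)
  then have "smooth_on (x ` T1) (\<lambda>w. z (G (F (inv_into U x w))))"
    by (rule smooth_on_cong[OF i1, rotated]) (use inv invV in \<open>auto simp: T1_def T2_def\<close>)
  then show "\<exists>U x V y T. (U, x) \<in> A \<and> (V, y) \<in> C \<and> open T \<and> p \<in> T \<and> T \<subseteq> U \<and>
      (\<lambda>p. G (F p)) ` T \<subseteq> V \<and> smooth_on (x ` T) (\<lambda>w. y (G (F (inv_into U x w))))"
    using U V W o1 p by (intro exI[of _ U] exI[of _ x] exI[of _ W] exI[of _ z] exI[of _ T1])
      (auto simp: T1_def T2_def)
qed

section \<open>Real functions and curves on a manifold\<close>

lemma smooth_atlas_euclidean: "smooth_atlas (euclidean_atlas :: ('e::euclidean_space, 'e) atlas)"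
proof -
  have "homeomorphism UNIV UNIV (\<lambda>x. x) (\<lambda>x. x :: 'e)" by (simp add: homeomorphism_def)
  moreover have "smooth_on UNIV (\<lambda>x. inv_into UNIV (\<lambda>x. x :: 'e) x)"
    using smooth_on_id[of UNIV] by (simp add: inv_into_def)
  ultimately show ?thesis by (auto simp: smooth_atlas_def euclidean_atlas_def)
qed

text \<open>Removes the chart of \<open>euclidean_atlas\<close> from coordinate expressions.\<close>

lemma inv_ident [simp]: "inv (\<lambda>x. x) = (\<lambda>x. x)"
  by (auto simp: inv_into_def)

lemma smooth_map_on_euclidean_iff:
  "smooth_map_on euclidean_atlas euclidean_atlas S f \<longleftrightarrow> open S \<and> smooth_on S f"
  using smooth_on_continuous_on by (auto simp: smooth_map_on_def euclidean_atlas_def)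

lemma smooth_fun_on_iff:
  "smooth_fun_on A S f \<longleftrightarrow> open S \<and> continuous_on S f \<and>
    (\<forall>(U, x)\<in>A. smooth_on (x ` (S \<inter> U)) (\<lambda>z. f (inv_into U x z)))"
  by (simp add: smooth_map_on_def euclidean_atlas_def)

lemma smooth_curve_iff:
  "smooth_map_on euclidean_atlas A S c \<longleftrightarrow> open S \<and> continuous_on S c \<and>
    (\<forall>(V, y)\<in>A. smooth_on (S \<inter> c -` V) (\<lambda>t. y (c t)))"
  by (simp add: smooth_map_on_def euclidean_atlas_def)

lemmas smooth_fun_on_subset = smooth_map_on_subset[where B=euclidean_atlas]
lemmas smooth_fun_on_open = smooth_map_onD(1)[where B=euclidean_atlas]
lemmas smooth_fun_on_cong = smooth_map_on_cong[OF _ smooth_atlas_euclidean]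
lemmas smooth_fun_on_local = smooth_map_on_local[OF _ smooth_atlas_euclidean]
lemmas smooth_fun_on_compose = smooth_map_on_compose[OF _ _ smooth_atlas_euclidean]

lemma smooth_fun_on_chart:
  fixes \<phi> :: "'e::euclidean_space \<Rightarrow> real"
  assumes A: "smooth_atlas A" and U: "(U, x) \<in> A" and T: "open T" "T \<subseteq> U" and \<phi>: "smooth_on (x ` T) \<phi>"
  shows "smooth_fun_on A T (\<lambda>q. \<phi> (x q))"
proof (rule smooth_map_onI[OF A smooth_atlas_euclidean T(1)])
  show "continuous_on T (\<lambda>q. \<phi> (x q))"
    by (rule continuous_on_compose2[OF smooth_on_continuous_on[OF \<phi>]
          continuous_on_subset[OF chart_continuous[OF A U] T(2)]]) auto
  have "smooth_on (x ` T) (\<lambda>z. \<phi> (x (inv_into U x z)))"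
    by (rule smooth_on_cong[OF chart_open_image[OF A U T] _ \<phi>])
      (use T chart_inj[OF A U] in \<open>auto simp: inv_into_f_f subset_iff\<close>)
  then have "(U, x) \<in> A \<and> (UNIV, \<lambda>x. x) \<in> euclidean_atlas \<and> open T \<and> p \<in> T \<and> T \<subseteq> U \<and>
      (\<lambda>q. \<phi> (x q)) ` T \<subseteq> UNIV \<and> smooth_on (x ` T) (\<lambda>z. \<phi> (x (inv_into U x z)))" if "p \<in> T" for p
    using U T that by (simp add: euclidean_atlas_def)
  then show "\<exists>U' x' V y Ta. (U', x') \<in> A \<and> (V, y) \<in> euclidean_atlas \<and> open Ta \<and> p \<in> Ta \<and> Ta \<subseteq> U' \<and>
      (\<lambda>q. \<phi> (x q)) ` Ta \<subseteq> V \<and> smooth_on (x' ` Ta) (\<lambda>z. y (\<phi> (x (inv_into U' x' z))))" if "p \<in> T" for p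
    using that by blast
qed

lemma chart_open_image_Int:
  "smooth_atlas A \<Longrightarrow> (U, x) \<in> A \<Longrightarrow> open S \<Longrightarrow> open (x ` (S \<inter> U))"
  by (rule chart_open_image) (auto intro: chart_open)

lemma smooth_fun_on_const:
  assumes A: "smooth_atlas A" and S: "open S"
  shows "smooth_fun_on A S (\<lambda>q. c)"
  using S by (auto simp: smooth_fun_on_iff intro: smooth_on_const chart_open_image_Int[OF A])

lemma smooth_fun_on_add:
  assumes A: "smooth_atlas A" and f: "smooth_fun_on A S f" and g: "smooth_fun_on A S g"
  shows "smooth_fun_on A S (\<lambda>q. f q + g q)"
  unfolding smooth_fun_on_iff
proof (safe)
  show S: "open S" using f by (simp add: smooth_fun_on_iff)
  show "continuous_on S (\<lambda>q. f q + g q)" using f g by (auto simp: smooth_fun_on_iff intro: continuous_on_add)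
  fix U x assume U: "(U, x) \<in> A"
  show "smooth_on (x ` (S \<inter> U)) (\<lambda>z. f (inv_into U x z) + g (inv_into U x z))"
    by (rule smooth_on_add[OF chart_open_image_Int[OF A U S]]) (use f g U in \<open>auto simp: smooth_fun_on_iff\<close>)
qed

lemma smooth_fun_on_mult:
  assumes A: "smooth_atlas A" and f: "smooth_fun_on A S f" and g: "smooth_fun_on A S g"
  shows "smooth_fun_on A S (\<lambda>q. f q * g q)"
  unfolding smooth_fun_on_iff
proof (safe)
  show S: "open S" using f by (simp add: smooth_fun_on_iff)
  show "continuous_on S (\<lambda>q. f q * g q)" using f g by (auto simp: smooth_fun_on_iff intro: continuous_on_mult)
  fix U x assume U: "(U, x) \<in> A"
  show "smooth_on (x ` (S \<inter> U)) (\<lambda>z. f (inv_into U x z) * g (inv_into U x z))"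
    by (rule smooth_on_bilinear[OF chart_open_image_Int[OF A U S] bounded_bilinear_mult]) (use f g U in \<open>auto simp: smooth_fun_on_iff\<close>)
qed

lemma smooth_fun_on_sum:
  assumes A: "smooth_atlas A" and S: "open S" and I: "finite I" "\<And>j. j \<in> I \<Longrightarrow> smooth_fun_on A S (f j)"
  shows "smooth_fun_on A S (\<lambda>q. \<Sum>j\<in>I. f j q)"
  using I by (induction I rule: finite_induct) (auto intro: smooth_fun_on_const[OF A S] smooth_fun_on_add[OF A])

section \<open>Tangent vectors and local frames\<close>

lemma sum_fun_apply: "(\<Sum>i\<in>I. f i) x = (\<Sum>i\<in>I. f i x)"
  by (induction I rule: infinite_finite_induct) auto

section \<open>Tangent vectors as local derivations\<close>

lemma smooth_nearI: "smooth_fun_on A S f \<Longrightarrow> p \<in> S \<Longrightarrow> smooth_near A p f"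
  unfolding smooth_near_def by blast

lemma smooth_near_cong:
  assumes A: "smooth_atlas A" and S: "open S" "p \<in> S" "\<And>q. q \<in> S \<Longrightarrow> f q = f' q" and f: "smooth_near A p f"
  shows "smooth_near A p f'"
proof -
  from f obtain T where T: "p \<in> T" "smooth_fun_on A T f" unfolding smooth_near_def by blast
  have "open (T \<inter> S)" using S smooth_fun_on_open[OF T(2)] by auto
  then have "smooth_fun_on A (T \<inter> S) f" by (rule smooth_fun_on_subset[OF T(2)]) auto
  then have "smooth_fun_on A (T \<inter> S) f'" by (rule smooth_fun_on_cong[OF A]) (use S in auto)
  then show ?thesis by (rule smooth_nearI) (use S T in auto)
qed

lemma smooth_near_add: "smooth_atlas A \<Longrightarrow> smooth_near A p f \<Longrightarrow> smooth_near A p g \<Longrightarrow> smooth_near A p (\<lambda>q. f q + g q)"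
  and smooth_near_mult: "smooth_atlas A \<Longrightarrow> smooth_near A p f \<Longrightarrow> smooth_near A p g \<Longrightarrow> smooth_near A p (\<lambda>q. f q * g q)"
proof -
  assume A: "smooth_atlas A" and f: "smooth_near A p f" and g: "smooth_near A p g"
  from f obtain T where T: "p \<in> T" "smooth_fun_on A T f" unfolding smooth_near_def by blast
  from g obtain S where S: "p \<in> S" "smooth_fun_on A S g" unfolding smooth_near_def by blast
  have o: "open (T \<inter> S)" using smooth_fun_on_open[OF T(2)] smooth_fun_on_open[OF S(2)] by auto
  have f': "smooth_fun_on A (T \<inter> S) f" by (rule smooth_fun_on_subset[OF T(2) o]) auto
  have g': "smooth_fun_on A (T \<inter> S) g" by (rule smooth_fun_on_subset[OF S(2) o]) auto
  show "smooth_near A p (\<lambda>q. f q + g q)"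
    by (rule smooth_nearI[OF smooth_fun_on_add[OF A f' g']]) (use S T in auto)
  show "smooth_near A p (\<lambda>q. f q * g q)"
    by (rule smooth_nearI[OF smooth_fun_on_mult[OF A f' g']]) (use S T in auto)
qed

text \<open>\<open>velocity\<close> is defined through \<open>deriv\<close>, which carries
  information only for differentiable functions; smoothness of \<open>f\<close> along the curve
  supplies this.\<close>

lemma velocity_has_derivative:
  assumes A: "smooth_atlas A" and c: "smooth_map_on euclidean_atlas A {-e<..<e} c" "e > 0"
    and f: "smooth_near A (c 0) f"
  shows "((\<lambda>t. f (c t)) has_real_derivative velocity A c f) (at 0)"
proof -
  from f obtain S where S: "c 0 \<in> S" "smooth_fun_on A S f" unfolding smooth_near_def by blast
  have "smooth_map_on euclidean_atlas euclidean_atlas ({-e<..<e} \<inter> c -` S) (\<lambda>t. f (c t))"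
    by (rule smooth_fun_on_compose[OF smooth_atlas_euclidean A c(1) S(2)])
  then have "((\<lambda>t. f (c t)) has_derivative frechet_derivative (\<lambda>t. f (c t)) (at 0)) (at 0)"
    unfolding smooth_map_on_euclidean_iff using S c(2) by (auto intro: smooth_on_has_derivative)
  then have "(\<lambda>t. f (c t)) differentiable at 0" by (rule differentiableI)
  then show ?thesis using f by (simp add: velocity_def DERIV_deriv_iff_real_differentiable)
qed

lemma tangent_vectorE:
  assumes "v \<in> tangent_space A p"
  obtains c e where "c 0 = p" "v = velocity A c" "smooth_map_on euclidean_atlas A {-e<..<e} c" "e > 0"
  using assms unfolding tangent_space_def by auto

lemma tangent_vector_not_smooth: "v \<in> tangent_space A p \<Longrightarrow> \<not> smooth_near A p f \<Longrightarrow> v f = 0"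
  by (auto simp: velocity_def elim: tangent_vectorE)

text \<open>A curve through \<open>p\<close> stays in \<open>S\<close> for small times. This
  locality is what allows coordinate functions to be replaced by cut-off ones.\<close>

lemma tangent_vector_cong:
  assumes A: "smooth_atlas A" and v: "v \<in> tangent_space A p"
    and S: "open S" "p \<in> S" "\<And>q. q \<in> S \<Longrightarrow> f q = f' q"
  shows "v f = v f'"
proof (cases "smooth_near A p f")
  case True
  have f': "smooth_near A p f'" by (rule smooth_near_cong[OF A S(1,2) _ True]) (rule S(3))
  from v obtain c e where c: "c 0 = p" "v = velocity A c" "smooth_map_on euclidean_atlas A {-e<..<e} c" "e > 0"
    by (rule tangent_vectorE)
  have "open ({-e<..<e} \<inter> c -` S)"
    using continuous_open_preimage[OF smooth_map_onD(2,1)[OF c(3)] S(1)] .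
  from has_field_derivative_transform_within_open[OF velocity_has_derivative[OF A c(3,4)] this, of f "\<lambda>t. f' (c t)"]
  have "((\<lambda>t. f' (c t)) has_real_derivative v f) (at 0)"
    using c S True by auto
  moreover have "((\<lambda>t. f' (c t)) has_real_derivative v f') (at 0)"
    using velocity_has_derivative[OF A c(3,4), of f'] c f' by simp
  ultimately show ?thesis by (rule DERIV_unique)
next
  \<comment> \<open>Neither function is then smooth near \<open>p\<close>, and a tangent vector
    takes its default value 0 on both.\<close>
  case False
  have "smooth_near A p f" if "smooth_near A p f'"
    by (rule smooth_near_cong[OF A S(1,2) _ that]) (rule S(3)[symmetric])
  then have "\<not> smooth_near A p f'" using False by blast
  then show ?thesis using False tangent_vector_not_smooth[OF v] by simp
qed

lemma tangent_vector_const: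
  assumes A: "smooth_atlas A" and v: "v \<in> tangent_space A p"
  shows "v (\<lambda>q. k) = 0"
  using v by (auto simp: velocity_def elim!: tangent_vectorE)

lemma tangent_vector_add_mult:
  assumes A: "smooth_atlas A" and v: "v \<in> tangent_space A p"
    and f: "smooth_near A p f" and g: "smooth_near A p g"
  shows tangent_vector_add: "v (\<lambda>q. f q + g q) = v f + v g"
    and tangent_vector_mult: "v (\<lambda>q. f q * g q) = v f * g p + f p * v g"
proof -
  from v obtain c e where c: "c 0 = p" "v = velocity A c" "smooth_map_on euclidean_atlas A {-e<..<e} c" "e > 0"
    by (rule tangent_vectorE)
  have D: "((\<lambda>t. h (c t)) has_real_derivative v h) (at 0)" if "smooth_near A p h" for h
    using velocity_has_derivative[OF A c(3,4), of h] c that by simp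
  show "v (\<lambda>q. f q + g q) = v f + v g"
    by (rule DERIV_unique[OF D[OF smooth_near_add[OF A f g]] DERIV_add[OF D[OF f] D[OF g]]])
  show "v (\<lambda>q. f q * g q) = v f * g p + f p * v g"
    using DERIV_unique[OF D[OF smooth_near_mult[OF A f g]] DERIV_mult[OF D[OF f] D[OF g]]] c(1)
    by simp
qed

lemma tangent_vector_sum:
  assumes A: "smooth_atlas A" and v: "v \<in> tangent_space A p"
    and I: "finite I" "\<And>j. j \<in> I \<Longrightarrow> smooth_near A p (f j)"
  shows "smooth_near A p (\<lambda>q. \<Sum>j\<in>I. f j q) \<and> v (\<lambda>q. \<Sum>j\<in>I. f j q) = (\<Sum>j\<in>I. v (f j))"
  using I
proof (induction I rule: finite_induct)
  case empty
  show ?case using tangent_vector_const[OF A v] smooth_nearI[OF smooth_fun_on_const[OF A open_UNIV]] by simp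
next
  case (insert j I)
  then show ?case
    using tangent_vector_add[OF A v, of "f j" "\<lambda>q. \<Sum>j\<in>I. f j q"] smooth_near_add[OF A, of p "f j" "\<lambda>q. \<Sum>j\<in>I. f j q"]
    by auto
qed

text \<open>The vector with coordinates \<open>a\<close> in the chart. The default 0 is the one of
  \<open>velocity\<close>, so that both can be equal as functions.\<close>

definition coord_vec ::
  "('p::topological_space, 'e::euclidean_space) atlas \<Rightarrow> 'p set \<Rightarrow> ('p \<Rightarrow> 'e) \<Rightarrow> 'p \<Rightarrow> 'e \<Rightarrow> 'p tvec"
  where "coord_vec A U x q a = (\<lambda>f.
    if smooth_near A q f then frechet_derivative (\<lambda>z. f (inv_into U x z)) (at (x q)) a else 0)"

lemma smooth_near_has_derivative:
  assumes A: "smooth_atlas A" and U: "(U, x) \<in> A" "q \<in> U" and f: "smooth_near A q f"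
  shows "((\<lambda>z. f (inv_into U x z)) has_derivative (\<lambda>a. coord_vec A U x q a f)) (at (x q))"
proof -
  from f obtain S where S: "q \<in> S" "smooth_fun_on A S f" unfolding smooth_near_def by blast
  have "smooth_on (x ` (S \<inter> U)) (\<lambda>z. f (inv_into U x z))" "open (x ` (S \<inter> U))"
    using S(2) U(1) chart_open_image_Int[OF A U(1)] by (auto simp: smooth_fun_on_iff)
  from smooth_on_has_derivative[OF this] show ?thesis
    using f S(1) U(2) unfolding coord_vec_def by simp
qed

section \<open>Tangent spaces in coordinates\<close>

lemma linear_coord_vec:
  assumes A: "smooth_atlas A" and U: "(U, x) \<in> A" "q \<in> U"
  shows "linear (coord_vec A U x q)"
proof -
  have "linear (\<lambda>a. coord_vec A U x q a f)" for f
  proof (cases "smooth_near A q f")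
    case True
    show ?thesis by (rule has_derivative_linear[OF smooth_near_has_derivative[OF A U True]])
  next
    case False
    then show ?thesis by (simp add: coord_vec_def linear_zero)
  qed
  note l = linear_add[OF this] linear_scale[OF this]
  show ?thesis by (rule linearI) (auto simp: fun_eq_iff l)
qed

text \<open>Near 0 the function \<open>f\<close> along \<open>c\<close> is its coordinate expression
  composed with the curve \<open>x (c t)\<close>, so the chain rule applies.\<close>

lemma coord_vec_eq_velocity:
  assumes A: "smooth_atlas A" and U: "(U, x) \<in> A" "c 0 \<in> U"
    and c: "smooth_map_on euclidean_atlas A {-e<..<e} c" "e > 0"
    and D: "((\<lambda>t. x (c t)) has_derivative (\<lambda>t. t *\<^sub>R a)) (at 0)"
  shows "velocity A c = coord_vec A U x (c 0) a"
proof
  fix f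
  show "velocity A c f = coord_vec A U x (c 0) a f"
  proof (cases "smooth_near A (c 0) f")
    case True
    let ?L = "\<lambda>a. coord_vec A U x (c 0) a f"
    have o: "open ({-e<..<e} \<inter> c -` U)"
      using continuous_open_preimage[OF smooth_map_onD(2,1)[OF c(1)] chart_open[OF A U(1)]] .
    note lin = has_derivative_linear[OF smooth_near_has_derivative[OF A U True]]
    have "((\<lambda>t. f (inv_into U x (x (c t)))) has_derivative (\<lambda>t. ?L (t *\<^sub>R a))) (at 0)"
      by (rule has_derivative_compose[OF D smooth_near_has_derivative[OF A U True]])
    then have "((\<lambda>t. f (c t)) has_derivative (\<lambda>t. ?L (t *\<^sub>R a))) (at 0)"
      by (rule has_derivative_transform_within_open[OF _ o])
        (use U c(2) chart_inj[OF A U(1)] in \<open>auto simp: inv_into_f_f\<close>)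
    then have "((\<lambda>t. f (c t)) has_real_derivative ?L a) (at 0)"
      by (rule has_derivative_imp_has_field_derivative) (simp add: linear_scale[OF lin])
    then show ?thesis by (rule DERIV_unique[OF velocity_has_derivative[OF A c True]])
  qed (simp add: velocity_def coord_vec_def)
qed

text \<open>Velocities of curves do not visibly form a vector space; as the image of a linear map
  they do. One inclusion differentiates a curve read in the chart, the other uses straight
  lines.\<close>

lemma tangent_space_eq_range:
  assumes A: "smooth_atlas A" and U: "(U, x) \<in> A" "q \<in> U"
  shows "tangent_space A q = range (coord_vec A U x q)"
proof (intro subset_antisym subsetI)
  fix v assume "v \<in> tangent_space A q"
  then obtain c e where c: "c 0 = q" "v = velocity A c" "smooth_map_on euclidean_atlas A {-e<..<e} c" "e > 0"
    by (rule tangent_vectorE)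
  have o: "open ({-e<..<e} \<inter> c -` U)"
    using continuous_open_preimage[OF smooth_map_onD(2,1)[OF c(3)] chart_open[OF A U(1)]] .
  have "smooth_on ({-e<..<e} \<inter> c -` U) (\<lambda>t. x (c t))" using c(3) U(1) by (auto simp: smooth_curve_iff)
  from smooth_on_has_derivative[OF this o, of 0]
  have D: "((\<lambda>t. x (c t)) has_derivative frechet_derivative (\<lambda>t. x (c t)) (at 0)) (at 0)"
    using c U by auto
  note lin = has_derivative_linear[OF D]
  have "frechet_derivative (\<lambda>t. x (c t)) (at 0) = (\<lambda>t. t *\<^sub>R frechet_derivative (\<lambda>t. x (c t)) (at 0) 1)"
  proof
    fix t :: real
    show "frechet_derivative (\<lambda>t. x (c t)) (at 0) t = t *\<^sub>R frechet_derivative (\<lambda>t. x (c t)) (at 0) 1"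
      using linear_scale[OF lin, of t 1] by simp
  qed
  with D have "((\<lambda>t. x (c t)) has_derivative (\<lambda>t. t *\<^sub>R frechet_derivative (\<lambda>t. x (c t)) (at 0) 1)) (at 0)"
    by metis
  from coord_vec_eq_velocity[OF A U(1) _ c(3,4) this] show "v \<in> range (coord_vec A U x q)"
    using c U(2) by auto
next
  fix v assume "v \<in> range (coord_vec A U x q)"
  then obtain a where v: "v = coord_vec A U x q a" by blast
  define c where "c t = inv_into U x (x q + t *\<^sub>R a)" for t :: real
  have inv: "inv_into U x (x q) = q" if "q \<in> U" for q using that chart_inj[OF A U(1)] by simp
  have o: "open (x ` U)" using chart_open_image[OF A U(1)] chart_open[OF A U(1)] by blast
  have "continuous_on UNIV (\<lambda>t::real. x q + t *\<^sub>R a)" by (intro continuous_intros)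
  then have "open ((\<lambda>t::real. x q + t *\<^sub>R a) -` (x ` U))" using o by (simp add: continuous_on_open_vimage)
  moreover have "0 \<in> (\<lambda>t::real. x q + t *\<^sub>R a) -` (x ` U)" using U by simp
  ultimately obtain e where e: "e > 0" "ball 0 e \<subseteq> (\<lambda>t::real. x q + t *\<^sub>R a) -` (x ` U)"
    using open_contains_ball by blast
  have in_U: "x q + t *\<^sub>R a \<in> x ` U" if "t \<in> {-e<..<e}" for t using e(2) that by (auto simp: subset_iff dist_real_def)
  have cU: "c t \<in> U" "x (c t) = x q + t *\<^sub>R a" if "t \<in> {-e<..<e}" for t
    using in_U[OF that] by (auto simp: c_def inv_into_into f_inv_into_f)
  have c0: "c 0 = q" using inv U by (simp add: c_def)
  have "smooth_map_on euclidean_atlas A {-e<..<e} c"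
  proof (rule smooth_map_onI[OF smooth_atlas_euclidean A])
    show "continuous_on {-e<..<e} c"
      unfolding c_def
      by (rule continuous_on_compose2[OF chart_inv_continuous[OF A U(1)]]) (use in_U in \<open>auto intro!: continuous_intros\<close>)
    have "smooth_on {-e<..<e} (\<lambda>t. x q + t *\<^sub>R a)"
      by (intro smooth_on_add smooth_on_const smooth_on_bounded_linear[OF _ bounded_linear_scaleR_left] smooth_on_id) auto
    then have "smooth_on {-e<..<e} (\<lambda>t. x (c t))"
      by (rule smooth_on_cong[rotated 2]) (auto simp: cU)
    then have *: "(UNIV, \<lambda>x. x) \<in> euclidean_atlas \<and> (U, x) \<in> A \<and> open {-e<..<e} \<and> t \<in> {-e<..<e} \<and> {-e<..<e} \<subseteq> UNIV \<and>
      c ` {-e<..<e} \<subseteq> U \<and> smooth_on ((\<lambda>x. x) ` {-e<..<e}) (\<lambda>z. x (c (inv_into UNIV (\<lambda>x. x) z)))"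
      if "t \<in> {-e<..<e}" for t
      using that U(1) cU by (auto simp: euclidean_atlas_def)
    show "\<exists>U x V y T. (U, x) \<in> euclidean_atlas \<and> (V, y) \<in> A \<and> open T \<and> t \<in> T \<and> T \<subseteq> U \<and>
      c ` T \<subseteq> V \<and> smooth_on (x ` T) (\<lambda>z. y (c (inv_into U x z)))" if "t \<in> {-e<..<e}" for t
      by (intro exI) (rule *[OF that])
  qed auto
  note c = this e(1)
  have "((\<lambda>t. x q + t *\<^sub>R a) has_derivative (\<lambda>t. t *\<^sub>R a)) (at 0)"
    by (auto intro!: derivative_eq_intros)
  then have "((\<lambda>t. x (c t)) has_derivative (\<lambda>t. t *\<^sub>R a)) (at 0)"
    by (rule has_derivative_transform_within_open[of _ _ _ _ "{-e<..<e}"]) (use e(1) cU in auto)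
  from coord_vec_eq_velocity[OF A U(1) _ c this] c0 U(2) v have "v = velocity A c" by simp
  then show "v \<in> tangent_space A q" unfolding tangent_space_def using c c0 by blast
qed

lemma subspace_tangent_space:
  assumes A: "smooth_atlas A" shows "subspace (tangent_space A p)"
proof -
  obtain U x where U: "(U, x) \<in> A" "p \<in> U" using chart_exists[OF A] .
  show ?thesis unfolding tangent_space_eq_range[OF A U]
    by (rule linear_subspace_image[OF linear_coord_vec[OF A U] subspace_UNIV])
qed

text \<open>If \<open>v\<close> is the velocity of \<open>c\<close>, its image is the velocity of
  the curve \<open>F (c t)\<close>.\<close>

lemma differential_tangent:
  assumes A: "smooth_atlas A" and B: "smooth_atlas B" and F: "smooth_map_on A B UNIV F"
    and v: "v \<in> tangent_space A p"
  shows "differential B F p v \<in> tangent_space B (F p)"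
proof -
  from v obtain c e where c: "c 0 = p" "v = velocity A c" "smooth_map_on euclidean_atlas A {-e<..<e} c" "e > 0"
    by (rule tangent_vectorE)
  have Fc: "smooth_map_on euclidean_atlas B {-e<..<e} (\<lambda>t. F (c t))"
    using smooth_map_on_compose[OF smooth_atlas_euclidean A B c(3) F] by simp
  have "differential B F p v = velocity B (\<lambda>t. F (c t))"
  proof
    fix f
    have "smooth_near A p (\<lambda>q. f (F q))" if "smooth_near B (F p) f"
    proof -
      from that obtain S where "F p \<in> S" "smooth_fun_on B S f" unfolding smooth_near_def by blast
      then show ?thesis using smooth_nearI[OF smooth_fun_on_compose[OF A B F]] by simp
    qed
    then show "differential B F p v f = velocity B (\<lambda>t. F (c t)) f"
      using c by (simp add: differential_def velocity_def)
  qed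
  then show ?thesis unfolding tangent_space_def using Fc c by blast
qed

text \<open>The preimage \<open>K\<close> of the closed ball is compact, hence closed in a Hausdorff
  space. The extension by zero is smooth on \<open>V \<inter> U\<close> and zero on
  \<open>V - K\<close>, and these two open sets cover \<open>V\<close>.\<close>

lemma smooth_fun_on_bump_mult:
  fixes A :: "('p::t2_space, 'e::euclidean_space) atlas"
  assumes A: "smooth_atlas A" and U: "(U, x) \<in> A" and R: "cball z R \<subseteq> x ` U"
    and \<rho>: "smooth_on UNIV \<rho>" "\<And>w. dist z w \<ge> R \<Longrightarrow> \<rho> w = (0::real)"
    and V: "open V" and f: "smooth_fun_on A (V \<inter> U) f"
  shows "smooth_fun_on A V (\<lambda>q. if q \<in> U then \<rho> (x q) * f q else 0)" (is "smooth_fun_on A V ?f")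
proof (rule smooth_fun_on_local[OF A])
  define K where "K = inv_into U x ` cball z R"
  have "compact K" unfolding K_def
    by (rule compact_continuous_image[OF continuous_on_subset[OF chart_inv_continuous[OF A U] R] compact_cball])
  then have K: "closed K" by (rule compact_imp_closed)
  have \<rho>0: "\<rho> (x q) = 0" if "q \<in> U" "q \<notin> K" for q
  proof -
    have "inv_into U x (x q) = q" using that chart_inj[OF A U] by simp
    then have "x q \<notin> cball z R" using that(2) unfolding K_def by (metis imageI)
    then show ?thesis by (intro \<rho>(2)) simp
  qed
  fix q assume q: "q \<in> V"
  show "\<exists>T. q \<in> T \<and> T \<subseteq> V \<and> smooth_fun_on A T ?f"
  proof (cases "q \<in> U")
    case True
    have o: "open (V \<inter> U)" using V chart_open[OF A U] by blast
    have "smooth_fun_on A (V \<inter> U) (\<lambda>q. \<rho> (x q))"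
      by (rule smooth_fun_on_chart[OF A U o _ smooth_on_subset[OF \<rho>(1)]]) auto
    then have "smooth_fun_on A (V \<inter> U) (\<lambda>q. \<rho> (x q) * f q)"
      by (rule smooth_fun_on_mult[OF A _ f])
    then have "smooth_fun_on A (V \<inter> U) ?f"
      by (rule smooth_fun_on_cong[OF A]) auto
    then show ?thesis using q True by (intro exI[of _ "V \<inter> U"]) simp
  next
    case False
    have "K \<subseteq> U" unfolding K_def using R by (auto intro: inv_into_into)
    with False have "q \<notin> K" by blast
    have "smooth_fun_on A (V - K) (\<lambda>q. 0)" by (rule smooth_fun_on_const[OF A open_Diff[OF V K]])
    then have "smooth_fun_on A (V - K) ?f" by (rule smooth_fun_on_cong[OF A]) (auto simp: \<rho>0)
    then show ?thesis using q \<open>q \<notin> K\<close> by (intro exI[of _ "V - K"]) auto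
  qed
qed

text \<open>A coordinate frame made global: \<open>F b\<close> are cut-off coordinate functions,
  \<open>Z b\<close> cut-off coordinate fields, and \<open>\<kappa>\<close> is the cut-off. The
  expansion is demanded at every \<open>q\<close>, since a connection accepts only global
  sections.\<close>

definition local_frame ::
  "('p::topological_space, 'e::euclidean_space) atlas \<Rightarrow> 'p \<Rightarrow> ('p \<Rightarrow> real) \<Rightarrow> ('e \<Rightarrow> 'p \<Rightarrow> real)
    \<Rightarrow> ('e \<Rightarrow> 'p \<Rightarrow> 'p tvec) \<Rightarrow> bool"
  where "local_frame A p \<kappa> F Z \<longleftrightarrow>
    smooth_fun_on A UNIV \<kappa> \<and> (\<exists>T. open T \<and> p \<in> T \<and> (\<forall>q\<in>T. \<kappa> q = 1)) \<and>
    (\<forall>b\<in>Basis. smooth_fun_on A UNIV (F b) \<and> Z b \<in> vector_fields A) \<and>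
    (\<forall>q. \<forall>v\<in>tangent_space A q. \<kappa> q *\<^sub>R v = (\<Sum>b\<in>Basis. v (F b) *\<^sub>R Z b q)) \<and>
    (\<forall>b\<in>Basis. \<forall>c\<in>Basis. Z b p (F c) = (if b = c then 1 else 0))"

lemma local_frame_exists:
  fixes A :: "('p::t2_space, 'e::euclidean_space) atlas"
  assumes A: "smooth_atlas A"
  obtains \<kappa> F Z where "local_frame A p \<kappa> F Z"
proof -
  obtain U x where U: "(U, x) \<in> A" "p \<in> U" using chart_exists[OF A] .
  have oU: "open U" by (rule chart_open[OF A U(1)])
  have "open (x ` U)" using chart_open_image[OF A U(1) oU] by blast
  then obtain R where R: "R > 0" "cball (x p) R \<subseteq> x ` U" using U(2) open_contains_cball by (metis imageI)
  \<comment> \<open>Two nested cut-offs: \<open>\<rho>\<close> vanishes from radius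
    \<open>R/2\<close> on, while \<open>\<rho>'\<close> is 1 up to that radius. Thus
    \<open>F b\<close> is the true coordinate wherever \<open>\<kappa>\<close> or \<open>Z b\<close>
    is nonzero, and the expansion holds globally.\<close>
  obtain \<rho> :: "'e \<Rightarrow> real" where \<rho>: "smooth_on UNIV \<rho>" "\<And>z. dist (x p) z \<le> R/4 \<Longrightarrow> \<rho> z = 1"
    "\<And>z. dist (x p) z \<ge> R/2 \<Longrightarrow> \<rho> z = 0"
    using smooth_bump[of "R/4" "R/2" "x p"] R(1) by auto
  obtain \<rho>' :: "'e \<Rightarrow> real" where \<rho>': "smooth_on UNIV \<rho>'" "\<And>z. dist (x p) z \<le> R/2 \<Longrightarrow> \<rho>' z = 1"
    "\<And>z. dist (x p) z \<ge> R \<Longrightarrow> \<rho>' z = 0"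
    using smooth_bump[of "R/2" R "x p"] R(1) by auto
  have \<rho>0: "\<rho> z = 0" if "dist (x p) z \<ge> R" for z using that R(1) by (intro \<rho>(3)) simp
  \<comment> \<open>The factor 1 gives \<open>\<kappa>\<close> the shape required by
    \<open>smooth_fun_on_bump_mult\<close>, applied to a constant function.\<close>
  define \<kappa> where "\<kappa> q = (if q \<in> U then \<rho> (x q) * 1 else 0)" for q
  define F where "F b q = (if q \<in> U then \<rho>' (x q) * (x q \<bullet> b) else 0)" for b q
  define Z where "Z b q = (if q \<in> U then \<rho> (x q) *\<^sub>R coord_vec A U x q b else 0)" for b q
  have \<kappa>: "smooth_fun_on A UNIV \<kappa>"
    unfolding \<kappa>_def
    by (rule smooth_fun_on_bump_mult[OF A U(1) R(2) \<rho>(1) \<rho>0 open_UNIV])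
      (use smooth_fun_on_const[OF A oU] in auto)
  have coord: "smooth_fun_on A U (\<lambda>q. x q \<bullet> b)" for b
    using smooth_fun_on_chart[OF A U(1) oU subset_refl] chart_open_image[OF A U(1) oU subset_refl]
      smooth_on_bounded_linear[OF _ bounded_linear_inner_left smooth_on_id, of "x ` U" b]
    by blast
  have F: "smooth_fun_on A UNIV (F b)" for b
    unfolding F_def
    by (rule smooth_fun_on_bump_mult[OF A U(1) R(2) \<rho>'(1,3) open_UNIV]) (use coord in simp_all)
  have near: "\<exists>T. open T \<and> q \<in> T \<and> T \<subseteq> U \<and> (\<forall>q'\<in>T. dist (x p) (x q') < r)" if "q \<in> U" "dist (x p) (x q) < r" for q r
  proof (intro exI conjI)
    show "open (U \<inter> x -` ball (x p) r)"
      by (rule continuous_open_preimage[OF chart_continuous[OF A U(1)] oU open_ball])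
  qed (use that in auto)
  \<comment> \<open>The strict inequality leaves a neighbourhood of \<open>q\<close> on which
    \<open>F b\<close> equals the coordinate function, which suffices by locality.\<close>
  have cv: "coord_vec A U x q a (F b) = a \<bullet> b" if q: "q \<in> U" "dist (x p) (x q) < R/2" for q a b
  proof -
    have t: "coord_vec A U x q a \<in> tangent_space A q" using tangent_space_eq_range[OF A U(1) q(1)] by blast
    obtain T where T: "open T" "q \<in> T" "T \<subseteq> U" "\<forall>q'\<in>T. dist (x p) (x q') < R/2" using near[OF q] by blast
    have "F b q' = x q' \<bullet> b" if "q' \<in> T" for q'
      using T(3,4) that \<rho>'(2)[of "x q'"] by (auto simp: F_def)
    then have "coord_vec A U x q a (F b) = coord_vec A U x q a (\<lambda>q. x q \<bullet> b)"
      by (rule tangent_vector_cong[OF A t T(1,2)])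
    also have "\<dots> = a \<bullet> b"
    proof -
      have o: "open (x ` U)" by (rule chart_open_image[OF A U(1) oU subset_refl])
      have "((\<lambda>z. z \<bullet> b) has_derivative (\<lambda>a. a \<bullet> b)) (at (x q))" by (auto intro!: derivative_eq_intros)
      then have "((\<lambda>z. x (inv_into U x z) \<bullet> b) has_derivative (\<lambda>a. a \<bullet> b)) (at (x q))"
        by (rule has_derivative_transform_within_open[OF _ o]) (use q(1) in \<open>auto simp: f_inv_into_f\<close>)
      from has_derivative_unique[OF this smooth_near_has_derivative[OF A U(1) q(1) smooth_nearI[OF coord q(1)]]]
      show ?thesis by metis
    qed
    finally show ?thesis .
  qed
  have Z: "Z b \<in> vector_fields A" for b
    unfolding vector_fields_def sections_along_def
  proof (safe)
    fix q
    show "Z b q \<in> tangent_space A q"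
    proof (cases "q \<in> U")
      case True
      then have "coord_vec A U x q b \<in> tangent_space A q" using tangent_space_eq_range[OF A U(1)] by blast
      then show ?thesis using True by (simp add: Z_def subspace_scale[OF subspace_tangent_space[OF A]])
    qed (simp add: Z_def subspace_0[OF subspace_tangent_space[OF A]])
  next
    fix V f assume f: "smooth_fun_on A V f"
    have oV: "open V" and oVU: "open (V \<inter> U)" using smooth_fun_on_open[OF f] oU by auto
    have "smooth_on (x ` (V \<inter> U)) (\<lambda>z. frechet_derivative (\<lambda>z. f (inv_into U x z)) (at z) b)"
      using f U(1) by (intro smooth_on_frechet_derivative) (auto simp: smooth_fun_on_iff)
    then have "smooth_fun_on A (V \<inter> U) (\<lambda>q. frechet_derivative (\<lambda>z. f (inv_into U x z)) (at (x q)) b)"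
      by (rule smooth_fun_on_chart[OF A U(1) oVU Int_lower2])
    then have "smooth_fun_on A V (\<lambda>q. if q \<in> U then \<rho> (x q) * frechet_derivative (\<lambda>z. f (inv_into U x z)) (at (x q)) b else 0)"
      by (rule smooth_fun_on_bump_mult[OF A U(1) R(2) \<rho>(1) _ oV, rotated]) (rule \<rho>0)
    then have "smooth_fun_on A V (\<lambda>q. Z b q f)"
      by (rule smooth_fun_on_cong[OF A]) (auto simp: Z_def coord_vec_def intro: smooth_nearI[OF f])
    then show "smooth_fun_on A ((\<lambda>p. p) -` V) (\<lambda>p. Z b p f)" by simp
  qed
  have dec: "\<kappa> q *\<^sub>R v = (\<Sum>b\<in>Basis. v (F b) *\<^sub>R Z b q)" if v: "v \<in> tangent_space A q" for q v
  proof (cases "q \<in> U \<and> dist (x p) (x q) < R/2")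
    case True
    then obtain a where a: "v = coord_vec A U x q a" using v tangent_space_eq_range[OF A U(1)] by auto
    note lin = linear_coord_vec[OF A U(1), of q]
    have "v = coord_vec A U x q (\<Sum>b\<in>Basis. (a \<bullet> b) *\<^sub>R b)" unfolding a by (simp add: euclidean_representation)
    also have "\<dots> = (\<Sum>b\<in>Basis. (a \<bullet> b) *\<^sub>R coord_vec A U x q b)"
      using True by (simp add: linear_sum[OF lin] linear_scale[OF lin])
    finally have "\<kappa> q *\<^sub>R v = (\<Sum>b\<in>Basis. (a \<bullet> b) *\<^sub>R \<kappa> q *\<^sub>R coord_vec A U x q b)"
      by (simp add: scaleR_sum_right mult.commute)
    also have "\<dots> = (\<Sum>b\<in>Basis. v (F b) *\<^sub>R Z b q)"
      using True cv by (simp add: a Z_def \<kappa>_def)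
    finally show ?thesis .
  next
    \<comment> \<open>Outside the chart, or from radius \<open>R/2\<close> on, both sides
      vanish.\<close>
    case False
    then have "\<kappa> q = 0" "Z b q = 0" for b using \<rho>(3)[of "x q"] by (auto simp: \<kappa>_def Z_def)
    then show ?thesis by simp
  qed
  obtain T where T: "open T" "p \<in> T" "T \<subseteq> U" "\<forall>q\<in>T. dist (x p) (x q) < R/4"
    using near[OF U(2), of "R/4"] R(1) by auto
  have "\<forall>q\<in>T. \<kappa> q = 1"
    using T(3,4) \<rho>(2) by (auto simp: \<kappa>_def subset_iff less_imp_le)
  then have "\<exists>T. open T \<and> p \<in> T \<and> (\<forall>q\<in>T. \<kappa> q = 1)" using T by blast
  moreover have "Z b p (F c) = (if b = c then 1 else 0)" if "b \<in> Basis" "c \<in> Basis" for b c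
    using cv[OF U(2), of b c] R(1) U(2) \<rho>(2)[of "x p"] that by (simp add: Z_def inner_Basis)
  ultimately have "local_frame A p \<kappa> F Z" unfolding local_frame_def using \<kappa> F Z dec by blast
  then show ?thesis by (rule that)
qed

section \<open>Traces and sections along a map\<close>

lemma linear_on_subspace_sum:
  assumes T: "linear_on_subspace V T" and V: "subspace V" and u: "\<And>j. j \<in> I \<Longrightarrow> u j \<in> V"
  shows "T (\<Sum>j\<in>I. c j *\<^sub>R u j) = (\<Sum>j\<in>I. c j *\<^sub>R T (u j))"
  using u
proof (induction I rule: infinite_finite_induct)
  case (insert j I)
  have "(\<Sum>j\<in>I. c j *\<^sub>R u j) \<in> V" using insert.prems by (intro subspace_sum[OF V] subspace_scale[OF V]) simp
  moreover have "u j \<in> V" "c j *\<^sub>R u j \<in> V" using insert.prems by (auto intro: subspace_scale[OF V])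
  ultimately show ?case using insert T unfolding linear_on_subspace_def by simp
next
  case empty
  have "T (0 *\<^sub>R 0) = 0 *\<^sub>R T 0" using T subspace_0[OF V] unfolding linear_on_subspace_def by blast
  then show ?case by simp
next
  \<comment> \<open>Sums over infinite sets are 0, so the claim is \<open>T 0 = 0\<close>.\<close>
  case (infinite I)
  have "T (0 *\<^sub>R 0) = 0 *\<^sub>R T 0" using T subspace_0[OF V] unfolding linear_on_subspace_def by blast
  then show ?case using infinite by simp
qed

section \<open>Inner products, orthonormal bases and traces on subspaces\<close>

lemma linear_on_subspaceD:
  assumes "linear_on_subspace V T"
  shows "u \<in> V \<Longrightarrow> v \<in> V \<Longrightarrow> T (u + v) = T u + T v" "u \<in> V \<Longrightarrow> T (c *\<^sub>R u) = c *\<^sub>R T u"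
  using assms unfolding linear_on_subspace_def by auto

text \<open>The product varies with the point and lives on a subspace of a function type, so a
  predicate takes the place of the type class of inner product spaces.\<close>

definition inner_product_on :: "'a::real_vector set \<Rightarrow> ('a \<Rightarrow> 'a \<Rightarrow> real) \<Rightarrow> bool"
  where "inner_product_on V q \<longleftrightarrow> subspace V \<and> (\<forall>u\<in>V. linear_on_subspace V (q u)) \<and>
    (\<forall>u\<in>V. \<forall>v\<in>V. q u v = q v u) \<and> (\<forall>u\<in>V. u \<noteq> 0 \<longrightarrow> q u u > 0)"

lemma inner_product_onD:
  assumes "inner_product_on V q"
  shows "subspace V" "u \<in> V \<Longrightarrow> linear_on_subspace V (q u)" "u \<in> V \<Longrightarrow> v \<in> V \<Longrightarrow> q u v = q v u"
    "u \<in> V \<Longrightarrow> u \<noteq> 0 \<Longrightarrow> q u u > 0"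
  using assms unfolding inner_product_on_def by auto

lemma inner_product_on_add:
  assumes q: "inner_product_on V q" and uv: "u \<in> V" "v \<in> V" "w \<in> V"
  shows inner_product_on_add_right: "q w (u + v) = q w u + q w v"
    and inner_product_on_add_left: "q (u + v) w = q u w + q v w"
proof -
  show 1: "q w (u + v) = q w u + q w v"
    using linear_on_subspaceD(1)[OF inner_product_onD(2)[OF q uv(3)]] uv by auto
  then show "q (u + v) w = q u w + q v w"
    using inner_product_onD(3)[OF q _ uv(3)] uv subspace_add[OF inner_product_onD(1)[OF q]] by simp
qed

lemma inner_product_on_scaleR:
  assumes q: "inner_product_on V q" and u: "u \<in> V" and w: "w \<in> V"
  shows inner_product_on_scaleR_right: "q w (c *\<^sub>R u) = c * q w u"
    and inner_product_on_scaleR_left: "q (c *\<^sub>R u) w = c * q u w"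
proof -
  show 1: "q w (c *\<^sub>R u) = c * q w u"
    using linear_on_subspaceD(2)[OF inner_product_onD(2)[OF q w]] u by auto
  then show "q (c *\<^sub>R u) w = c * q u w"
    using inner_product_onD(3)[OF q _ w] u subspace_scale[OF inner_product_onD(1)[OF q]] by simp
qed

lemma inner_product_on_sum:
  assumes q: "inner_product_on V q" and w: "w \<in> V" and u: "\<And>j. j \<in> I \<Longrightarrow> u j \<in> V"
  shows inner_product_on_sum_right: "q w (\<Sum>j\<in>I. c j *\<^sub>R u j) = (\<Sum>j\<in>I. c j * q w (u j))"
    and inner_product_on_sum_left: "q (\<Sum>j\<in>I. c j *\<^sub>R u j) w = (\<Sum>j\<in>I. c j * q (u j) w)"
proof -
  note V = inner_product_onD(1)[OF q]
  show 1: "q w (\<Sum>j\<in>I. c j *\<^sub>R u j) = (\<Sum>j\<in>I. c j * q w (u j))"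
    using linear_on_subspace_sum[where T="q w" and I=I and u=u, OF inner_product_onD(2)[OF q w] V u] by simp
  have "(\<Sum>j\<in>I. c j *\<^sub>R u j) \<in> V" by (intro subspace_sum[OF V] subspace_scale[OF V] u)
  then have "q (\<Sum>j\<in>I. c j *\<^sub>R u j) w = q w (\<Sum>j\<in>I. c j *\<^sub>R u j)" by (rule inner_product_onD(3)[OF q _ w])
  also note 1
  also have "(\<Sum>j\<in>I. c j * q w (u j)) = (\<Sum>j\<in>I. c j * q (u j) w)"
    using inner_product_onD(3)[OF q w u] by (intro sum.cong) auto
  finally show "q (\<Sum>j\<in>I. c j *\<^sub>R u j) w = (\<Sum>j\<in>I. c j * q (u j) w)" .
qed

lemma orthonormal_independent:
  assumes q: "inner_product_on V q" and E: "E \<subseteq> V" "\<forall>u\<in>E. \<forall>v\<in>E. q u v = (if u = v then 1 else 0)"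
  shows "independent E"
proof
  assume "dependent E"
  then obtain t c w where t: "finite t" "t \<subseteq> E" "(\<Sum>v\<in>t. c v *\<^sub>R v) = 0" "w \<in> t" "c w \<noteq> 0"
    unfolding dependent_explicit by blast
  have wV: "w \<in> V" using t E by blast
  have "q w (\<Sum>v\<in>t. c v *\<^sub>R v) = (\<Sum>v\<in>t. c v * q w v)"
    by (rule inner_product_on_sum_right[OF q wV]) (use t E in auto)
  also have "\<dots> = (\<Sum>v\<in>t. if v = w then c v else 0)"
    using t E by (intro sum.cong) (auto simp: subset_iff)
  also have "\<dots> = c w" using t by simp
  finally have "q w 0 = c w" using t(3) by simp
  moreover have "q w (0 *\<^sub>R w) = 0 * q w w" by (rule inner_product_on_scaleR_right[OF q wV wV])
  ultimately show False using t(5) by simp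
qed

text \<open>Orthonormal sets have at most \<open>card B\<close> elements, so one of maximal size
  exists; if it did not span \<open>V\<close>, a Gram-Schmidt step would enlarge it. Existence gives
  meaning to the \<open>SOME\<close> in \<open>metric_trace\<close>.\<close>

lemma orthonormal_basis_exists:
  assumes q: "inner_product_on V q" and B: "finite B" "span B = V"
  shows "\<exists>E. finite E \<and> span E = V \<and> (\<forall>u\<in>E. \<forall>v\<in>E. q u v = (if u = v then 1 else 0))"
proof -
  note V = inner_product_onD(1)[OF q]
  let ?P = "\<lambda>E. E \<subseteq> V \<and> (\<forall>u\<in>E. \<forall>v\<in>E. q u v = (if u = v then 1 else 0))"
  have bound: "finite E \<and> card E \<le> card B" if "?P E" for E
    using that B by (intro independent_span_bound orthonormal_independent[OF q]) auto
  have "?P {}" by simp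
  moreover have "\<forall>E. ?P E \<longrightarrow> card E < Suc (card B)" using bound by (simp add: less_Suc_eq_le)
  ultimately have "\<exists>E. ?P E \<and> (\<forall>E'. ?P E' \<longrightarrow> card E' \<le> card E)"
    by (rule ex_has_greatest_nat)
  then obtain E where E: "?P E" and max: "\<And>E'. ?P E' \<Longrightarrow> card E' \<le> card E" by blast
  have fin: "finite E" using bound E by blast
  have "span E = V"
  proof (rule ccontr)
    assume "span E \<noteq> V"
    moreover have "span E \<subseteq> V" using E V by (simp add: span_minimal)
    ultimately obtain v where v: "v \<in> V" "v \<notin> span E" by blast
    \<comment> \<open>The orthogonal projection of \<open>v\<close> onto \<open>span E\<close>; the
      remainder, normalised to \<open>w'\<close>, contradicts maximality.\<close>
    define s where "s = (\<Sum>e\<in>E. q e v *\<^sub>R e)"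
    have s: "s \<in> span E" unfolding s_def by (intro span_sum span_scale span_base)
    then have sV: "s \<in> V" using \<open>span E \<subseteq> V\<close> by blast
    define w where "w = v + (-1) *\<^sub>R s"
    have wV: "w \<in> V" unfolding w_def by (intro subspace_add[OF V] subspace_scale[OF V] v sV)
    have w0: "w \<noteq> 0" using v s by (auto simp: w_def)
    have ew: "q e w = 0" if e: "e \<in> E" for e
    proof -
      have eV: "e \<in> V" using e E by blast
      have "q e s = (\<Sum>e'\<in>E. q e' v * q e e')"
        unfolding s_def by (rule inner_product_on_sum_right[OF q eV]) (use E in auto)
      also have "\<dots> = (\<Sum>e'\<in>E. if e' = e then q e' v else 0)" using E e by (intro sum.cong) auto
      also have "\<dots> = q e v" using e fin by simp
      finally show ?thesis
        unfolding w_def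
        using inner_product_on_add_right[OF q v(1) subspace_scale[OF V sV, of "-1"] eV]
          inner_product_on_scaleR_right[OF q sV eV, of "-1"] by simp
    qed
    define r where "r = 1 / sqrt (q w w)"
    define w' where "w' = r *\<^sub>R w"
    have pos: "q w w > 0" using inner_product_onD(4)[OF q wV w0] .
    have w'V: "w' \<in> V" unfolding w'_def by (rule subspace_scale[OF V wV])
    have "q w' w' = r * (r * q w w)"
      unfolding w'_def
      by (simp add: inner_product_on_scaleR_left[OF q wV subspace_scale[OF V wV]]
          inner_product_on_scaleR_right[OF q wV wV])
    then have 1: "q w' w' = 1" using pos by (simp add: r_def)
    have 2: "q e w' = 0" "q w' e = 0" if e: "e \<in> E" for e
    proof -
      have eV: "e \<in> V" using e E by blast
      show "q e w' = 0" unfolding w'_def using inner_product_on_scaleR_right[OF q wV eV] ew[OF e] by simp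
      then show "q w' e = 0" using inner_product_onD(3)[OF q w'V eV] by simp
    qed
    have "w' \<notin> E" using 1 2(1) by force
    have "?P (insert w' E)" using E 1 2 w'V \<open>w' \<notin> E\<close> by auto
    from max[OF this] show False using \<open>w' \<notin> E\<close> fin by simp
  qed
  then show ?thesis using E fin by blast
qed

text \<open>The basis in \<open>trace_on\<close> is chosen by \<open>SOME\<close>; the existence of
  a basis is enough, because the diagonal coefficients are \<open>c\<close> in each of them.\<close>

lemma trace_on_scaleR:
  assumes ex: "independent B" "span B = V" and T: "\<And>v. v \<in> V \<Longrightarrow> T v = c *\<^sub>R v"
  shows "trace_on V T = c * real (dim V)"
proof -
  define b where "b = (SOME b. independent b \<and> span b = V)"
  have b: "independent b \<and> span b = V" unfolding b_def by (rule someI[of _ B]) (use ex in blast)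
  have "trace_on V T = (\<Sum>v\<in>b. representation b (T v) v)" by (simp add: trace_on_def b_def Let_def)
  also have "\<dots> = (\<Sum>v\<in>b. c)"
  proof (rule sum.cong[OF refl])
    fix v assume v: "v \<in> b"
    then have "v \<in> span b" by (rule span_base)
    then show "representation b (T v) v = c"
      using b v T by (simp add: representation_scale representation_basis)
  qed
  also have "\<dots> = c * real (card b)" by simp
  also have "card b = dim V" using b dim_span dim_eq_card_independent by metis
  finally show ?thesis .
qed

text \<open>Every summand over an orthonormal basis equals \<open>x\<close>, so only the number of
  basis vectors counts.\<close>

lemma metric_trace_scaleR:
  assumes q: "inner_product_on V q" and B: "finite B" "span B = V"
    and b: "\<And>v. v \<in> V \<Longrightarrow> b v v = q v v *\<^sub>R x"
  shows "metric_trace V q b = real (dim V) *\<^sub>R x"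
proof -
  let ?P = "\<lambda>E. finite E \<and> span E = V \<and> (\<forall>u\<in>E. \<forall>v\<in>E. q u v = (if u = v then 1 else 0))"
  define E where "E = (SOME E. ?P E)"
  have E: "?P E" unfolding E_def by (rule someI_ex[OF orthonormal_basis_exists[OF q B]])
  then have EV: "E \<subseteq> V" using span_superset by blast
  have "metric_trace V q b = (\<Sum>e\<in>E. b e e)" by (simp add: metric_trace_def E_def Let_def)
  also have "\<dots> = (\<Sum>e\<in>E. x)" using E EV b by (intro sum.cong) auto
  also have "\<dots> = real (card E) *\<^sub>R x" by (simp add: scaleR_conv_of_real sum_constant_scaleR)
  also have "card E = dim V"
    using E orthonormal_independent[OF q EV] dim_span dim_eq_card_independent by metis
  finally show ?thesis .
qed

section \<open>Frames and the dimension of tangent spaces\<close>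

lemma local_frameD:
  assumes "local_frame A p \<kappa> F Z"
  shows "smooth_fun_on A UNIV \<kappa>" "\<exists>T. open T \<and> p \<in> T \<and> (\<forall>q\<in>T. \<kappa> q = 1)" "\<kappa> p = 1"
    "b \<in> Basis \<Longrightarrow> smooth_fun_on A UNIV (F b)" "b \<in> Basis \<Longrightarrow> Z b \<in> vector_fields A"
    "v \<in> tangent_space A q \<Longrightarrow> \<kappa> q *\<^sub>R v = (\<Sum>b\<in>Basis. v (F b) *\<^sub>R Z b q)"
    "b \<in> Basis \<Longrightarrow> c \<in> Basis \<Longrightarrow> Z b p (F c) = (if b = c then 1 else 0)"
  using assms unfolding local_frame_def by auto

lemma vector_field_tangent: "X \<in> vector_fields A \<Longrightarrow> X p \<in> tangent_space A p"
  unfolding vector_fields_def sections_along_def by auto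

lemma section_tangent: "W \<in> sections_along A B i \<Longrightarrow> W p \<in> tangent_space B (i p)"
  unfolding sections_along_def by auto

lemma section_smooth:
  "W \<in> sections_along A B i \<Longrightarrow> smooth_fun_on B V f \<Longrightarrow> smooth_fun_on A (i -` V) (\<lambda>p. W p f)"
  unfolding sections_along_def by auto

text \<open>The frame vectors at \<open>p\<close> span by the expansion with
  \<open>\<kappa> p = 1\<close>, and they are independent because the differentials of the functions
  \<open>F c\<close> are dual to them.\<close>

lemma tangent_space_basis:
  fixes A :: "('p::t2_space, 'e::euclidean_space) atlas"
  assumes A: "smooth_atlas A"
  obtains B where "finite B" "independent B" "span B = tangent_space A p" "card B = DIM('e)"
proof -
  obtain \<kappa> F Z where fr: "local_frame A p \<kappa> F Z" using local_frame_exists[OF A] .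
  note fr = local_frameD[OF fr] and sub = subspace_tangent_space[OF A, of p]
  \<comment> \<open>\<open>L\<close> sends \<open>Basis\<close> to the frame vectors; its
    injectivity yields independence and cardinality at once.\<close>
  define L where "L a = (\<Sum>b\<in>Basis. (a \<bullet> b) *\<^sub>R Z b p)" for a
  have lin: "linear L"
    by (rule linearI) (simp_all add: L_def inner_add_left scaleR_add_left sum.distrib scaleR_sum_right)
  have LF: "L a (F c) = a \<bullet> c" if c: "c \<in> Basis" for a c
  proof -
    have "L a (F c) = (\<Sum>b\<in>Basis. (a \<bullet> b) * Z b p (F c))" by (simp add: L_def sum_fun_apply)
    also have "\<dots> = (\<Sum>b\<in>Basis. if b = c then a \<bullet> b else 0)" using fr(7) c by (intro sum.cong) auto
    finally show ?thesis using c by simp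
  qed
  have inj: "inj L"
  proof (rule injI)
    fix a a' assume "L a = L a'"
    then show "a = a'" using LF by (metis euclidean_eqI)
  qed
  have Lb: "L b = Z b p" if b: "b \<in> Basis" for b
  proof -
    have "L b = (\<Sum>c\<in>Basis. if c = b then Z c p else 0)"
      unfolding L_def using b by (intro sum.cong) (auto simp: inner_Basis)
    then show ?thesis using b by simp
  qed
  have "span (L ` Basis) = tangent_space A p"
  proof
    show "span (L ` Basis) \<subseteq> tangent_space A p"
      using Lb fr(5) vector_field_tangent by (intro span_minimal sub) fastforce
    show "tangent_space A p \<subseteq> span (L ` Basis)"
    proof
      fix v assume "v \<in> tangent_space A p"
      from fr(6)[OF this] fr(3) have "v = (\<Sum>b\<in>Basis. v (F b) *\<^sub>R L b)" using Lb by simp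
      moreover have "(\<Sum>b\<in>Basis. v (F b) *\<^sub>R L b) \<in> span (L ` Basis)"
        by (intro span_sum span_scale span_base) auto
      ultimately show "v \<in> span (L ` Basis)" by metis
    qed
  qed
  moreover have "independent (L ` Basis)"
    by (rule linear_independent_injective_image[OF lin independent_Basis inj_on_subset[OF inj subset_UNIV]])
  moreover have "card (L ` Basis) = DIM('e)" using inj by (simp add: card_image inj_on_subset)
  ultimately show ?thesis by (intro that[of "L ` Basis"]) auto
qed

lemma dim_tangent_space:
  fixes A :: "('p::t2_space, 'e::euclidean_space) atlas"
  assumes A: "smooth_atlas A"
  shows "dim (tangent_space A p) = DIM('e)"
proof -
  obtain B where "finite B" "independent B" "span B = tangent_space A p" "card B = DIM('e)"
    using tangent_space_basis[OF A] .
  then show ?thesis using dim_span dim_eq_card_independent by metis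
qed

section \<open>Sections along a map\<close>

lemma sections_along_zero:
  assumes A: "smooth_atlas A" and B: "smooth_atlas B" and i: "smooth_map_on A B UNIV i"
  shows "(\<lambda>p. 0) \<in> sections_along A B i"
proof -
  have "open (i -` V)" if "smooth_fun_on B V f" for V f
    using continuous_open_preimage[OF smooth_map_onD(2)[OF i] open_UNIV smooth_fun_on_open[OF that]] by simp
  then show ?thesis
    unfolding sections_along_def
    using subspace_0[OF subspace_tangent_space[OF B]] smooth_fun_on_const[OF A] by auto
qed

lemma sections_along_add:
  assumes A: "smooth_atlas A" and B: "smooth_atlas B"
    and W: "W \<in> sections_along A B i" "W' \<in> sections_along A B i"
  shows "(\<lambda>p. W p + W' p) \<in> sections_along A B i"
  using W subspace_add[OF subspace_tangent_space[OF B]] smooth_fun_on_add[OF A]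
  unfolding sections_along_def by auto

lemma sections_along_scaleR:
  assumes A: "smooth_atlas A" and B: "smooth_atlas B"
    and W: "W \<in> sections_along A B i" and f: "smooth_fun_on A UNIV f"
  shows "(\<lambda>p. f p *\<^sub>R W p) \<in> sections_along A B i"
proof -
  have "smooth_fun_on A (i -` V) (\<lambda>p. f p * W p k)" if k: "smooth_fun_on B V k" for V k
  proof (rule smooth_fun_on_mult[OF A])
    note s = section_smooth[OF W k]
    show "smooth_fun_on A (i -` V) (\<lambda>p. W p k)" by (rule s)
    show "smooth_fun_on A (i -` V) f" by (rule smooth_fun_on_subset[OF f smooth_fun_on_open[OF s]]) simp
  qed
  then show ?thesis
    using section_tangent[OF W] subspace_scale[OF subspace_tangent_space[OF B]]
    unfolding sections_along_def by auto
qed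

lemma sections_along_sum:
  assumes A: "smooth_atlas A" and B: "smooth_atlas B" and i: "smooth_map_on A B UNIV i"
    and "finite I" "\<And>j. j \<in> I \<Longrightarrow> W j \<in> sections_along A B i"
  shows "(\<lambda>p. \<Sum>j\<in>I. W j p) \<in> sections_along A B i"
  using assms(4,5)
  by (induction I rule: finite_induct) (auto intro: sections_along_zero[OF A B i] sections_along_add[OF A B])

lemma vector_field_along:
  assumes A: "smooth_atlas A" and B: "smooth_atlas B" and i: "smooth_map_on A B UNIV i"
    and Z: "Z \<in> vector_fields B"
  shows "(\<lambda>p. Z (i p)) \<in> sections_along A B i"
proof -
  have "smooth_fun_on A (i -` V) (\<lambda>p. Z (i p) f)" if f: "smooth_fun_on B V f" for V f
    using smooth_fun_on_compose[OF A B i section_smooth[OF Z[unfolded vector_fields_def] f]] by simp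
  then show ?thesis
    using vector_field_tangent[OF Z] unfolding sections_along_def by auto
qed

lemma smooth_map_ident:
  assumes A: "smooth_atlas A" shows "smooth_map_on A A UNIV (\<lambda>p. p)"
  using chart_transition[OF A] by (auto simp: smooth_map_on_def)

text \<open>Combining the frame fields with the constant coefficients \<open>v (F b)\<close> extends
  \<open>v\<close>. This is how pointwise statements are reached from axioms about fields.\<close>

lemma vector_field_extend:
  fixes A :: "('p::t2_space, 'e::euclidean_space) atlas"
  assumes A: "smooth_atlas A" and v: "v \<in> tangent_space A p"
  obtains X where "X \<in> vector_fields A" "X p = v"
proof -
  obtain \<kappa> F Z where fr: "local_frame A p \<kappa> F Z" using local_frame_exists[OF A] .
  note fr = local_frameD[OF fr]
  have "(\<lambda>q. \<Sum>b\<in>Basis. v (F b) *\<^sub>R Z b q) \<in> vector_fields A"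
    unfolding vector_fields_def
    by (intro sections_along_sum[OF A A smooth_map_ident[OF A]] sections_along_scaleR[OF A A]
        smooth_fun_on_const[OF A] fr(5)[unfolded vector_fields_def]) auto
  moreover have "(\<Sum>b\<in>Basis. v (F b) *\<^sub>R Z b p) = v" using fr(6)[OF v] fr(3) by simp
  ultimately show ?thesis by (rule that)
qed

lemma differential_smooth:
  "smooth_near B (i p) f \<Longrightarrow> differential B i p v f = v (\<lambda>q. f (i q))"
  by (simp add: differential_def)

lemma differential_along:
  assumes A: "smooth_atlas A" and B: "smooth_atlas B" and i: "smooth_map_on A B UNIV i"
    and X: "X \<in> vector_fields A"
  shows "(\<lambda>p. differential B i p (X p)) \<in> sections_along A B i"
proof -
  have "smooth_fun_on A (i -` V) (\<lambda>p. differential B i p (X p) f)" if f: "smooth_fun_on B V f" for V f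
  proof -
    have "smooth_fun_on A (i -` V) (\<lambda>p. f (i p))" using smooth_fun_on_compose[OF A B i f] by simp
    from section_smooth[OF X[unfolded vector_fields_def] this]
    have "smooth_fun_on A (i -` V) (\<lambda>p. X p (\<lambda>q. f (i q)))" by simp
    then show ?thesis
      by (rule smooth_fun_on_cong[OF A]) (auto simp: differential_smooth[OF smooth_nearI[OF f]])
  qed
  then show ?thesis
    using differential_tangent[OF A B i] vector_field_tangent[OF X] unfolding sections_along_def by auto
qed

text \<open>Smoothness of \<open>T\<close> is known only on vector fields of the target, and
  \<open>W\<close> need not be the restriction of one. Near each point \<open>W\<close> is a
  combination of restricted frame fields with smooth coefficients \<open>W q (F b)\<close>, and
  linearity of \<open>T\<close> reduces to these.\<close>

lemma endomorphism_along:
  fixes A :: "('p::topological_space, 'e::euclidean_space) atlas"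
    and B :: "('q::t2_space, 'f::euclidean_space) atlas"
  assumes A: "smooth_atlas A" and B: "smooth_atlas B" and i: "smooth_map_on A B UNIV i"
    and T: "endomorphism_field B T" and W: "W \<in> sections_along A B i"
  shows "(\<lambda>p. T (i p) (W p)) \<in> sections_along A B i"
proof -
  have lin: "linear_on_subspace (tangent_space B q) (T q)" for q
    using T unfolding endomorphism_field_def by blast
  have "smooth_fun_on A (i -` V) (\<lambda>p. T (i p) (W p) f)" if f: "smooth_fun_on B V f" for V f
  proof (rule smooth_fun_on_local[OF A])
    fix p assume p: "p \<in> i -` V"
    obtain \<kappa> F Z where fr: "local_frame B (i p) \<kappa> F Z" using local_frame_exists[OF B] .
    note fr = local_frameD[OF fr]
    obtain S where S: "open S" "i p \<in> S" "\<And>q. q \<in> S \<Longrightarrow> \<kappa> q = 1" using fr(2) by blast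
    define R where "R = i -` V \<inter> i -` S"
    have oR: "open R"
      using continuous_open_preimage[OF smooth_map_onD(2)[OF i] open_UNIV smooth_fun_on_open[OF f]]
        continuous_open_preimage[OF smooth_map_onD(2)[OF i] open_UNIV S(1)] by (auto simp: R_def)
    have "smooth_fun_on A R (\<lambda>q. \<Sum>b\<in>Basis. W q (F b) * T (i q) (Z b (i q)) f)"
    proof (intro smooth_fun_on_sum[OF A oR] smooth_fun_on_mult[OF A] finite_Basis)
      fix b :: 'f assume b: "b \<in> Basis"
      show "smooth_fun_on A R (\<lambda>q. W q (F b))"
        by (rule smooth_fun_on_subset[OF _ oR]) (use section_smooth[OF W fr(4)[OF b]] in auto)
      have "(\<lambda>q. T q (Z b q)) \<in> vector_fields B" using T fr(5)[OF b] unfolding endomorphism_field_def by blast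
      from section_smooth[OF vector_field_along[OF A B i this] f]
      show "smooth_fun_on A R (\<lambda>q. T (i q) (Z b (i q)) f)"
        by (rule smooth_fun_on_subset[OF _ oR]) (simp add: R_def)
    qed
    moreover have "(\<Sum>b\<in>Basis. W q (F b) * T (i q) (Z b (i q)) f) = T (i q) (W q) f" if q: "q \<in> R" for q
    proof -
      have "\<kappa> (i q) = 1" using q S(3) by (simp add: R_def)
      then have "W q = (\<Sum>b\<in>Basis. W q (F b) *\<^sub>R Z b (i q))" using fr(6)[OF section_tangent[OF W, of q]] by simp
      then have "T (i q) (W q) = T (i q) (\<Sum>b\<in>Basis. W q (F b) *\<^sub>R Z b (i q))" by metis
      also have "\<dots> = (\<Sum>b\<in>Basis. W q (F b) *\<^sub>R T (i q) (Z b (i q)))"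
        by (rule linear_on_subspace_sum[OF lin subspace_tangent_space[OF B]]) (intro vector_field_tangent fr(5))
      finally show ?thesis by (simp add: sum_fun_apply)
    qed
    ultimately have "smooth_fun_on A R (\<lambda>p. T (i p) (W p) f)" by (rule smooth_fun_on_cong[OF A])
    then show "\<exists>R. p \<in> R \<and> R \<subseteq> i -` V \<and> smooth_fun_on A R (\<lambda>p. T (i p) (W p) f)"
      using p S(2) by (intro exI[of _ R]) (auto simp: R_def)
  qed
  moreover have "T (i p) (W p) \<in> tangent_space B (i p)" for p
    using T section_tangent[OF W, of p] unfolding endomorphism_field_def by blast
  ultimately show ?thesis unfolding sections_along_def by auto
qed

section \<open>Connections along an immersion\<close>

lemma covariant_derivativeD:
  assumes "covariant_derivative A \<Gamma> D" "X \<in> vector_fields A"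
  shows "W \<in> \<Gamma> \<Longrightarrow> D X W \<in> \<Gamma>"
    "W \<in> \<Gamma> \<Longrightarrow> Z \<in> \<Gamma> \<Longrightarrow> D X (\<lambda>p. W p + Z p) = (\<lambda>p. D X W p + D X Z p)"
    "W \<in> \<Gamma> \<Longrightarrow> smooth_fun_on A UNIV f \<Longrightarrow>
      D X (\<lambda>p. f p *\<^sub>R W p) = (\<lambda>p. X p f *\<^sub>R W p + f p *\<^sub>R D X W p)"
  using assms unfolding covariant_derivative_def plus_fun_def by auto

lemma pullback_connection_sum:
  assumes A: "smooth_atlas A" and B: "smooth_atlas B" and i: "smooth_map_on A B UNIV i"
    and D: "covariant_derivative A (sections_along A B i) D" and X: "X \<in> vector_fields A"
    and I: "finite I" "\<And>j. j \<in> I \<Longrightarrow> W j \<in> sections_along A B i"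
  shows "D X (\<lambda>p. \<Sum>j\<in>I. W j p) = (\<lambda>p. \<Sum>j\<in>I. D X (W j) p)"
  using I
proof (induction I rule: finite_induct)
  case empty
  note z = sections_along_zero[OF A B i]
  \<comment> \<open>Additivity alone gives \<open>D X 0 = D X 0 + D X 0\<close>, hence the
    derivative of the zero section is zero.\<close>
  have "D X (\<lambda>p. 0 + 0) = (\<lambda>p. D X (\<lambda>p. 0) p + D X (\<lambda>p. 0) p)"
    by (rule covariant_derivativeD(2)[OF D X z z])
  then have "D X (\<lambda>p. 0) p = D X (\<lambda>p. 0) p + D X (\<lambda>p. 0) p" for p
    by (simp only: add_0_left) (rule fun_cong)
  then have "D X (\<lambda>p. 0) p = 0" for p by (simp only: add_cancel_right_right)
  then show ?case by (simp only: sum.empty)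
next
  case (insert j I)
  have "D X (\<lambda>p. W j p + (\<Sum>j\<in>I. W j p)) = (\<lambda>p. D X (W j) p + D X (\<lambda>p. \<Sum>j\<in>I. W j p) p)"
    by (rule covariant_derivativeD(2)[OF D X]) (use insert in \<open>auto intro: sections_along_sum[OF A B i]\<close>)
  then show ?case using insert by (simp only: sum.insert[OF insert(1,2)] insertI2)
qed

text \<open>The Leibniz rule and the values on restricted ambient fields determine
  \<open>D'\<close>. The fields \<open>Z j\<close> are left arbitrary so that the result covers both
  a frame and its image under \<open>\<phi>\<close>.\<close>

lemma pullback_connection_expand:
  assumes A: "smooth_atlas A" and B: "smooth_atlas B" and i: "smooth_map_on A B UNIV i"
    and D': "pullback_connection A B i D D'" and X: "X \<in> vector_fields A"
    and Y: "Y \<in> vector_fields B" "Y (i p) = differential B i p (X p)"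
    and V: "V \<in> sections_along A B i"
    and \<kappa>: "smooth_fun_on B UNIV \<kappa>" "open S" "i p \<in> S" "\<And>q. q \<in> S \<Longrightarrow> \<kappa> q = 1"
    and I: "finite I" "\<And>j. j \<in> I \<Longrightarrow> smooth_fun_on A UNIV (f j)" "\<And>j. j \<in> I \<Longrightarrow> Z j \<in> vector_fields B"
    and eq: "\<And>q. \<kappa> (i q) *\<^sub>R V q = (\<Sum>j\<in>I. f j q *\<^sub>R Z j (i q))"
  shows "D' X V p = (\<Sum>j\<in>I. X p (f j) *\<^sub>R Z j (i p) + f j p *\<^sub>R D Y (Z j) (i p))"
proof -
  have cov: "covariant_derivative A (sections_along A B i) D'"
    using D' unfolding pullback_connection_def by blast
  have pull: "D' X (\<lambda>q. Z (i q)) p = D Y Z (i p)" if "Z \<in> vector_fields B" for Z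
    using D' X Y that unfolding pullback_connection_def by blast
  have \<kappa>i: "smooth_fun_on A UNIV (\<lambda>q. \<kappa> (i q))" using smooth_fun_on_compose[OF A B i \<kappa>(1)] by simp
  have o: "open (i -` S)" using continuous_open_preimage[OF smooth_map_onD(2)[OF i] open_UNIV \<kappa>(2)] by simp
  \<comment> \<open>Since \<open>\<kappa>\<close> is constant near \<open>i p\<close>, its
    derivative vanishes, so multiplying \<open>V\<close> by it leaves \<open>D' X V p\<close>
    unchanged.\<close>
  have "X p (\<lambda>q. \<kappa> (i q)) = X p (\<lambda>q. 1)"
    by (rule tangent_vector_cong[OF A vector_field_tangent[OF X] o]) (use \<kappa> in auto)
  then have X\<kappa>: "X p (\<lambda>q. \<kappa> (i q)) = 0" using tangent_vector_const[OF A vector_field_tangent[OF X]] by simp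
  have "D' X (\<lambda>q. \<kappa> (i q) *\<^sub>R V q) p = X p (\<lambda>q. \<kappa> (i q)) *\<^sub>R V p + \<kappa> (i p) *\<^sub>R D' X V p"
    using covariant_derivativeD(3)[OF cov X V \<kappa>i] by metis
  then have "D' X V p = D' X (\<lambda>q. \<kappa> (i q) *\<^sub>R V q) p" using X\<kappa> \<kappa> by simp
  also have "\<dots> = D' X (\<lambda>q. \<Sum>j\<in>I. f j q *\<^sub>R Z j (i q)) p" by (simp only: eq)
  also have "\<dots> = (\<Sum>j\<in>I. D' X (\<lambda>q. f j q *\<^sub>R Z j (i q)) p)"
    by (subst pullback_connection_sum[OF A B i cov X I(1)])
      (auto intro: sections_along_scaleR[OF A B vector_field_along[OF A B i I(3)] I(2)])
  also have "\<dots> = (\<Sum>j\<in>I. X p (f j) *\<^sub>R Z j (i p) + f j p *\<^sub>R D Y (Z j) (i p))"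
  proof (rule sum.cong[OF refl])
    fix j assume j: "j \<in> I"
    show "D' X (\<lambda>q. f j q *\<^sub>R Z j (i q)) p = X p (f j) *\<^sub>R Z j (i p) + f j p *\<^sub>R D Y (Z j) (i p)"
      using covariant_derivativeD(3)[OF cov X vector_field_along[OF A B i I(3)[OF j]] I(2)[OF j]] pull[OF I(3)[OF j]]
      by simp
  qed
  finally show ?thesis .
qed

section \<open>Metric compatibility and the structure equation along a map\<close>

lemma levi_civitaD:
  assumes "levi_civita A g D" "X \<in> vector_fields A" "Y \<in> vector_fields A"
  shows "D X Y \<in> vector_fields A"
    and "Z \<in> vector_fields A \<Longrightarrow> X p (\<lambda>q. g q (Y q) (Z q)) = g p (D X Y p) (Z p) + g p (Y p) (D X Z p)"
  using assms covariant_derivativeD(1)[of A "vector_fields A" D X Y] unfolding levi_civita_def by auto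

lemma riemannian_metric_inner_product_on:
  assumes B: "smooth_atlas B" and g: "riemannian_metric B g"
  shows "inner_product_on (tangent_space B p) (g p)"
  unfolding inner_product_on_def
proof (intro conjI)
  show "subspace (tangent_space B p)" by (rule subspace_tangent_space[OF B])
qed (use g in \<open>simp_all add: riemannian_metric_def\<close>)

text \<open>After expanding both sections, the product rule for \<open>v b\<close>,
  \<open>w c\<close> and the metric coefficients reduces the claim to compatibility of
  \<open>D\<close> on frame fields. For an orthogonal pair the derivative of the product is zero,
  which leaves a rule for moving a derivative from one section to the other.\<close>

lemma pullback_connection_metric_orthogonal:
  fixes B :: "('q::t2_space, 'f::euclidean_space) atlas"
  assumes A: "smooth_atlas A" and B: "smooth_atlas B" and i: "smooth_map_on A B UNIV i"
    and g: "riemannian_metric B g" and D: "levi_civita B g D"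
    and D': "pullback_connection A B i D D'" and X: "X \<in> vector_fields A"
    and V: "V \<in> sections_along A B i" and W: "W \<in> sections_along A B i"
    and ortho: "\<And>q. g (i q) (V q) (W q) = 0"
  shows "g (i p) (D' X V p) (W p) + g (i p) (V p) (D' X W p) = 0"
proof -
  obtain \<kappa> F Z where fr: "local_frame B (i p) \<kappa> F Z" using local_frame_exists[OF B] .
  note fr = local_frameD[OF fr]
  obtain S where S: "open S" "i p \<in> S" "\<And>q. q \<in> S \<Longrightarrow> \<kappa> q = 1" using fr(2) by blast
  note Xt = vector_field_tangent[OF X, of p]
  \<comment> \<open>The image of \<open>X\<close> need not come from an ambient field;
    \<open>pullback_connection\<close> asks for agreement at the one point \<open>i p\<close>
    only.\<close>
  obtain Y where Y: "Y \<in> vector_fields B" "Y (i p) = differential B i p (X p)"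
    using vector_field_extend[OF B differential_tangent[OF A B i Xt]] .
  note ip = riemannian_metric_inner_product_on[OF B g]
  have DZ: "D Y (Z b) (i p) \<in> tangent_space B (i p)" if "b \<in> Basis" for b
    by (rule vector_field_tangent[OF levi_civitaD(1)[OF D Y(1) fr(5)[OF that]]])
  have Zt: "Z b q \<in> tangent_space B q" if "b \<in> Basis" for b q using vector_field_tangent[OF fr(5)[OF that]] .
  define v where "v = (\<lambda>b q. V q (F b))"
  define w where "w = (\<lambda>b q. W q (F b))"
  define G where "G = (\<lambda>b c q. g q (Z b q) (Z c q))"
  have v: "smooth_fun_on A UNIV (v b)" and w: "smooth_fun_on A UNIV (w b)" if "b \<in> Basis" for b
    using section_smooth[OF V fr(4)[OF that]] section_smooth[OF W fr(4)[OF that]] by (auto simp: v_def w_def)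
  have G: "smooth_fun_on B UNIV (G b c)" if "b \<in> Basis" "c \<in> Basis" for b c
    using g fr(5) that unfolding riemannian_metric_def G_def by blast
  then have Gi: "smooth_fun_on A UNIV (\<lambda>q. G b c (i q))" if "b \<in> Basis" "c \<in> Basis" for b c
    using smooth_fun_on_compose[OF A B i] that by fastforce
  have Veq: "\<kappa> (i q) *\<^sub>R V q = (\<Sum>b\<in>Basis. v b q *\<^sub>R Z b (i q))" for q
    unfolding v_def by (rule fr(6)[OF section_tangent[OF V]])
  have Weq: "\<kappa> (i q) *\<^sub>R W q = (\<Sum>b\<in>Basis. w b q *\<^sub>R Z b (i q))" for q
    unfolding w_def by (rule fr(6)[OF section_tangent[OF W]])
  have Vp: "V p = (\<Sum>b\<in>Basis. v b p *\<^sub>R Z b (i p))" and Wp: "W p = (\<Sum>b\<in>Basis. w b p *\<^sub>R Z b (i p))"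
    using Veq[of p] Weq[of p] fr(3) by auto
  have DV: "D' X V p = (\<Sum>b\<in>Basis. X p (v b) *\<^sub>R Z b (i p)) + (\<Sum>b\<in>Basis. v b p *\<^sub>R D Y (Z b) (i p))"
    using pullback_connection_expand[OF A B i D' X Y V fr(1) S finite_Basis v fr(5) Veq] by (simp add: sum.distrib)
  have DW: "D' X W p = (\<Sum>b\<in>Basis. X p (w b) *\<^sub>R Z b (i p)) + (\<Sum>b\<in>Basis. w b p *\<^sub>R D Y (Z b) (i p))"
    using pullback_connection_expand[OF A B i D' X Y W fr(1) S finite_Basis w fr(5) Weq] by (simp add: sum.distrib)
  have gsum: "g q (\<Sum>b\<in>Basis. c b *\<^sub>R x b) (\<Sum>b\<in>Basis. d b *\<^sub>R y b) =
      (\<Sum>b\<in>Basis. \<Sum>b'\<in>Basis. c b * (d b' * g q (x b) (y b')))"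
    if "\<And>b. b \<in> Basis \<Longrightarrow> x b \<in> tangent_space B q" "\<And>b. b \<in> Basis \<Longrightarrow> y b \<in> tangent_space B q"
    for q c d and x y :: "'f \<Rightarrow> 'q tvec"
  proof -
    have "(\<Sum>b\<in>Basis. d b *\<^sub>R y b) \<in> tangent_space B q"
      by (intro subspace_sum subspace_scale subspace_tangent_space[OF B] that(2))
    then show ?thesis
      using that by (simp add: inner_product_on_sum_left[OF ip] inner_product_on_sum_right[OF ip] sum_distrib_left)
  qed
  \<comment> \<open>Along \<open>i\<close> the derivative by \<open>X p\<close> is the derivative by
    \<open>Y (i p)\<close>, so the ambient compatibility applies to the metric coefficients.\<close>
  have XG: "X p (\<lambda>q. G b c (i q)) = g (i p) (D Y (Z b) (i p)) (Z c (i p)) + g (i p) (Z b (i p)) (D Y (Z c) (i p))"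
    if bc: "b \<in> Basis" "c \<in> Basis" for b c
  proof -
    have "X p (\<lambda>q. G b c (i q)) = Y (i p) (G b c)"
      unfolding Y(2) by (rule differential_smooth[symmetric, OF smooth_nearI[OF G[OF bc]]]) simp
    then show ?thesis
      unfolding G_def by (simp only: levi_civitaD(2)[OF D Y(1) fr(5)[OF bc(1)] fr(5)[OF bc(2)]])
  qed
  \<comment> \<open>The double sum is \<open>g(V, W)\<close> times the square of
    \<open>\<kappa>\<close>, hence zero at every \<open>q\<close>, so \<open>X p\<close> may be
    applied to it as to a constant.\<close>
  have zero: "(\<Sum>b\<in>Basis. \<Sum>c\<in>Basis. v b q * (w c q * G b c (i q))) = 0" for q
  proof -
    have "(\<Sum>b\<in>Basis. \<Sum>c\<in>Basis. v b q * (w c q * G b c (i q))) = g (i q) (\<kappa> (i q) *\<^sub>R V q) (\<kappa> (i q) *\<^sub>R W q)"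
      unfolding Veq Weq using gsum[of "\<lambda>b. Z b (i q)" "i q" "\<lambda>b. Z b (i q)" "\<lambda>b. v b q" "\<lambda>b. w b q"] Zt
      by (simp add: G_def)
    also have "\<dots> = \<kappa> (i q) * (\<kappa> (i q) * g (i q) (V q) (W q))"
      using section_tangent[OF V, of q] section_tangent[OF W, of q]
      by (simp add: inner_product_on_scaleR_left[OF ip] inner_product_on_scaleR_right[OF ip]
          subspace_scale[OF subspace_tangent_space[OF B]])
    finally show ?thesis by (simp add: ortho)
  qed
  have near: "smooth_near A p f" if "smooth_fun_on A UNIV f" for f using smooth_nearI[OF that] by simp
  have prod: "smooth_near A p (\<lambda>q. v b q * (w c q * G b c (i q))) \<and>
      X p (\<lambda>q. v b q * (w c q * G b c (i q))) =
      X p (v b) * (w c p * G b c (i p)) + v b p * (X p (w c) * G b c (i p) + w c p * X p (\<lambda>q. G b c (i q)))"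
    if bc: "b \<in> Basis" "c \<in> Basis" for b c
  proof -
    note n = near[OF v[OF bc(1)]] near[OF w[OF bc(2)]] near[OF Gi[OF bc]]
    note m = smooth_near_mult[OF A n(2,3)]
    show ?thesis
      using smooth_near_mult[OF A n(1) m] tangent_vector_mult[OF A Xt n(1) m] tangent_vector_mult[OF A Xt n(2,3)] by simp
  qed
  have inner: "smooth_near A p (\<lambda>q. \<Sum>c\<in>Basis. v b q * (w c q * G b c (i q))) \<and>
      X p (\<lambda>q. \<Sum>c\<in>Basis. v b q * (w c q * G b c (i q))) = (\<Sum>c\<in>Basis. X p (\<lambda>q. v b q * (w c q * G b c (i q))))"
    if b: "b \<in> Basis" for b
    by (rule tangent_vector_sum[OF A Xt finite_Basis]) (rule conjunct1[OF prod[OF b]])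
  have "0 = X p (\<lambda>q. \<Sum>b\<in>Basis. \<Sum>c\<in>Basis. v b q * (w c q * G b c (i q)))"
    unfolding zero by (rule tangent_vector_const[OF A Xt, symmetric])
  also have "\<dots> = (\<Sum>b\<in>Basis. X p (\<lambda>q. \<Sum>c\<in>Basis. v b q * (w c q * G b c (i q))))"
    by (rule conjunct2[OF tangent_vector_sum[OF A Xt finite_Basis]]) (rule conjunct1[OF inner])
  also have "\<dots> = (\<Sum>b\<in>Basis. \<Sum>c\<in>Basis. X p (\<lambda>q. v b q * (w c q * G b c (i q))))"
    by (intro sum.cong[OF refl] conjunct2[OF inner])
  also have "\<dots> = (\<Sum>b\<in>Basis. \<Sum>c\<in>Basis.
      X p (v b) * (w c p * G b c (i p)) + v b p * (w c p * g (i p) (D Y (Z b) (i p)) (Z c (i p))) +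
      (v b p * (X p (w c) * G b c (i p)) + v b p * (w c p * g (i p) (Z b (i p)) (D Y (Z c) (i p)))))"
    by (intro sum.cong[OF refl]) (simp add: prod XG algebra_simps)
  also have "\<dots> = g (i p) (D' X V p) (W p) + g (i p) (V p) (D' X W p)"
  proof -
    have sub: "(\<Sum>b\<in>Basis. c b *\<^sub>R x b) \<in> tangent_space B (i p)"
      if "\<And>b. b \<in> Basis \<Longrightarrow> x b \<in> tangent_space B (i p)" for c :: "'f \<Rightarrow> real" and x
      by (intro subspace_sum subspace_scale subspace_tangent_space[OF B] that)
    have "g (i p) (D' X V p) (W p) = (\<Sum>b\<in>Basis. \<Sum>c\<in>Basis. X p (v b) * (w c p * G b c (i p)))
        + (\<Sum>b\<in>Basis. \<Sum>c\<in>Basis. v b p * (w c p * g (i p) (D Y (Z b) (i p)) (Z c (i p))))"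
      unfolding DV Wp G_def
      by (subst inner_product_on_add_left[OF ip]) (simp_all add: sub Zt DZ gsum)
    moreover have "g (i p) (V p) (D' X W p) = (\<Sum>b\<in>Basis. \<Sum>c\<in>Basis. v b p * (X p (w c) * G b c (i p)))
        + (\<Sum>b\<in>Basis. \<Sum>c\<in>Basis. v b p * (w c p * g (i p) (Z b (i p)) (D Y (Z c) (i p))))"
      unfolding DW Vp G_def
      by (subst inner_product_on_add_right[OF ip]) (simp_all add: sub Zt DZ gsum)
    ultimately show ?thesis by (simp only: sum.distrib)
  qed
  finally show ?thesis by simp
qed

text \<open>The covariant derivative of \<open>\<phi>\<close> is tensorial: in the expansion the
  derivatives of the coefficients cancel, and the ambient identity remains for each frame field. For
  \<open>W\<close> orthogonal to \<open>\<xi>\<close> the conclusion leaves only a multiple of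
  \<open>\<xi>\<close> besides \<open>\<phi> (D' X W)\<close>.\<close>

lemma generalized_quasi_sasakian_along:
  fixes B :: "('q::t2_space, 'f::euclidean_space) atlas"
  assumes A: "smooth_atlas A" and B: "smooth_atlas B" and i: "smooth_map_on A B UNIV i"
    and gqs: "generalized_quasi_sasakian B \<phi> \<xi> \<eta> g D"
    and D': "pullback_connection A B i D D'" and X: "X \<in> vector_fields A"
    and W: "W \<in> sections_along A B i"
  shows "\<exists>r u. D' X (\<lambda>q. \<phi> (i q) (W q)) p = r *\<^sub>R \<xi> (i p) - \<eta> (i p) (W p) *\<^sub>R u + \<phi> (i p) (D' X W p)"
proof -
  from gqs have acm: "almost_contact_metric B \<phi> \<xi> \<eta> g" and lc: "levi_civita B g D"
    and eq: "\<And>X Y p. X \<in> vector_fields B \<Longrightarrow> Y \<in> vector_fields B \<Longrightarrow>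
      D X (\<lambda>q. \<phi> q (Y q)) p - \<phi> p (D X Y p) =
      g p (D (\<lambda>q. \<phi> q (X q)) \<xi> p) (Y p) *\<^sub>R \<xi> p - \<eta> p (Y p) *\<^sub>R D (\<lambda>q. \<phi> q (X q)) \<xi> p"
    unfolding generalized_quasi_sasakian_def by auto
  from acm have \<phi>: "endomorphism_field B \<phi>" and \<eta>: "one_form B \<eta>" unfolding almost_contact_metric_def by auto
  have lin\<phi>: "linear_on_subspace (tangent_space B q) (\<phi> q)" and lin\<eta>: "linear_on_subspace (tangent_space B q) (\<eta> q)" for q
    using \<phi> \<eta> unfolding endomorphism_field_def one_form_def by auto
  obtain \<kappa> F Z where fr: "local_frame B (i p) \<kappa> F Z" using local_frame_exists[OF B] .
  note fr = local_frameD[OF fr]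
  obtain S where S: "open S" "i p \<in> S" "\<And>q. q \<in> S \<Longrightarrow> \<kappa> q = 1" using fr(2) by blast
  obtain Y where Y: "Y \<in> vector_fields B" "Y (i p) = differential B i p (X p)"
    using vector_field_extend[OF B differential_tangent[OF A B i vector_field_tangent[OF X]]] .
  note sub = subspace_tangent_space[OF B]
  have DZ: "D Y (Z b) q \<in> tangent_space B q" if "b \<in> Basis" for b q
    by (rule vector_field_tangent[OF levi_civitaD(1)[OF lc Y(1) fr(5)[OF that]]])
  have Zt: "Z b q \<in> tangent_space B q" if "b \<in> Basis" for b q using vector_field_tangent[OF fr(5)[OF that]] .
  define w where "w = (\<lambda>b q. W q (F b))"
  have w: "smooth_fun_on A UNIV (w b)" if "b \<in> Basis" for b
    using section_smooth[OF W fr(4)[OF that]] by (auto simp: w_def)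
  have Weq: "\<kappa> (i q) *\<^sub>R W q = (\<Sum>b\<in>Basis. w b q *\<^sub>R Z b (i q))" for q
    unfolding w_def by (rule fr(6)[OF section_tangent[OF W]])
  have Wp: "W p = (\<Sum>b\<in>Basis. w b p *\<^sub>R Z b (i p))" using Weq[of p] fr(3) by auto
  have \<phi>Z: "(\<lambda>q. \<phi> q (Z b q)) \<in> vector_fields B" if "b \<in> Basis" for b
    using \<phi> fr(5)[OF that] unfolding endomorphism_field_def by blast
  have \<phi>sum: "\<phi> q (\<Sum>b\<in>Basis. c b *\<^sub>R x b) = (\<Sum>b\<in>Basis. c b *\<^sub>R \<phi> q (x b))"
    if "\<And>b. b \<in> Basis \<Longrightarrow> x b \<in> tangent_space B q" for q and c :: "'f \<Rightarrow> real" and x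
    by (rule linear_on_subspace_sum[OF lin\<phi> sub that])
  have \<phi>Weq: "\<kappa> (i q) *\<^sub>R \<phi> (i q) (W q) = (\<Sum>b\<in>Basis. w b q *\<^sub>R \<phi> (i q) (Z b (i q)))" for q
  proof -
    have "\<phi> (i q) (\<kappa> (i q) *\<^sub>R W q) = \<kappa> (i q) *\<^sub>R \<phi> (i q) (W q)"
      by (rule linear_on_subspaceD(2)[OF lin\<phi> section_tangent[OF W]])
    then show ?thesis unfolding Weq using \<phi>sum[of "\<lambda>b. Z b (i q)" "i q"] Zt by simp
  qed
  \<comment> \<open>Same coefficients as for \<open>W\<close>, with the ambient fields
    \<open>\<phi> (Z b)\<close> in place of \<open>Z b\<close>.\<close>
  have D\<phi>W: "D' X (\<lambda>q. \<phi> (i q) (W q)) p =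
      (\<Sum>b\<in>Basis. X p (w b) *\<^sub>R \<phi> (i p) (Z b (i p)) + w b p *\<^sub>R D Y (\<lambda>q. \<phi> q (Z b q)) (i p))"
    by (rule pullback_connection_expand[OF A B i D' X Y endomorphism_along[OF A B i \<phi> W] fr(1) S finite_Basis
          w \<phi>Z \<phi>Weq])
  have DW: "D' X W p = (\<Sum>b\<in>Basis. X p (w b) *\<^sub>R Z b (i p)) + (\<Sum>b\<in>Basis. w b p *\<^sub>R D Y (Z b) (i p))"
    using pullback_connection_expand[OF A B i D' X Y W fr(1) S finite_Basis w fr(5) Weq] by (simp add: sum.distrib)
  have "\<phi> (i p) (D' X W p) = \<phi> (i p) (\<Sum>b\<in>Basis. X p (w b) *\<^sub>R Z b (i p)) + \<phi> (i p) (\<Sum>b\<in>Basis. w b p *\<^sub>R D Y (Z b) (i p))"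
    unfolding DW by (intro linear_on_subspaceD(1)[OF lin\<phi>] subspace_sum[OF sub] subspace_scale[OF sub] Zt DZ)
  also have "\<dots> = (\<Sum>b\<in>Basis. X p (w b) *\<^sub>R \<phi> (i p) (Z b (i p)) + w b p *\<^sub>R \<phi> (i p) (D Y (Z b) (i p)))"
    using Zt DZ by (simp add: \<phi>sum sum.distrib)
  finally have \<phi>DW: "\<phi> (i p) (D' X W p) = \<dots>" .
  define u where "u = D (\<lambda>q. \<phi> q (Y q)) \<xi> (i p)"
  \<comment> \<open>The terms with \<open>X p (w b)\<close> occur on both sides of the difference
    and cancel.\<close>
  have "D' X (\<lambda>q. \<phi> (i q) (W q)) p - \<phi> (i p) (D' X W p) =
      (\<Sum>b\<in>Basis. w b p *\<^sub>R (D Y (\<lambda>q. \<phi> q (Z b q)) (i p) - \<phi> (i p) (D Y (Z b) (i p))))"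
    unfolding D\<phi>W \<phi>DW by (simp add: sum_subtractf[symmetric] scaleR_diff_right)
  also have "\<dots> = (\<Sum>b\<in>Basis. w b p *\<^sub>R (g (i p) u (Z b (i p)) *\<^sub>R \<xi> (i p) - \<eta> (i p) (Z b (i p)) *\<^sub>R u))"
    unfolding u_def by (intro sum.cong[OF refl]) (simp only: eq[OF Y(1) fr(5)])
  also have "\<dots> = (\<Sum>b\<in>Basis. w b p * g (i p) u (Z b (i p))) *\<^sub>R \<xi> (i p) - (\<Sum>b\<in>Basis. w b p * \<eta> (i p) (Z b (i p))) *\<^sub>R u"
    by (simp add: scaleR_diff_right sum_subtractf scaleR_sum_left)
  also have "(\<Sum>b\<in>Basis. w b p * \<eta> (i p) (Z b (i p))) = \<eta> (i p) (W p)"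
    unfolding Wp using linear_on_subspace_sum[OF lin\<eta> sub, of Basis "\<lambda>b. Z b (i p)"] Zt by simp
  finally have "D' X (\<lambda>q. \<phi> (i q) (W q)) p =
      (\<Sum>b\<in>Basis. w b p * g (i p) u (Z b (i p))) *\<^sub>R \<xi> (i p) - \<eta> (i p) (W p) *\<^sub>R u + \<phi> (i p) (D' X W p)"
    by (simp only: diff_eq_eq)
  then show ?thesis by blast
qed

section \<open>Umbilical invariant submanifolds\<close>

lemma differential_add: "differential B i p (u + v) = differential B i p u + differential B i p v"
  and differential_scaleR: "differential B i p (c *\<^sub>R u) = c *\<^sub>R differential B i p u"
  by (auto simp: differential_def fun_eq_iff)

text \<open>When the second distribution is zero the first is the whole tangent space, so
  \<open>\<phi>\<close> preserves the tangent spaces.\<close>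

lemma invariant_xi_perp_submanifoldD:
  assumes "invariant_xi_perp_submanifold A B i \<phi> \<xi> g"
  shows "immersion A B i" "\<xi> (i p) \<in> normal_space A B i g p"
    "u \<in> tangent_space A p \<Longrightarrow>
      \<exists>v\<in>tangent_space A p. \<phi> (i p) (differential B i p u) = differential B i p v"
proof -
  from assms obtain \<D> where \<D>: "semi_invariant_xi_perp_submanifold A B i \<phi> \<xi> g \<D> (\<lambda>p. {0})"
    unfolding invariant_xi_perp_submanifold_def by blast
  then show "immersion A B i" "\<xi> (i p) \<in> normal_space A B i g p"
    unfolding semi_invariant_xi_perp_submanifold_def by auto
  have "\<forall>p. {u + v | u v. u \<in> \<D> p \<and> v \<in> {0}} = tangent_space A p"
    using \<D> unfolding semi_invariant_xi_perp_submanifold_def by (elim conjE)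
  then have "{u + v | u v. u \<in> \<D> p \<and> v \<in> {0}} = tangent_space A p" by (rule spec)
  then have "\<D> p = tangent_space A p" by simp
  moreover have "\<forall>p. \<phi> (i p) ` (differential B i p ` \<D> p) = differential B i p ` \<D> p"
    using \<D> unfolding semi_invariant_xi_perp_submanifold_def by (elim conjE)
  ultimately have "\<phi> (i p) ` (differential B i p ` tangent_space A p) = differential B i p ` tangent_space A p"
    by metis
  then show "u \<in> tangent_space A p \<Longrightarrow>
      \<exists>v\<in>tangent_space A p. \<phi> (i p) (differential B i p u) = differential B i p v"
    by blast
qed

lemma almost_contact_metricD:
  assumes "almost_contact_metric B \<phi> \<xi> \<eta> g"
  shows "endomorphism_field B \<phi>" "\<xi> \<in> vector_fields B" "riemannian_metric B g"
    "v \<in> tangent_space B p \<Longrightarrow> \<phi> p (\<phi> p v) = - v + \<eta> p v *\<^sub>R \<xi> p"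
    "\<eta> p (\<xi> p) = 1"
    "v \<in> tangent_space B p \<Longrightarrow> \<eta> p (\<phi> p v) = 0"
    "v \<in> tangent_space B p \<Longrightarrow> \<eta> p v = g p v (\<xi> p)"
    "u \<in> tangent_space B p \<Longrightarrow> v \<in> tangent_space B p \<Longrightarrow> g p (\<phi> p u) v + g p u (\<phi> p v) = 0"
    "v \<in> tangent_space B p \<Longrightarrow> \<phi> p v \<in> tangent_space B p"
    "linear_on_subspace (tangent_space B p) (\<phi> p)"
  using assms unfolding almost_contact_metric_def endomorphism_field_def by auto

text \<open>Positive definiteness comes from injectivity of the differential.\<close>

lemma induced_metric_inner_product_on:
  assumes A: "smooth_atlas A" and B: "smooth_atlas B" and i: "immersion A B i" and g: "riemannian_metric B g"
  shows "inner_product_on (tangent_space A p) (induced_metric B i g p)"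
proof -
  note ip = riemannian_metric_inner_product_on[OF B g, of "i p"]
  have si: "smooth_map_on A B UNIV i" and inj: "inj_on (differential B i p) (tangent_space A p)"
    using i unfolding immersion_def by auto
  note t = differential_tangent[OF A B si] and sub = subspace_tangent_space[OF A, of p]
  have "differential B i p u \<noteq> 0" if "u \<in> tangent_space A p" "u \<noteq> 0" for u
  proof
    assume "differential B i p u = 0"
    also have "0 = differential B i p 0" by (simp add: differential_def fun_eq_iff)
    finally show False using inj that subspace_0[OF sub] by (auto dest: inj_onD)
  qed
  then show ?thesis
    using sub t inner_product_onD[OF ip]
    by (auto simp: inner_product_on_def induced_metric_def linear_on_subspace_def differential_add differential_scaleR
        inner_product_on_add_right[OF ip] inner_product_on_scaleR_right[OF ip])
qed

section \<open>Normal curvature of an invariant submanifold\<close>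

locale gqs_invariant_submanifold =
  fixes A :: "('p::t2_space, 'e::euclidean_space) atlas"
    and B :: "('q::t2_space, 'f::euclidean_space) atlas"
    and \<phi> \<xi> \<eta> g' nabla' i nabla nabla_i h
  assumes A: "smooth_atlas A" and B: "smooth_atlas B"
    and gqs: "generalized_quasi_sasakian B \<phi> \<xi> \<eta> g' nabla'"
    and inv: "invariant_xi_perp_submanifold A B i \<phi> \<xi> g'"
    and nabla: "levi_civita A (induced_metric B i g') nabla"
    and pull: "pullback_connection A B i nabla' nabla_i"
    and sff: "second_fundamental_form A B i g' nabla nabla_i h"
begin

abbreviation di where "di \<equiv> differential B i"
abbreviation g where "g \<equiv> induced_metric B i g'"
abbreviation N where "N \<equiv> normal_space A B i g'"

lemma acm: "almost_contact_metric B \<phi> \<xi> \<eta> g'" and nabla': "levi_civita B g' nabla'"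
  using gqs unfolding generalized_quasi_sasakian_def by auto

lemmas acmD = almost_contact_metricD[OF acm]

lemma i: "smooth_map_on A B UNIV i"
  using invariant_xi_perp_submanifoldD(1)[OF inv] unfolding immersion_def by auto

lemma ip': "inner_product_on (tangent_space B q) (g' q)"
  by (rule riemannian_metric_inner_product_on[OF B acmD(3)])

lemma ip: "inner_product_on (tangent_space A p) (g p)"
  by (rule induced_metric_inner_product_on[OF A B invariant_xi_perp_submanifoldD(1)[OF inv] acmD(3)])

lemma di_tangent: "u \<in> tangent_space A p \<Longrightarrow> di p u \<in> tangent_space B (i p)"
  by (rule differential_tangent[OF A B i])

lemma normalD: "w \<in> N p \<Longrightarrow> w \<in> tangent_space B (i p)"
  "w \<in> N p \<Longrightarrow> u \<in> tangent_space A p \<Longrightarrow> g' (i p) (di p u) w = 0"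
  unfolding normal_space_def by auto

text \<open>A skew map that preserves the tangent spaces also preserves their orthogonal
  complements.\<close>

lemma \<phi>_normal:
  assumes w: "w \<in> N p" shows "\<phi> (i p) w \<in> N p"
proof -
  have "g' (i p) (di p u) (\<phi> (i p) w) = 0" if u: "u \<in> tangent_space A p" for u
  proof -
    obtain v where "v \<in> tangent_space A p" "\<phi> (i p) (di p u) = di p v"
      using invariant_xi_perp_submanifoldD(3)[OF inv u] by blast
    then have "g' (i p) (\<phi> (i p) (di p u)) w = 0" using normalD(2)[OF w] by simp
    then show ?thesis using acmD(8)[OF di_tangent[OF u] normalD(1)[OF w]] by simp
  qed
  then show ?thesis using acmD(9)[OF normalD(1)[OF w]] unfolding normal_space_def by blast
qed

lemma h_normal:
  "X \<in> vector_fields A \<Longrightarrow> Y \<in> vector_fields A \<Longrightarrow> h p (X p) (Y p) \<in> N p"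
  using sff vector_field_tangent unfolding second_fundamental_form_def by blast

lemma gauss:
  "X \<in> vector_fields A \<Longrightarrow> Y \<in> vector_fields A \<Longrightarrow>
    nabla_i X (\<lambda>q. di q (Y q)) p = di p (nabla X Y p) + h p (X p) (Y p)"
  using sff unfolding second_fundamental_form_def by blast

text \<open>Smoothness of \<open>h\<close> is not an axiom; it follows from the Gauss formula, where
  \<open>h\<close> is the difference of two smooth sections.\<close>

lemma h_section:
  assumes X: "X \<in> vector_fields A" and Y: "Y \<in> vector_fields A"
  shows "(\<lambda>p. h p (X p) (Y p)) \<in> sections_along A B i"
proof -
  have cov: "covariant_derivative A (sections_along A B i) nabla_i"
    using pull unfolding pullback_connection_def by blast
  have "(\<lambda>p. nabla_i X (\<lambda>q. di q (Y q)) p + (-1) *\<^sub>R di p (nabla X Y p)) \<in> sections_along A B i"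
    by (intro sections_along_add[OF A B] sections_along_scaleR[OF A B] smooth_fun_on_const[OF A]
        covariant_derivativeD(1)[OF cov X] differential_along[OF A B i] levi_civitaD(1)[OF nabla X] Y open_UNIV)
  moreover have "nabla_i X (\<lambda>q. di q (Y q)) p + (-1) *\<^sub>R di p (nabla X Y p) = h p (X p) (Y p)" for p
    by (subst gauss[OF X Y]) (simp only: scaleR_minus1_left, simp)
  ultimately show ?thesis by simp
qed

text \<open>The section \<open>\<phi> h(X, X)\<close> is smooth and normal everywhere, so it can be paired with
  \<open>nabla_i X (\<phi> X)\<close> by moving the derivative onto it; this avoids showing that the tangential
  field \<open>\<phi> X\<close> is the image of a smooth vector field on the submanifold.\<close>

lemma umbilical_point_normal_curvature:
  assumes umb: "\<And>X Y. X \<in> vector_fields A \<Longrightarrow> Y \<in> vector_fields A \<Longrightarrow> h p (X p) (Y p) = g p (X p) (Y p) *\<^sub>R H"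
  shows "\<exists>t. H = t *\<^sub>R \<xi> (i p)"
proof -
  note sub = subspace_tangent_space[OF A, of p] and sub' = subspace_tangent_space[OF B, of "i p"]
  \<comment> \<open>The dimension equals that of a Euclidean space, which is positive.\<close>
  have "\<exists>u\<in>tangent_space A p. u \<noteq> 0"
  proof (rule ccontr)
    assume "\<not> ?thesis"
    then have "tangent_space A p \<subseteq> span {}" by auto
    then have "dim (tangent_space A p) \<le> 0" using dim_le_card[of "tangent_space A p" "{}"] by simp
    then show False using dim_tangent_space[OF A, of p] by simp
  qed
  then obtain u where u: "u \<in> tangent_space A p" "u \<noteq> 0" by blast
  obtain X where X: "X \<in> vector_fields A" and Xp: "X p = u" using vector_field_extend[OF A u(1)] .
  obtain v where v: "v \<in> tangent_space A p" "\<phi> (i p) (di p u) = di p v"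
    using invariant_xi_perp_submanifoldD(3)[OF inv u(1)] by blast
  \<comment> \<open>\<open>Y\<close> agrees with \<open>\<phi> X\<close> at \<open>p\<close> only,
    which is enough to bring in the Gauss formula.\<close>
  obtain Y where Y: "Y \<in> vector_fields A" and Yp: "Y p = v" using vector_field_extend[OF A v(1)] .
  define W where "W = (\<lambda>q. di q (X q))"
  define K where "K = (\<lambda>q. h q (X q) (X q))"
  define M where "M = (\<lambda>q. \<phi> (i q) (K q))"
  have W: "W \<in> sections_along A B i" unfolding W_def by (rule differential_along[OF A B i X])
  have K: "K \<in> sections_along A B i" and KN: "K q \<in> N q" for q
    unfolding K_def by (rule h_section[OF X X], rule h_normal[OF X X])
  have M: "M \<in> sections_along A B i" unfolding M_def by (rule endomorphism_along[OF A B i acmD(1) K])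
  have MN: "M q \<in> N q" for q unfolding M_def by (rule \<phi>_normal[OF KN])
  have \<phi>W: "(\<lambda>q. \<phi> (i q) (W q)) \<in> sections_along A B i" by (rule endomorphism_along[OF A B i acmD(1) W])
  have Y': "(\<lambda>q. di q (Y q)) \<in> sections_along A B i" by (rule differential_along[OF A B i Y])
  have o1: "g' (i q) (\<phi> (i q) (W q)) (M q) = 0" for q
    using invariant_xi_perp_submanifoldD(3)[OF inv vector_field_tangent[OF X], of q] normalD(2)[OF MN] by (auto simp: W_def)
  \<comment> \<open>The sections \<open>\<phi> W\<close> and \<open>di Y\<close> are both orthogonal
    to \<open>M\<close> and coincide at \<open>p\<close>. Moving the derivative onto
    \<open>M\<close> gives the same term for both, so their derivatives have the same product with
    \<open>M p\<close>.\<close>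
  have "g' (i p) (nabla_i X (\<lambda>q. \<phi> (i q) (W q)) p) (M p) + g' (i p) (\<phi> (i p) (W p)) (nabla_i X M p) = 0"
    by (rule pullback_connection_metric_orthogonal[OF A B i acmD(3) nabla' pull X \<phi>W M]) (rule o1)
  moreover have "\<phi> (i p) (W p) = di p v" using v(2) by (simp only: W_def Xp)
  ultimately have 1: "g' (i p) (nabla_i X (\<lambda>q. \<phi> (i q) (W q)) p) (M p) + g' (i p) (di p v) (nabla_i X M p) = 0"
    by (simp only:)
  have o2: "g' (i q) (di q (Y q)) (M q) = 0" for q by (rule normalD(2)[OF MN vector_field_tangent[OF Y]])
  have "g' (i p) (nabla_i X (\<lambda>q. di q (Y q)) p) (M p) + g' (i p) (di p (Y p)) (nabla_i X M p) = 0"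
    by (rule pullback_connection_metric_orthogonal[OF A B i acmD(3) nabla' pull X Y' M]) (rule o2)
  then have 2: "g' (i p) (di p (nabla X Y p) + h p u v) (M p) + g' (i p) (di p v) (nabla_i X M p) = 0"
    by (simp only: gauss[OF X Y] Yp Xp)
  have "g p u v = 0"
  proof -
    have "g' (i p) (di p v) (di p u) + g' (i p) (di p u) (di p v) = 0"
      using acmD(8)[OF di_tangent[OF u(1)] di_tangent[OF u(1)]] v(2) by simp
    then show ?thesis using inner_product_onD(3)[OF ip' di_tangent[OF u(1)] di_tangent[OF v(1)]]
      by (simp add: induced_metric_def)
  qed
  then have h0: "h p u v = 0" using umb[OF X Y] Xp Yp by simp
  have tan: "g' (i p) (di p (nabla X Z p)) (M p) = 0" if "Z \<in> vector_fields A" for Z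
    by (rule normalD(2)[OF MN vector_field_tangent[OF levi_civitaD(1)[OF nabla X that]]])
  have 3: "g' (i p) (nabla_i X (\<lambda>q. \<phi> (i q) (W q)) p) (M p) = 0"
    using 1 2 tan[OF Y] by (simp only: h0 add_0_right)
  obtain r w where "nabla_i X (\<lambda>q. \<phi> (i q) (W q)) p = r *\<^sub>R \<xi> (i p) - \<eta> (i p) (W p) *\<^sub>R w + \<phi> (i p) (nabla_i X W p)"
    using generalized_quasi_sasakian_along[OF A B i gqs pull X W] by blast
  moreover have "\<eta> (i p) (W p) = 0"
    using acmD(7)[OF section_tangent[OF W]] normalD(2)[OF invariant_xi_perp_submanifoldD(2)[OF inv] vector_field_tangent[OF X]]
    by (simp add: W_def)
  ultimately have e: "nabla_i X (\<lambda>q. \<phi> (i q) (W q)) p = r *\<^sub>R \<xi> (i p) + \<phi> (i p) (nabla_i X W p)"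
    by (simp only: scaleR_zero_left diff_zero)
  note \<xi>t = vector_field_tangent[OF acmD(2), of "i p"] and Kt = section_tangent[OF K, of p] and Mt = section_tangent[OF M, of p]
  have dt: "di p (nabla X X p) \<in> tangent_space B (i p)"
    by (rule di_tangent[OF vector_field_tangent[OF levi_civitaD(1)[OF nabla X X]]])
  have "\<phi> (i p) (nabla_i X W p) = \<phi> (i p) (di p (nabla X X p)) + M p"
    unfolding W_def gauss[OF X X] M_def K_def
    by (rule linear_on_subspaceD(1)[OF acmD(10) dt Kt[unfolded K_def]])
  moreover obtain z where z: "z \<in> tangent_space A p" "\<phi> (i p) (di p (nabla X X p)) = di p z"
    using invariant_xi_perp_submanifoldD(3)[OF inv vector_field_tangent[OF levi_civitaD(1)[OF nabla X X]]] by blast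
  ultimately have e': "nabla_i X (\<lambda>q. \<phi> (i q) (W q)) p = r *\<^sub>R \<xi> (i p) + (di p z + M p)" using e by simp
  \<comment> \<open>Of the three components only \<open>M p\<close> survives: \<open>di p z\<close>
    is tangential, and \<open>\<xi>\<close> is orthogonal to the image of
    \<open>\<phi>\<close>.\<close>
  have "g' (i p) (r *\<^sub>R \<xi> (i p) + (di p z + M p)) (M p) =
      r * g' (i p) (\<xi> (i p)) (M p) + (g' (i p) (di p z) (M p) + g' (i p) (M p) (M p))"
    using \<xi>t di_tangent[OF z(1)] Mt sub'
    by (simp add: inner_product_on_add_left[OF ip'] inner_product_on_scaleR_left[OF ip'] subspace_add subspace_scale del: plus_fun_apply)
  moreover have "g' (i p) (\<xi> (i p)) (M p) = 0"
    using acmD(6)[OF Kt] acmD(7)[OF Mt] inner_product_onD(3)[OF ip' \<xi>t Mt] by (simp add: M_def)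
  moreover have "g' (i p) (di p z) (M p) = 0" by (rule normalD(2)[OF MN z(1)])
  ultimately have "g' (i p) (M p) (M p) = 0" using 3 e' by simp
  then have "M p = 0" using inner_product_onD(4)[OF ip' Mt] by fastforce
  moreover have "\<phi> (i p) (0 *\<^sub>R \<xi> (i p)) = 0 *\<^sub>R \<phi> (i p) (\<xi> (i p))"
    by (rule linear_on_subspaceD(2)[OF acmD(10) \<xi>t])
  \<comment> \<open>Applying \<open>\<phi>\<close> once more makes its square available, which is
    the identity up to sign and a multiple of \<open>\<xi>\<close>.\<close>
  ultimately have "\<phi> (i p) (\<phi> (i p) (K p)) = 0" by (simp add: M_def)
  then have K1: "K p = \<eta> (i p) (K p) *\<^sub>R \<xi> (i p)" using acmD(4)[OF Kt] by (simp only: neg_eq_iff_add_eq_0 minus_minus add_eq_0_iff)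
  have K2: "K p = g p u u *\<^sub>R H" using umb[OF X X] by (simp add: K_def Xp)
  have "g p u u > 0" by (rule inner_product_onD(4)[OF ip u])
  then have "H = inverse (g p u u) *\<^sub>R (g p u u *\<^sub>R H)" by simp
  also have "g p u u *\<^sub>R H = \<eta> (i p) (K p) *\<^sub>R \<xi> (i p)" by (rule trans[OF K2[symmetric] K1])
  finally have "H = (inverse (g p u u) * \<eta> (i p) (K p)) *\<^sub>R \<xi> (i p)" by (simp only: scaleR_scaleR)
  then show ?thesis by blast
qed

text \<open>Since \<open>\<xi>\<close> is a unit vector, \<open>t *\<^sub>R u\<close> satisfies the
  defining equation; positive definiteness of \<open>g\<close> makes it the only solution, as
  \<open>THE\<close> demands.\<close>

lemma shape_operator_scaleR:
  assumes h: "\<And>u v. u \<in> tangent_space A p \<Longrightarrow> v \<in> tangent_space A p \<Longrightarrow> h p u v = (g p u v * t) *\<^sub>R \<xi> (i p)"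
    and u: "u \<in> tangent_space A p"
  shows "shape_operator A B i g' h p (\<xi> (i p)) u = t *\<^sub>R u"
  unfolding shape_operator_def
proof (rule the_equality)
  note sub = subspace_tangent_space[OF A, of p]
  note \<xi>t = vector_field_tangent[OF acmD(2), of "i p"]
  have \<xi>1: "g' (i p) (\<xi> (i p)) (\<xi> (i p)) = 1" using acmD(5,7) \<xi>t by metis
  have 1: "g' (i p) (h p u v) (\<xi> (i p)) = t * g p u v" if v: "v \<in> tangent_space A p" for v
    using h[OF u v] inner_product_on_scaleR_left[OF ip' \<xi>t \<xi>t] \<xi>1 by simp
  have 2: "g p (t *\<^sub>R u) v = t * g p u v" if v: "v \<in> tangent_space A p" for v
    by (rule inner_product_on_scaleR_left[OF ip u v])
  show "t *\<^sub>R u \<in> tangent_space A p \<and>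
      (\<forall>v\<in>tangent_space A p. g' (i p) (h p u v) (\<xi> (i p)) = g p (t *\<^sub>R u) v)"
    using 1 2 subspace_scale[OF sub u] by simp
  fix w assume w: "w \<in> tangent_space A p \<and>
      (\<forall>v\<in>tangent_space A p. g' (i p) (h p u v) (\<xi> (i p)) = g p w v)"
  \<comment> \<open>The difference of two solutions is orthogonal to every tangent vector, in
    particular to itself.\<close>
  define d where "d = w + (- t) *\<^sub>R u"
  have d: "d \<in> tangent_space A p" unfolding d_def using w u by (intro subspace_add[OF sub] subspace_scale[OF sub]) auto
  have "g p d d = g p w d + (- t) * g p u d"
    using w u d subspace_scale[OF sub u] unfolding d_def
    by (simp only: inner_product_on_add_left[OF ip] inner_product_on_scaleR_left[OF ip])
  also have "\<dots> = 0" using w 1[OF d] d by simp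
  finally have "d = 0" using inner_product_onD(4)[OF ip d] by fastforce
  then show "w = t *\<^sub>R u" unfolding d_def by (simp only: scaleR_minus_left add_eq_0_iff minus_minus add.right_inverse eq_neg_iff_add_eq_0 neg_eq_iff_add_eq_0)
qed

text \<open>Umbilicity speaks of vector fields, whereas the shape operator and the metric trace
  evaluate \<open>h\<close> on single vectors.\<close>

lemma h_tangent_vectors:
  assumes "\<And>X Y. X \<in> vector_fields A \<Longrightarrow> Y \<in> vector_fields A \<Longrightarrow> h p (X p) (Y p) = g p (X p) (Y p) *\<^sub>R H"
    and uv: "u \<in> tangent_space A p" "v \<in> tangent_space A p"
  shows "h p u v = g p u v *\<^sub>R H"
proof -
  obtain X where "X \<in> vector_fields A" "X p = u" using vector_field_extend[OF A uv(1)] .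
  moreover obtain Y where "Y \<in> vector_fields A" "Y p = v" using vector_field_extend[OF A uv(2)] .
  ultimately show ?thesis using assms(1) by blast
qed

text \<open>If the mean curvature vector is \<open>t \<xi>\<close>, the shape operator of
  \<open>\<xi>\<close> is \<open>t\<close> times the identity with trace \<open>m t\<close>, so the
  two coefficients agree. Conversely, taking the metric trace of the given formula recovers the mean
  curvature vector.\<close>

lemma umbilical_point_iff:
  "(\<forall>X\<in>vector_fields A. \<forall>Y\<in>vector_fields A. h p (X p) (Y p) = g p (X p) (Y p) *\<^sub>R mean_curvature A B i g' h p) \<longleftrightarrow>
    (\<forall>X\<in>vector_fields A. \<forall>Y\<in>vector_fields A. h p (X p) (Y p) =
      (1 / real DIM('e) * g p (X p) (Y p) *
        trace_on (tangent_space A p) (shape_operator A B i g' h p (\<xi> (i p)))) *\<^sub>R \<xi> (i p))"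
    (is "?L \<longleftrightarrow> ?R")
proof
  obtain Bs where Bs: "finite Bs" "independent Bs" "span Bs = tangent_space A p"
    using tangent_space_basis[OF A] .
  show ?R if ?L
  proof -
    let ?H = "mean_curvature A B i g' h p"
    have umb: "h p (X p) (Y p) = g p (X p) (Y p) *\<^sub>R ?H" if "X \<in> vector_fields A" "Y \<in> vector_fields A" for X Y
      using \<open>?L\<close> that by blast
    have "\<exists>t. ?H = t *\<^sub>R \<xi> (i p)" by (rule umbilical_point_normal_curvature) (rule umb)
    then obtain t where t: "?H = t *\<^sub>R \<xi> (i p)" by blast
    have ht: "h p u v = (g p u v * t) *\<^sub>R \<xi> (i p)" if uv: "u \<in> tangent_space A p" "v \<in> tangent_space A p" for u v
    proof -
      have "h p u v = g p u v *\<^sub>R ?H" by (rule h_tangent_vectors[OF _ uv]) (rule umb)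
      then show ?thesis by (simp only: t scaleR_scaleR)
    qed
    have "shape_operator A B i g' h p (\<xi> (i p)) u = t *\<^sub>R u" if "u \<in> tangent_space A p" for u
      by (rule shape_operator_scaleR[OF _ that]) (rule ht)
    then have "trace_on (tangent_space A p) (shape_operator A B i g' h p (\<xi> (i p))) = t * real DIM('e)"
      using trace_on_scaleR[OF Bs(2,3)] dim_tangent_space[OF A] by metis
    then show ?R by (simp add: umb t del: scaleR_fun_apply)
  qed
  show ?L if ?R
  proof -
    \<comment> \<open>The candidate read off from the formula; it is identified with the mean
      curvature by the trace below.\<close>
    define H where "H = (1 / real DIM('e) * trace_on (tangent_space A p) (shape_operator A B i g' h p (\<xi> (i p)))) *\<^sub>R \<xi> (i p)"
    have umb: "h p (X p) (Y p) = g p (X p) (Y p) *\<^sub>R H" if "X \<in> vector_fields A" "Y \<in> vector_fields A" for X Y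
      using \<open>?R\<close> that by (simp add: H_def mult.commute mult.left_commute)
    have "h p u u = g p u u *\<^sub>R H" if u: "u \<in> tangent_space A p" for u
      by (rule h_tangent_vectors[OF _ u u]) (rule umb)
    then have "metric_trace (tangent_space A p) (g p) (h p) = real (dim (tangent_space A p)) *\<^sub>R H"
      by (rule metric_trace_scaleR[OF ip Bs(1,3)])
    then have "mean_curvature A B i g' h p = H"
      by (simp add: mean_curvature_def dim_tangent_space[OF A])
    then show ?L using umb by simp
  qed
qed

end

theorem theorem5:
  fixes A :: "('p::{t2_space,second_countable_topology}, 'e::euclidean_space) atlas"
    and B :: "('q::{t2_space,second_countable_topology}, 'f::euclidean_space) atlas"
    and \<phi> :: "'q \<Rightarrow> 'q tvec \<Rightarrow> 'q tvec"
    and \<xi> :: "'q \<Rightarrow> 'q tvec"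
    and \<eta> :: "'q \<Rightarrow> 'q tvec \<Rightarrow> real"
    and g' :: "'q \<Rightarrow> 'q tvec \<Rightarrow> 'q tvec \<Rightarrow> real"
    and nabla' :: "('q \<Rightarrow> 'q tvec) \<Rightarrow> ('q \<Rightarrow> 'q tvec) \<Rightarrow> 'q \<Rightarrow> 'q tvec"
    and i :: "'p \<Rightarrow> 'q"
    and g :: "'p \<Rightarrow> 'p tvec \<Rightarrow> 'p tvec \<Rightarrow> real"
    and nabla :: "('p \<Rightarrow> 'p tvec) \<Rightarrow> ('p \<Rightarrow> 'p tvec) \<Rightarrow> 'p \<Rightarrow> 'p tvec"
    and nabla_i :: "('p \<Rightarrow> 'p tvec) \<Rightarrow> ('p \<Rightarrow> 'q tvec) \<Rightarrow> 'p \<Rightarrow> 'q tvec"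
    and h :: "'p \<Rightarrow> 'p tvec \<Rightarrow> 'p tvec \<Rightarrow> 'q tvec"
    and m n :: nat
  assumes "smooth_atlas A" and "DIM('e) = m"
    and "smooth_atlas B" and "DIM('f) = 2 * n + 1"
    and "generalized_quasi_sasakian B \<phi> \<xi> \<eta> g' nabla'"
    and "invariant_xi_perp_submanifold A B i \<phi> \<xi> g'"
    and "g = induced_metric B i g'"
    and "levi_civita A g nabla"
    and "pullback_connection A B i nabla' nabla_i"
    and "second_fundamental_form A B i g' nabla nabla_i h"
  shows "totally_umbilical A B i g' h \<longleftrightarrow>
    (\<forall>X\<in>vector_fields A. \<forall>Y\<in>vector_fields A. \<forall>p.
      h p (X p) (Y p) =
      (1 / real m * g p (X p) (Y p) *
        trace_on (tangent_space A p) (shape_operator A B i g' h p (\<xi> (i p)))) *\<^sub>R \<xi> (i p))"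
proof -
  interpret gqs_invariant_submanifold A B \<phi> \<xi> \<eta> g' nabla' i nabla nabla_i h
    by unfold_locales (use assms in simp_all)
  \<comment> \<open>The equivalence holds at each point, so only the quantifiers have to be
    rearranged.\<close>
  show ?thesis
    using umbilical_point_iff unfolding totally_umbilical_def assms(7) assms(2)[symmetric] by blast
qed

end
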